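(* Let $\beta\ge2/3$ and let $F$ be the neighbor function on $[0,1)^3$ defined in the context. Then $F$ extends continuously to $[0,1]^3$, and for each $\ell\in\{1,2,3\}$ the restriction of this continuous extension to the side face $\{r\in[0,1]^3:r_\ell=1\}$ is given by $$F|_{r_\ell=1}=\frac{\Gamma(2\beta)\Gamma(3\beta-1)}{\Gamma(\beta)\Gamma(4\beta-1)}\prod_{j\in\{1,2,3\}\setminus\{\ell\}}f_\beta(r_j).$$
   Context: $\mathbb N_0=\{0,1,2,\dots\}$, $r^n=r_1^{n_1}r_2^{n_2}r_3^{n_3}$, $e_j$ is the $j$-th unit vector of $\mathbb Z^3$. $f_\beta(x)={}_2F_1(1-\beta,\beta;2\beta;x)$, which for $\beta>1/2$ is continuous on $[0,1]$. The neighbor function: for $\beta>0$, $A,B:\mathbb N_0^3\to\mathbb R$, extended by $0$ to $\mathbb Z^3$, are the unique pair with $A_{(0,0,0)}=1$ such that for all $n\in\mathbb Z^3$ and all $\{j,k,\ell\}=\{1,2,3\}$, $$(n_\ell+1)(n_\ell+2\beta)A_{n+e_\ell}-(n_\ell+\beta)(n_\ell+1-\beta)A_n=B_n-B_{n-e_j}-B_{n-e_k}+B_{n-e_j-e_k},$$ $$(2n_jn_k+\beta n_j+\beta n_k+\beta n_\ell+\beta^2)A_n=B_{n-e_\ell-e_j}+B_{n-e_\ell-e_k}-B_n-B_{n-e_j-e_k}.$$ The series $\sum A_nr^n$ converges absolutely for $r\in\mathbb C^3$ with all $|r_i|<1/10$, and its sum extends analytically to a domain in $\mathbb C^3$ containing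 $[0,1)^3$; $F$ denotes this extension restricted to $[0,1)^3$. *)

theory Defs
  imports "HOL-Analysis.Analysis"
begin

text \<open>\<open>f\<^sub>\<beta>(x) = \<^sub>2F\<^sub>1(1 - \<beta>, \<beta>; 2\<beta>; x)\<close>. For \<open>\<beta> > 1/2\<close> the series also converges at \<open>x = 1\<close>.\<close>

definition f_beta :: "real \<Rightarrow> real \<Rightarrow> real" where
  "f_beta \<beta> x = eval_fps (fps_hypergeo [1 - \<beta>, \<beta>] [2 * \<beta>] 1) x"

definition zero_ext :: "(nat ^ 3 \<Rightarrow> real) \<Rightarrow> int ^ 3 \<Rightarrow> real" where
  "zero_ext A n = (if \<forall>i. 0 \<le> n $ i then A (\<chi> i. nat (n $ i)) else 0)"

abbreviation unit_vec :: "3 \<Rightarrow> int ^ 3" where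
  "unit_vec j \<equiv> axis j 1"

definition monomial3 :: "complex ^ 3 \<Rightarrow> nat ^ 3 \<Rightarrow> complex" where
  "monomial3 r n = (\<Prod>i\<in>UNIV. (r $ i) ^ (n $ i))"

text \<open>The coordinates are indexed by the three-element type \<open>3\<close>, in which the numeral \<open>3\<close>
  is the same as \<open>0\<close>, so \<open>{j, k, l} = UNIV\<close> says that \<open>j, k, l\<close> is a permutation
  of the coordinates.\<close>

definition neighbor_coeffs :: "real \<Rightarrow> (nat ^ 3 \<Rightarrow> real) \<Rightarrow> (nat ^ 3 \<Rightarrow> real) \<Rightarrow> bool" where
  "neighbor_coeffs \<beta> A B \<longleftrightarrow>
     A 0 = 1 \<and>
     (\<forall>n :: int ^ 3. \<forall>j k l :: 3. {j, k, l} = UNIV \<longrightarrow>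
        (let a = zero_ext A; b = zero_ext B; e = unit_vec in
          (real_of_int (n $ l) + 1) * (real_of_int (n $ l) + 2 * \<beta>) * a (n + e l)
            - (real_of_int (n $ l) + \<beta>) * (real_of_int (n $ l) + 1 - \<beta>) * a n
          = b n - b (n - e j) - b (n - e k) + b (n - e j - e k)
          \<and>
          (2 * real_of_int (n $ j) * real_of_int (n $ k)
             + \<beta> * real_of_int (n $ j) + \<beta> * real_of_int (n $ k) + \<beta> * real_of_int (n $ l)
             + \<beta>\<^sup>2) * a n
          = b (n - e l - e j) + b (n - e l - e k) - b n - b (n - e j - e k)))"

text \<open>Analyticity in several complex variables: near every point of the open set \<open>U\<close> the
  function is the sum of a power series, absolutely convergent on a polydisc (for complex-valued
  families \<open>has_sum\<close> is unconditional, hence absolute, summation).\<close>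

definition analytic3_on :: "(complex ^ 3 \<Rightarrow> complex) \<Rightarrow> (complex ^ 3) set \<Rightarrow> bool" where
  "analytic3_on G U \<longleftrightarrow> open U \<and>
     (\<forall>z\<in>U. \<exists>c :: nat ^ 3 \<Rightarrow> complex. \<exists>\<epsilon>>0. \<forall>w.
        (\<forall>i. norm (w $ i - z $ i) < \<epsilon>) \<longrightarrow>
          ((\<lambda>n. c n * monomial3 (w - z) n) has_sum G w) UNIV)"

definition half_open_cube :: "(real ^ 3) set" where
  "half_open_cube = {r. \<forall>i. 0 \<le> r $ i \<and> r $ i < 1}"

definition closed_cube :: "(real ^ 3) set" where
  "closed_cube = {r. \<forall>i. 0 \<le> r $ i \<and> r $ i \<le> 1}"

definition complex_vec :: "real ^ 3 \<Rightarrow> complex ^ 3" where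
  "complex_vec r = (\<chi> i. complex_of_real (r $ i))"

definition small_polydisc :: "(complex ^ 3) set" where
  "small_polydisc = {r. \<forall>i. norm (r $ i) < 1 / 10}"

text \<open>\<open>F\<close> agrees on \<open>[0,1)\<^sup>3\<close> with the analytic extension of \<open>\<Sum> A\<^sub>n r\<^sup>n\<close> to a domain
  containing \<open>[0,1)\<^sup>3\<close>. By the identity theorem this determines \<open>F\<close> on \<open>[0,1)\<^sup>3\<close>;
  its values elsewhere are irrelevant.\<close>

definition neighbor_function :: "real \<Rightarrow> (real ^ 3 \<Rightarrow> complex) \<Rightarrow> bool" where
  "neighbor_function \<beta> F \<longleftrightarrow>
     (\<exists>A B U G. neighbor_coeffs \<beta> A B \<and>
        open U \<and> connected U \<and> small_polydisc \<subseteq> U \<and> complex_vec ` half_open_cube \<subseteq> U \<and>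
        analytic3_on G U \<and>
        (\<forall>r\<in>small_polydisc.
           ((\<lambda>n. complex_of_real (A n) * monomial3 r n) has_sum G r) UNIV) \<and>
        (\<forall>r\<in>half_open_cube. F r = G (complex_vec r)))"

end

(* With L = (1 - x) (x (1 - x) d^2 + (2 \<beta> - 2 x) d - \<beta> (1 - \<beta>)), the first recurrence says that
   L_1 F = L_2 F = L_3 F, and on a coordinate axis the second one turns it into the equation of
   g = 2F1(\<beta>, 1 - 2 \<beta>; 2 \<beta>; x).  In the variable (1 + x) / (1 - x), L is a Gegenbauer (hyperbolic Laplace)
   operator, so equations of the form L_1 u = L_2 u are solved by a generalised translation: with
   W = |1 - sqrt (x y) e^(i \<theta>)|^2,
     u(x, y) = c * integral over [0, \<pi>] of sin \<theta>^(4 \<beta> - 2) W^(-\<beta>) u(X, 0) d\<theta>,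
     1 - X = (1 - x) (1 - y) / W.
   Both sides are analytic along the ray t -> (t x, t y, t z), so it is enough to compare Taylor
   coefficients at 0; these satisfy the same recurrence, since the translates of (1 - X)^l are
   ((1 - x) (1 - y))^l 2F1(\<beta> + l, l + 1 - \<beta>; 2 \<beta>; x y) by an ODE for the Gegenbauer integral.
   Applying the translation twice expresses F through g.  The resulting integral makes sense on the
   closed cube and is continuous there by dominated convergence, because W >= sin^2 \<theta>.  For x = 1
   it collapses to g(1) f(y) f(z), where g(1) is given by Gauss's theorem; the other faces follow by
   symmetry. *)

theory Submission
  imports Defs "HOL-Complex_Analysis.Complex_Analysis" "HOL-Real_Asymp.Real_Asymp"
begin

no_notation fps_nth (infixl "$" 75)

text \<open>The constants of the translation are geometric. If x is the squared radius in the ball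
  model of hyperbolic space of formal dimension 4\<beta>, then L is, up to an additive constant, the
  radial Laplacian conjugated by (1 - x)^\<beta>. The angular density in that dimension is
  sin^(4\<beta> - 2), and conjugation puts the factor ((1 - X) / ((1 - x) (1 - y)))^\<beta> =
  W^(-\<beta>) into the spherical mean. The obstacle is that F is known only as an analytic
  continuation to an unspecified domain, while sqrt (x y) is not analytic at the origin. On a ray
  sqrt (t x t y) = t sqrt (x y) is linear in t, so the integrand is holomorphic in complex t near
  [0, 1], and for t in [0, 1] all points that occur lie in the half-open cube. The translation is
  applied to the continuation itself; equality at t = 1 then follows from expansions to every finite
  order as t tends to 0 from the right. At the boundary W >= sin^2 leaves the weight sin^(2\<beta> -
  2), which for \<beta> >= 2/3 has one fixed integrable majorant.\<close>

section \<open>Holomorphic functions: parametric integrals and flatness\<close>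

text \<open>Cauchy's estimate is applied to the difference \<open>k t x - k t x0\<close> on a small
  disc: uniform continuity on a compact set makes this difference uniformly small, hence also its
  derivative.\<close>

lemma continuous_deriv_parametric:
  fixes k :: "complex \<Rightarrow> real \<Rightarrow> complex"
  assumes V: "open V" and cont: "continuous_on (V \<times> {a..b}) (\<lambda>(t, x). k t x)"
    and hol: "\<And>x. x \<in> {a..b} \<Longrightarrow> (\<lambda>t. k t x) holomorphic_on V"
  shows "continuous_on (V \<times> {a..b}) (\<lambda>(t, x). deriv (\<lambda>t. k t x) t)"
  unfolding continuous_on_iff
proof (intro ballI allI impI)
  fix p and e :: real assume p: "p \<in> V \<times> {a..b}" and "e > 0"
  obtain z x0 where p_eq: "p = (z, x0)" by (cases p)
  have z: "z \<in> V" and x0: "a \<le> x0" "x0 \<le> b" using p p_eq by auto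
  obtain r where r: "r > 0" "cball z (2*r) \<subseteq> V"
    using V z open_contains_cball_eq[of V] 
    by (metis mult.commute nonzero_eq_divide_eq zero_less_divide_iff zero_less_numeral zero_neq_numeral)
  have "uniformly_continuous_on (cball z (2*r) \<times> {a..b}) (\<lambda>(t, x). k t x)"
    by (rule compact_uniformly_continuous)
      (auto intro!: compact_Times continuous_on_subset[OF cont] simp: r subsetD[OF r(2)])
  \<comment> \<open>Discs of radius r around points within r of z lie in
    \<open>cball z (2*r)\<close>, and Cauchy's estimate on them turns e r / 4 into e / 4.\<close>
  then obtain d where d: "d > 0" "\<And>t x x'. t \<in> cball z (2*r) \<Longrightarrow> x \<in> {a..b} \<Longrightarrow> x' \<in> {a..b} \<Longrightarrow> dist x' x < d \<Longrightarrow>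
      dist (k t x') (k t x) < e * r / 4"
    unfolding uniformly_continuous_on_def using \<open>e > 0\<close> r(1)
    by (elim allE[of _ "e*r/4"]) (fastforce simp: dist_Pair_Pair)
  have "continuous_on V (deriv (\<lambda>t. k t x0))"
    using hol[of x0] x0 V by (intro holomorphic_on_imp_continuous_on holomorphic_deriv) auto
  then obtain d2 where d2: "d2 > 0" "\<And>t. t \<in> V \<Longrightarrow> dist t z < d2 \<Longrightarrow>
      dist (deriv (\<lambda>t. k t x0) t) (deriv (\<lambda>t. k t x0) z) < e / 2"
    unfolding continuous_on_iff using z \<open>e > 0\<close> by (meson half_gt_zero)
  have "dist (deriv (\<lambda>t. k t x) t) (deriv (\<lambda>t. k t x0) z) < e"
    if t: "t \<in> V" "a \<le> x" "x \<le> b" "dist (t, x) (z, x0) < min d (min d2 r)" for t x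
  proof -
    have dt: "dist t z < min d (min d2 r)"
      using that(4) dist_fst_le[of "(t,x)" "(z,x0)"] by simp
    have dx: "dist x x0 < d"
      using that(4) dist_snd_le[of "(t,x)" "(z,x0)"] by simp
    have sub: "cball t r \<subseteq> cball z (2*r)"
    proof
      fix w assume "w \<in> cball t r"
      then have "dist z w \<le> dist z t + dist t w" "dist t w \<le> r" using dist_triangle by auto
      then show "w \<in> cball z (2*r)" using dt by (simp add: dist_commute)
    qed
    have subV: "cball t r \<subseteq> V" using sub r by blast
    have "norm ((deriv ^^ 1) (\<lambda>t. k t x - k t x0) t) \<le> fact 1 * (e * r / 4) / r ^ 1"
    proof (rule Cauchy_inequality)
      show "(\<lambda>t. k t x - k t x0) holomorphic_on ball t r"
        using hol[of x] hol[of x0] that x0 subV ball_subset_cball[of t r]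
        by (intro holomorphic_on_diff holomorphic_on_subset[where t = "ball t r"]) auto
      show "continuous_on (cball t r) (\<lambda>t. k t x - k t x0)"
        using hol[of x] hol[of x0] that x0 subV
        by (intro continuous_on_diff holomorphic_on_imp_continuous_on holomorphic_on_subset[where t = "cball t r"]) auto
      fix w assume "norm (t - w) = r"
      then have "w \<in> cball z (2*r)" using sub by (auto simp: dist_norm)
      then show "norm (k w x - k w x0) \<le> e * r / 4"
        using d(2)[of w x0 x] dx that x0 by (auto simp: dist_norm)
    qed (use r in auto)
    moreover have "deriv (\<lambda>t. k t x - k t x0) t = deriv (\<lambda>t. k t x) t - deriv (\<lambda>t. k t x0) t"
      using hol[of x] hol[of x0] that x0 V
      by (intro deriv_diff) (auto intro: holomorphic_on_imp_differentiable_at)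
    ultimately have "dist (deriv (\<lambda>t. k t x) t) (deriv (\<lambda>t. k t x0) t) \<le> e / 4"
      using r by (simp add: dist_norm)
    moreover have "dist (deriv (\<lambda>t. k t x0) t) (deriv (\<lambda>t. k t x0) z) < e / 2"
      using d2 dt that by auto
    ultimately show ?thesis using \<open>e > 0\<close> dist_triangle[of "deriv (\<lambda>t. k t x) t" "deriv (\<lambda>t. k t x0) z" "deriv (\<lambda>t. k t x0) t"]
      by simp
  qed
  then show "\<exists>d>0. \<forall>q\<in>V \<times> {a..b}. dist q p < d \<longrightarrow>
      dist (case q of (t, x) \<Rightarrow> deriv (\<lambda>t. k t x) t) (case p of (t, x) \<Rightarrow> deriv (\<lambda>t. k t x) t) < e"
    using d(1) d2(1) r(1) unfolding p_eq by (intro exI[of _ "min d (min d2 r)"]) auto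
qed

lemma parametric_integral_has_field_derivative:
  fixes k :: "complex \<Rightarrow> real \<Rightarrow> complex"
  assumes V: "open V" and cont: "continuous_on (V \<times> {a..b}) (\<lambda>(t, x). k t x)"
    and hol: "\<And>x. x \<in> {a..b} \<Longrightarrow> (\<lambda>t. k t x) holomorphic_on V" and z: "z \<in> V"
  shows "((\<lambda>t. integral {a..b} (k t)) has_field_derivative integral {a..b} (\<lambda>x. deriv (\<lambda>t. k t x) z)) (at z)"
proof -
  obtain r where r: "r > 0" "ball z r \<subseteq> V"
    using V z by (auto simp: open_contains_ball)
  have "((\<lambda>t. integral (cbox a b) (k t)) has_field_derivative integral (cbox a b) (\<lambda>x. deriv (\<lambda>t. k t x) z)) (at z within ball z r)"
  proof (rule leibniz_rule_field_derivative)
    show "((\<lambda>t. k t x) has_field_derivative deriv (\<lambda>t. k t x) t) (at t within ball z r)"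
      if "t \<in> ball z r" "x \<in> cbox a b" for t x
      using that hol[of x] V r by (intro has_field_derivative_at_within[OF holomorphic_derivI[of _ V]]) auto
    show "k t integrable_on cbox a b" if "t \<in> ball z r" for t
      using r that by (auto intro!: integrable_continuous_real continuous_on_compose2[OF cont, of _ "\<lambda>x. (t, x)", simplified] continuous_intros)
    show "continuous_on (ball z r \<times> cbox a b) (\<lambda>(x, t). deriv (\<lambda>ta. k ta t) x)"
      using continuous_deriv_parametric[OF V cont hol] r
      by (auto intro: continuous_on_subset)
  qed (use r in auto)
  then show ?thesis
    using r by (simp add: at_within_open[of z "ball z r"])
qed

lemma parametric_integral_holomorphic:
  fixes k :: "complex \<Rightarrow> real \<Rightarrow> complex"
  assumes "open V" "continuous_on (V \<times> {a..b}) (\<lambda>(t, x). k t x)"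
    and "\<And>x. x \<in> {a..b} \<Longrightarrow> (\<lambda>t. k t x) holomorphic_on V"
  shows "(\<lambda>t. integral {a..b} (k t)) holomorphic_on V"
  using parametric_integral_has_field_derivative[OF assms] assms(1)
  by (auto simp: holomorphic_on_open)

text \<open>A holomorphic function that is not identically zero vanishes at 0 to some finite order
  n, and then it is not O(t^(n + 1)). Approach along positive reals suffices, and that is all the
  expansions below provide.\<close>

lemma holomorphic_flat_eq_0:
  fixes f :: "complex \<Rightarrow> complex"
  assumes hol: "f holomorphic_on V" and V: "open V" "connected V" "0 \<in> V"
    and flat: "\<And>N. (\<lambda>t. f (of_real t)) \<in> O[at_right 0](\<lambda>t. of_real t ^ N)"
    and z: "z \<in> V"
  shows "f z = 0"
proof -
  have tr: "((\<lambda>t. complex_of_real t) \<longlongrightarrow> 0) (at_right 0)"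
    by (auto intro!: tendsto_eq_intros)
  have ft: "((\<lambda>t. f (of_real t)) \<longlongrightarrow> f 0) (at_right 0)"
  proof -
    have "isCont f 0" using hol V by (metis continuous_on_eq_continuous_at holomorphic_on_imp_continuous_on)
    then show ?thesis using isCont_tendsto_compose[OF _ tr, of f] by simp
  qed
  have lim0: "c = 0" if "(g \<longlongrightarrow> c) (at_right (0::real))" and lO: "g \<in> O[at_right 0](\<lambda>t. of_real t)"
    for g :: "real \<Rightarrow> complex" and c
  proof -
    obtain C where "eventually (\<lambda>t. norm (g t) \<le> C * norm (of_real t :: complex)) (at_right 0)"
      using lO by (elim landau_o.bigE)
    moreover have "((\<lambda>t. C * norm (of_real t :: complex)) \<longlongrightarrow> 0) (at_right 0)"
      by (auto intro!: tendsto_eq_intros)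
    ultimately have "(g \<longlongrightarrow> 0) (at_right 0)" by (rule Lim_null_comparison)
    then show ?thesis using that(1) tendsto_unique[of "at_right (0::real)"] by force
  qed
  have f0: "f 0 = 0"
    using lim0[OF ft] flat[of 1] by simp
  show ?thesis
  proof (rule ccontr)
    assume nz: "f z \<noteq> 0"
    have "\<not> f constant_on V" using nz f0 V(3) z by (metis constant_on_def)
    from holomorphic_factor_zero_nonconstant[OF hol V(1,2,3) f0 this]
    obtain g r n where g: "0 < n" "0 < r" "ball 0 r \<subseteq> V" "g holomorphic_on ball 0 r"
      "\<And>w. w \<in> ball 0 r \<Longrightarrow> f w = (w - 0)^n * g w" "\<And>w. w \<in> ball 0 r \<Longrightarrow> g w \<noteq> 0"
      by metis
    have "isCont g 0" using g(2,4) by (metis centre_in_ball continuous_on_eq_continuous_at holomorphic_on_imp_continuous_on open_ball)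
    then have gt: "((\<lambda>t. g (of_real t)) \<longlongrightarrow> g 0) (at_right 0)"
      using isCont_tendsto_compose[OF _ tr, of g] by simp
    have ev: "eventually (\<lambda>t::real. of_real t \<in> ball (0::complex) r \<and> t \<noteq> 0) (at_right 0)"
      using g(2) by (auto simp: eventually_at_right_field intro!: exI[of _ r])
    \<comment> \<open>Dividing the bound O(t^(n + 1)) by t^n leaves g = O(t), which contradicts that
      g does not vanish at 0.\<close>
    obtain C where "eventually (\<lambda>t. norm (f (of_real t)) \<le> C * norm (of_real t ^ Suc n :: complex)) (at_right 0)"
      using flat[of "Suc n"] by (elim landau_o.bigE)
    with ev have "eventually (\<lambda>t. norm (g (of_real t)) \<le> C * norm (of_real t :: complex)) (at_right 0)"
      by eventually_elim (simp add: g(5) norm_mult norm_power mult.left_commute[of C] mult.commute[of C])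
    then have "(\<lambda>t. g (of_real t)) \<in> O[at_right 0](\<lambda>t::real. of_real t)"
      by (rule bigoI)
    from lim0[OF gt this] show False using g(6)[of 0] g(2) by simp
  qed
qed

section \<open>The Gegenbauer integral\<close>

text \<open>For real \<open>\<rho>\<close> this is \<open>|1 - \<rho> exp(\<i>x)|\<^sup>2\<close>.\<close>

definition gkern :: "'a :: {real_normed_field, banach} \<Rightarrow> real \<Rightarrow> 'a" where
  "gkern \<rho> x = 1 - 2 * \<rho> * of_real (cos x) + \<rho>\<^sup>2"

lemma gkern_of_real: "gkern (of_real \<rho>) x = of_real (gkern \<rho> x)"
  by (simp add: gkern_def)

text \<open>W = (1 - \<rho> exp(ix)) (1 - \<rho> exp(-ix)) is a product of two numbers with positive
  real part, so its argument stays in (-pi, pi) and its principal powers are holomorphic in the unit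
  disc.\<close>

lemma gkern_notin_nonpos_Reals:
  assumes "norm (\<rho> :: complex) < 1"
  shows "gkern \<rho> x \<notin> \<real>\<^sub>\<le>\<^sub>0"
proof
  assume *: "gkern \<rho> x \<in> \<real>\<^sub>\<le>\<^sub>0"
  define u v c where "u = Re \<rho>" and "v = Im \<rho>" and "c = cos x"
  have c: "c\<^sup>2 \<le> 1" unfolding c_def by (simp add: abs_square_le_1)
  have n: "u\<^sup>2 + v\<^sup>2 < 1"
    using assms by (simp add: u_def v_def cmod_def real_sqrt_lt_1_iff)
  \<comment> \<open>The imaginary part is 2 v (u - c) up to sign: either \<rho> is real, or u = c
    and then the real part equals 1 - |\<rho>|^2.\<close>
  have re: "1 - 2 * u * c + (u\<^sup>2 - v\<^sup>2) \<le> 0" and im: "2 * v * (u - c) = 0"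
    using * by (auto simp: complex_nonpos_Reals_iff gkern_def u_def v_def c_def power2_eq_square algebra_simps)
  show False
  proof (cases "v = 0")
    case True
    have "1 - 2 * u * c + u\<^sup>2 = (u - c)\<^sup>2 + (1 - c\<^sup>2)" by (simp add: power2_eq_square algebra_simps)
    with re True have "(u - c)\<^sup>2 + (1 - c\<^sup>2) \<le> 0" by simp
    then have "(u - c)\<^sup>2 = 0" "c\<^sup>2 = 1"
      using c zero_le_power2[of "u - c"] by linarith+
    with n True show False by simp
  next
    case False
    with im have "u = c" by simp
    with re n show False by (simp add: power2_eq_square)
  qed
qed

lemma gkern_ge_sin_squared: "(sin x)\<^sup>2 \<le> gkern (\<rho> :: real) x"
proof -
  have "gkern \<rho> x = (\<rho> - cos x)\<^sup>2 + (1 - (cos x)\<^sup>2)"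
    by (simp add: gkern_def power2_eq_square algebra_simps)
  then show ?thesis by (simp add: sin_squared_eq)
qed

lemma gkern_nonneg: "0 \<le> gkern (\<rho> :: real) x"
  using gkern_ge_sin_squared[of x \<rho>] zero_le_power2[of "sin x"] by linarith

lemma gkern_pos:
  assumes "\<bar>\<rho>\<bar> < (1 :: real)"
  shows "0 < gkern \<rho> x"
proof -
  have "gkern (complex_of_real \<rho>) x \<notin> \<real>\<^sub>\<le>\<^sub>0"
    by (rule gkern_notin_nonpos_Reals) (use assms in simp)
  then show ?thesis by (simp add: gkern_of_real)
qed

lemma continuous_on_gkern [continuous_intros]:
  fixes f :: "'b :: t2_space \<Rightarrow> 'a :: {real_normed_field, banach}"
  assumes "continuous_on A f" "continuous_on A h"
  shows "continuous_on A (\<lambda>p. gkern (f p) (h p))"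
  unfolding gkern_def by (intro continuous_intros assms)

lemma holomorphic_on_gkern [holomorphic_intros]:
  assumes "f holomorphic_on A"
  shows "(\<lambda>t. gkern (f t) x) holomorphic_on A"
  unfolding gkern_def by (intro holomorphic_intros assms)

text \<open>With \<open>u = W powr s\<close>, \<open>W = gkern \<rho> x\<close>, \<open>c = cos x\<close> and \<open>\<vartheta> = \<rho> d/d\<rho>\<close>, this is
  \<open>\<vartheta>(\<vartheta> + \<mu>)u - \<rho>\<^sup>2(\<vartheta> - 2s)(\<vartheta> - 2s - \<mu>)u + (1 - \<rho>\<^sup>2)(u\<^sub>x\<^sub>x + \<mu> cot x u\<^sub>x) = 0\<close>,
  divided by \<open>W powr (s - 2)\<close>.\<close>

lemma gkern_ode_identity:
  fixes \<rho> c s m W :: complex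
  assumes W: "W = 1 - 2 * \<rho> * c + \<rho>\<^sup>2"
  shows "(1 - \<rho>\<^sup>2) * \<rho>\<^sup>2 * (s * ((s - 1) * (2 * \<rho> - 2 * c)\<^sup>2 + 2 * W))
      + ((1 + m) - (1 - 4 * s - m) * \<rho>\<^sup>2) * \<rho> * (s * W * (2 * \<rho> - 2 * c))
      - 2 * s * (2 * s + m) * \<rho>\<^sup>2 * W\<^sup>2
      + (1 - \<rho>\<^sup>2) * (2 * s * \<rho>) * ((m + 1) * c * W + (s - 1) * (2 * \<rho>) * (1 - c\<^sup>2)) = 0"
  using W by algebra

text \<open>Here \<open>w\<close> stands for the power of the sine and \<open>P\<close> for W^(s -
  2). With W^(s - 1) and W^s written as P W and P W^2, the pointwise equation is w P times the
  polynomial identity above.\<close>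

lemma gkern_ode_integrand:
  fixes \<rho> c s m W w P :: complex
  assumes W: "W = 1 - 2 * \<rho> * c + \<rho>\<^sup>2"
  shows "(1 - \<rho>\<^sup>2) * \<rho>\<^sup>2 * (w * s * ((s - 1) * P * (2 * \<rho> - 2 * c)\<^sup>2 + 2 * (P * W)))
      + ((1 + m) - (1 - 4 * s - m) * \<rho>\<^sup>2) * \<rho> * (w * (s * (P * W) * (2 * \<rho> - 2 * c)))
      - 2 * s * (2 * s + m) * \<rho>\<^sup>2 * (w * (P * W\<^sup>2))
      + (1 - \<rho>\<^sup>2) * (2 * s * \<rho>) * (w * ((m + 1) * c * (P * W) + (s - 1) * (2 * \<rho>) * (1 - c\<^sup>2) * P)) = 0"
  (is "?l = 0")
proof -
  have "?l = w * P * ((1 - \<rho>\<^sup>2) * \<rho>\<^sup>2 * (s * ((s - 1) * (2 * \<rho> - 2 * c)\<^sup>2 + 2 * W))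
      + ((1 + m) - (1 - 4 * s - m) * \<rho>\<^sup>2) * \<rho> * (s * W * (2 * \<rho> - 2 * c))
      - 2 * s * (2 * s + m) * \<rho>\<^sup>2 * W\<^sup>2
      + (1 - \<rho>\<^sup>2) * (2 * s * \<rho>) * ((m + 1) * c * W + (s - 1) * (2 * \<rho>) * (1 - c\<^sup>2)))"
    by algebra
  then show ?thesis using gkern_ode_identity[OF W, of s m] by simp
qed

text \<open>The parameter is complex so that the power series at 0 is known to converge in the whole
  unit disc.\<close>

definition gint :: "real \<Rightarrow> real \<Rightarrow> complex \<Rightarrow> complex" where
  "gint \<mu> s \<rho> = integral {0..pi} (\<lambda>x. of_real (sin x powr \<mu>) * gkern \<rho> x powr of_real s)"

lemma continuous_on_sin_powr [continuous_intros]: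
  assumes "\<mu> > 0"
  shows "continuous_on {0..pi} (\<lambda>x. sin x powr \<mu>)"
  using assms by (intro continuous_on_powr' continuous_intros) (auto simp: sin_ge_zero)

lemma DERIV_gkern_powr:
  fixes \<rho> :: complex
  assumes "norm \<rho> < 1"
  shows "((\<lambda>\<rho>. gkern \<rho> x powr s) has_field_derivative
           s * gkern \<rho> x powr (s - 1) * (2 * \<rho> - 2 * of_real (cos x))) (at \<rho>)"
proof -
  have "((\<lambda>\<rho>. gkern \<rho> x) has_field_derivative (2 * \<rho> - 2 * of_real (cos x))) (at \<rho>)"
    unfolding gkern_def by (auto intro!: derivative_eq_intros)
  from DERIV_chain2[OF has_field_derivative_powr[OF gkern_notin_nonpos_Reals[OF assms]] this]
  show ?thesis .
qed

lemma continuous_on_gkern_powr: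
  fixes f :: "'b :: t2_space \<Rightarrow> complex"
  assumes "continuous_on A f" "continuous_on A h" "\<And>p. p \<in> A \<Longrightarrow> norm (f p) < 1"
  shows "continuous_on A (\<lambda>p. gkern (f p) (h p) powr (s :: complex))"
proof (intro continuous_on_powr_complex continuous_intros assms)
  have *: "Re (gkern (f p) (h p)) \<ge> 0 \<or> Im (gkern (f p) (h p)) \<noteq> 0" "gkern (f p) (h p) \<noteq> 0" if "p \<in> A" for p
    using gkern_notin_nonpos_Reals[OF assms(3)[OF that], of "h p"] by (auto simp: complex_nonpos_Reals_iff)
  show "A \<subseteq> {p. Re (gkern (f p) (h p)) \<ge> 0 \<or> Im (gkern (f p) (h p)) \<noteq> 0}"
    using * by blast
  show "Re s > 0" if "p \<in> A" "gkern (f p) (h p) = 0" for p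
    using * that by blast
qed

lemma DERIV_gint:
  assumes \<mu>: "\<mu> > 0" and \<rho>: "norm \<rho> < 1"
  shows "(gint \<mu> s has_field_derivative
     integral {0..pi} (\<lambda>x. of_real (sin x powr \<mu>) * (of_real s * gkern \<rho> x powr (of_real s - 1)
        * (2 * \<rho> - 2 * of_real (cos x))))) (at \<rho>)" (is ?t1)
    and "(deriv (gint \<mu> s) has_field_derivative
     integral {0..pi} (\<lambda>x. of_real (sin x powr \<mu>) * of_real s *
        ((of_real s - 1) * gkern \<rho> x powr (of_real s - 2) * (2 * \<rho> - 2 * of_real (cos x))\<^sup>2
          + 2 * gkern \<rho> x powr (of_real s - 1)))) (at \<rho>)" (is ?t2)
proof -
  let ?w = "\<lambda>x. complex_of_real (sin x powr \<mu>)"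
  let ?k1 = "\<lambda>t x. ?w x * gkern t x powr of_real s"
  let ?k2 = "\<lambda>t x. ?w x * (of_real s * gkern t x powr (of_real s - 1) * (2 * t - 2 * of_real (cos x)))"
  have d1: "((\<lambda>t. ?k1 t x) has_field_derivative ?k2 t x) (at t)" if "norm t < 1" for t x
    using DERIV_cmult[OF DERIV_gkern_powr[OF that, of x "of_real s"], of "?w x"] by (simp add: mult_ac)
  have d2: "((\<lambda>t. ?k2 t x) has_field_derivative ?w x * of_real s *
        ((of_real s - 1) * gkern t x powr (of_real s - 2) * (2 * t - 2 * of_real (cos x))\<^sup>2
          + 2 * gkern t x powr (of_real s - 1))) (at t)" if "norm t < 1" for t x
    by (rule derivative_eq_intros DERIV_gkern_powr that refl)+
      (simp add: algebra_simps power2_eq_square diff_diff_eq)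
  have w: "continuous_on (ball 0 1 \<times> {0..pi}) (\<lambda>p. ?w (snd p))"
    by (rule continuous_on_compose2[of "{0..pi}" ?w]) (use \<mu> in \<open>auto intro!: continuous_intros\<close>)
  have h1: "(\<lambda>t. ?k1 t x) holomorphic_on ball 0 1" and h2: "(\<lambda>t. ?k2 t x) holomorphic_on ball 0 1" for x
    unfolding holomorphic_on_open[OF open_ball] by (intro ballI exI, rule d1 d2, simp)+
  have D1: "(gint \<mu> s has_field_derivative integral {0..pi} (?k2 t)) (at t)" if "norm t < 1" for t
  proof -
    have "((\<lambda>t. integral {0..pi} (?k1 t)) has_field_derivative integral {0..pi} (\<lambda>x. deriv (\<lambda>t. ?k1 t x) t)) (at t)"
      by (rule parametric_integral_has_field_derivative[where V = "ball 0 1"])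
        (use that in \<open>auto simp: split_def intro!: h1 continuous_intros w continuous_on_gkern_powr\<close>)
    moreover have "deriv (\<lambda>t. ?k1 t x) t = ?k2 t x" for x
      by (rule DERIV_imp_deriv[OF d1[OF that]])
    ultimately show ?thesis unfolding gint_def[abs_def] by simp
  qed
  show ?t1 by (rule D1[OF \<rho>])
  have e1: "((\<lambda>t. integral {0..pi} (?k2 t)) has_field_derivative integral {0..pi} (\<lambda>x. deriv (\<lambda>t. ?k2 t x) \<rho>)) (at \<rho>)"
    by (rule parametric_integral_has_field_derivative[where V = "ball 0 1"])
      (use \<rho> in \<open>auto simp: split_def intro!: h2 continuous_intros w continuous_on_gkern_powr\<close>)
  have e2: "eventually (\<lambda>t. integral {0..pi} (?k2 t) = deriv (gint \<mu> s) t) (nhds \<rho>)"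
    using eventually_nhds_in_open[of "ball 0 1" \<rho>] \<rho>
    by (auto elim!: eventually_mono simp: DERIV_imp_deriv[OF D1])
  have "(deriv (gint \<mu> s) has_field_derivative integral {0..pi} (\<lambda>x. deriv (\<lambda>t. ?k2 t x) \<rho>)) (at \<rho>)"
    by (rule DERIV_cong_ev[OF refl e2 refl, THEN iffD1, OF e1])
  moreover have "deriv (\<lambda>t. ?k2 t x) \<rho> = ?w x * of_real s *
        ((of_real s - 1) * gkern \<rho> x powr (of_real s - 2) * (2 * \<rho> - 2 * of_real (cos x))\<^sup>2
          + 2 * gkern \<rho> x powr (of_real s - 1))" for x
    by (rule DERIV_imp_deriv[OF d2[OF \<rho>]])
  ultimately show ?t2 by simp
qed

text \<open>After multiplication by sin^\<mu>, the terms with x-derivatives become 1 - \<rho>^2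
  times the total derivative of 2 s \<rho> sin^(\<mu> + 1) W^(s - 1). It integrates to 0 because the
  sine vanishes at both ends; the rest is differentiation under the integral sign.\<close>

lemma gint_ode:
  assumes \<mu>: "\<mu> > 0" and \<rho>: "norm \<rho> < 1"
  shows "(1 - \<rho>\<^sup>2) * \<rho>\<^sup>2 * deriv (deriv (gint \<mu> s)) \<rho>
     + ((1 + of_real \<mu>) - (1 - 4 * of_real s - of_real \<mu>) * \<rho>\<^sup>2) * \<rho> * deriv (gint \<mu> s) \<rho>
     - 2 * of_real s * (2 * of_real s + of_real \<mu>) * \<rho>\<^sup>2 * gint \<mu> s \<rho> = 0"
proof -
  let ?w = "\<lambda>x. complex_of_real (sin x powr \<mu>)"
  let ?s = "complex_of_real s" and ?m = "complex_of_real \<mu>"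
  let ?g0 = "\<lambda>x. ?w x * gkern \<rho> x powr ?s"
  let ?g1 = "\<lambda>x. ?w x * (?s * gkern \<rho> x powr (?s - 1) * (2 * \<rho> - 2 * of_real (cos x)))"
  let ?g2 = "\<lambda>x. ?w x * ?s * ((?s - 1) * gkern \<rho> x powr (?s - 2) * (2 * \<rho> - 2 * of_real (cos x))\<^sup>2
          + 2 * gkern \<rho> x powr (?s - 1))"
  let ?K = "\<lambda>x. complex_of_real (sin x powr (\<mu> + 1)) * gkern \<rho> x powr (?s - 1)"
  let ?K' = "\<lambda>x. ?w x * ((?m + 1) * of_real (cos x) * gkern \<rho> x powr (?s - 1)
      + (?s - 1) * (2 * \<rho>) * of_real (1 - (cos x)\<^sup>2) * gkern \<rho> x powr (?s - 2))"
  have i: "?g0 integrable_on {0..pi}" "?g1 integrable_on {0..pi}" "?g2 integrable_on {0..pi}"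
    by (intro integrable_continuous_real continuous_intros continuous_on_gkern_powr \<mu> \<rho>)+
  have K': "(?K' has_integral ?K pi - ?K 0) {0..pi}"
  proof (rule fundamental_theorem_of_calculus_interior)
    show "continuous_on {0..pi} ?K"
      using \<mu> by (intro continuous_on_mult continuous_on_of_real continuous_on_sin_powr
        continuous_on_gkern_powr continuous_on_const continuous_on_id \<rho>) auto
    fix x assume x: "x \<in> {0<..<pi}"
    have sx: "sin x > 0" using x by (simp add: sin_gt_zero)
    have "((\<lambda>x. sin x powr (\<mu> + 1)) has_real_derivative (\<mu> + 1) * sin x powr \<mu> * cos x) (at x)"
      using DERIV_chain2[OF has_real_derivative_powr[OF sx] DERIV_sin, of "\<mu> + 1"] by simp
    then have a: "((\<lambda>x. complex_of_real (sin x powr (\<mu> + 1))) has_vector_derivative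
        of_real ((\<mu> + 1) * sin x powr \<mu> * cos x)) (at x)"
      by (intro has_vector_derivative_of_real) (simp add: has_real_derivative_iff_has_vector_derivative)
    have b0: "((\<lambda>x. gkern \<rho> x) has_vector_derivative 2 * \<rho> * of_real (sin x)) (at x)"
    proof -
      have "((\<lambda>x. complex_of_real (cos x)) has_vector_derivative of_real (- sin x)) (at x)"
        using DERIV_cos by (intro has_vector_derivative_of_real)
          (simp add: has_real_derivative_iff_has_vector_derivative[symmetric])
      from has_vector_derivative_diff[OF has_vector_derivative_const[of "1 + \<rho>\<^sup>2"]
          has_vector_derivative_mult_right[OF this, of "2 * \<rho>"]]
      show ?thesis by (simp add: gkern_def[abs_def] algebra_simps)
    qed
    have b: "((\<lambda>x. gkern \<rho> x powr (?s - 1)) has_vector_derivative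
        2 * \<rho> * of_real (sin x) * ((?s - 1) * gkern \<rho> x powr (?s - 1 - 1))) (at x)"
      using field_vector_diff_chain_at[OF b0 has_field_derivative_powr[OF gkern_notin_nonpos_Reals[OF \<rho>], of "?s - 1"]]
      by (simp add: o_def)
    have *: "sin x powr (\<mu> + 1) = sin x powr \<mu> * sin x" "1 - (cos x)\<^sup>2 = (sin x)\<^sup>2"
      "?s - 1 - 1 = ?s - 2"
      using sx by (simp_all add: powr_add sin_squared_eq)
    show "(?K has_vector_derivative ?K' x) (at x)"
      by (rule has_vector_derivative_eq_rhs[OF has_vector_derivative_mult[OF a b]])
        (simp add: *, simp add: power2_eq_square distrib_left distrib_right mult_ac)
  qed simp
  have K0: "(?K' has_integral 0) {0..pi}" using K' \<mu> by simp
  have pt: "(1 - \<rho>\<^sup>2) * \<rho>\<^sup>2 * ?g2 x + ((1 + ?m) - (1 - 4 * ?s - ?m) * \<rho>\<^sup>2) * \<rho> * ?g1 x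
     - 2 * ?s * (2 * ?s + ?m) * \<rho>\<^sup>2 * ?g0 x + (1 - \<rho>\<^sup>2) * (2 * ?s * \<rho>) * ?K' x = 0" for x
  proof -
    have nz: "gkern \<rho> x \<noteq> 0" using gkern_notin_nonpos_Reals[OF \<rho>, of x] by auto
    define P where "P = gkern \<rho> x powr (?s - 2)"
    have p1: "gkern \<rho> x powr (?s - 1) = P * gkern \<rho> x"
      using nz powr_add[of "gkern \<rho> x" "?s - 2" 1] by (simp add: P_def)
    have p0: "gkern \<rho> x powr ?s = P * (gkern \<rho> x)\<^sup>2"
      using nz powr_add[of "gkern \<rho> x" "?s - 2" 2] powr_nat'[of "gkern \<rho> x" 2] by (simp add: P_def)
    show ?thesis unfolding p0 p1 P_def[symmetric] of_real_diff of_real_1 of_real_power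
      by (rule gkern_ode_integrand) (simp add: gkern_def)
  qed
  have "((\<lambda>x. (1 - \<rho>\<^sup>2) * \<rho>\<^sup>2 * ?g2 x + ((1 + ?m) - (1 - 4 * ?s - ?m) * \<rho>\<^sup>2) * \<rho> * ?g1 x
     - 2 * ?s * (2 * ?s + ?m) * \<rho>\<^sup>2 * ?g0 x + (1 - \<rho>\<^sup>2) * (2 * ?s * \<rho>) * ?K' x) has_integral
     ((1 - \<rho>\<^sup>2) * \<rho>\<^sup>2 * integral {0..pi} ?g2 + ((1 + ?m) - (1 - 4 * ?s - ?m) * \<rho>\<^sup>2) * \<rho> * integral {0..pi} ?g1
     - 2 * ?s * (2 * ?s + ?m) * \<rho>\<^sup>2 * integral {0..pi} ?g0 + (1 - \<rho>\<^sup>2) * (2 * ?s * \<rho>) * 0)) {0..pi}"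
    by (intro has_integral_add has_integral_diff has_integral_mult_right integrable_integral i K0)
  then have "(1 - \<rho>\<^sup>2) * \<rho>\<^sup>2 * integral {0..pi} ?g2 + ((1 + ?m) - (1 - 4 * ?s - ?m) * \<rho>\<^sup>2) * \<rho> * integral {0..pi} ?g1
     - 2 * ?s * (2 * ?s + ?m) * \<rho>\<^sup>2 * integral {0..pi} ?g0 = 0"
    unfolding pt mult_zero_right add_0_right by (rule has_integral_unique[OF _ has_integral_0])
  then show ?thesis
    unfolding gint_def[of \<mu> s \<rho>] DERIV_imp_deriv[OF DERIV_gint(1)[OF \<mu> \<rho>, of s]]
      DERIV_imp_deriv[OF DERIV_gint(2)[OF \<mu> \<rho>, of s]] .
qed

lemma gint_holomorphic: "\<mu> > 0 \<Longrightarrow> gint \<mu> s holomorphic_on ball 0 1"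
  unfolding holomorphic_on_open[OF open_ball] by (intro ballI exI, rule DERIV_gint(1)) auto

text \<open>The equation involves only the Euler operator and multiplication by \<rho>^2, so it
  couples coefficients at distance two.\<close>

lemma gint_coeffs:
  fixes s :: real
  assumes \<mu>: "\<mu> > 0"
  defines "F \<equiv> fps_expansion (gint \<mu> s) 0"
  shows "fps_nth F 1 = 0"
    and "of_nat (n + 2) * (of_nat (n + 2) + of_real \<mu>) * fps_nth F (n + 2)
      = (of_nat n - 2 * of_real s) * (of_nat n - 2 * of_real s - of_real \<mu>) * fps_nth F n"
proof -
  let ?s = "complex_of_real s" and ?m = "complex_of_real \<mu>"
  have F: "gint \<mu> s has_fps_expansion F"
    unfolding F_def using gint_holomorphic[OF \<mu>] by (intro has_fps_expansion_fps_expansion[of "ball 0 1"]) auto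
  define H where "H = (1 - fps_X^2) * fps_X^2 * fps_deriv (fps_deriv F)
     + (fps_const (1 + ?m) - fps_const (1 - 4 * ?s - ?m) * fps_X^2) * fps_X * fps_deriv F
     - fps_const (2 * ?s * (2 * ?s + ?m)) * fps_X^2 * F"
  have e1: "(\<lambda>\<rho>. (1 - \<rho>^2) * \<rho>^2 * deriv (deriv (gint \<mu> s)) \<rho>
     + ((1 + ?m) - (1 - 4 * ?s - ?m) * \<rho>^2) * \<rho> * deriv (gint \<mu> s) \<rho>
     - 2 * ?s * (2 * ?s + ?m) * \<rho>^2 * gint \<mu> s \<rho>) has_fps_expansion H"
    unfolding H_def by (intro fps_expansion_intros F)
  have e2: "eventually (\<lambda>\<rho>. (1 - \<rho>^2) * \<rho>^2 * deriv (deriv (gint \<mu> s)) \<rho>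
     + ((1 + ?m) - (1 - 4 * ?s - ?m) * \<rho>^2) * \<rho> * deriv (gint \<mu> s) \<rho>
     - 2 * ?s * (2 * ?s + ?m) * \<rho>^2 * gint \<mu> s \<rho> = 0) (nhds 0)"
    by (rule eventually_mono[OF eventually_nhds_in_open[of "ball 0 1" "0 :: complex"]])
      (simp_all only: open_ball mem_ball_0 norm_zero zero_less_one gint_ode[OF \<mu>])
  have "(\<lambda>_. 0) has_fps_expansion H"
    by (rule has_fps_expansion_cong[OF e2 refl, THEN iffD1, OF e1])
  then have H0: "H = 0"
    using fps_expansion_unique_complex has_fps_expansion_0 by blast
  have A: "fps_X^2 * fps_deriv (fps_deriv F) = Abs_fps (\<lambda>n. of_nat n * (of_nat n - 1) * fps_nth F n)" (is "_ = ?A")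
  proof (rule fps_ext)
    fix n show "fps_nth (fps_X^2 * fps_deriv (fps_deriv F)) n = fps_nth ?A n"
    proof (cases "n < 2")
      case False
      then obtain m where "n = m + 2" by (metis add.commute le_Suc_ex not_less)
      then show ?thesis by (simp add: fps_X_power_mult_nth mult.assoc)
    qed (auto simp: fps_X_power_mult_nth less_2_cases_iff)
  qed
  have B: "fps_X * fps_deriv F = Abs_fps (\<lambda>n. of_nat n * fps_nth F n)" (is "_ = ?B")
    by (rule fps_ext) (simp add: fps_X_mult_nth)
  have H: "H = ?A - fps_X^2 * ?A + fps_const (1 + ?m) * ?B - fps_X^2 * (fps_const (1 - 4 * ?s - ?m) * ?B)
     - fps_X^2 * (fps_const (2 * ?s * (2 * ?s + ?m)) * F)"
  proof -
    \<comment> \<open>After this regrouping every summand acts diagonally on coefficients, up to a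
      shift by \<open>fps_X^2\<close>, and coefficients can be read off.\<close>
    have gen: "(1 - X) * X * A + (c1 - c2 * X) * Y * D - c3 * X * G
        = X * A - X * (X * A) + c1 * (Y * D) - X * (c2 * (Y * D)) - X * (c3 * G)"
      for X Y A D G c1 c2 c3 :: "complex fps"
      by (simp only: left_diff_distrib mult_1_left mult.assoc mult.left_commute add_diff_eq)
    show ?thesis
      unfolding A[symmetric] B[symmetric] H_def gen ..
  qed
  note nth = H fps_sub_nth fps_add_nth fps_mult_left_const_nth fps_X_power_mult_nth fps_nth_Abs_fps
  have "0 = fps_nth H 1" by (simp add: H0)
  also have "\<dots> = (1 + ?m) * fps_nth F 1"
    by (simp only: nth) simp
  finally show "fps_nth F 1 = 0"
    using \<mu> by (auto simp: complex_eq_iff)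
  have "0 = fps_nth H (n + 2)" by (simp add: H0)
  also have "\<dots> = (of_nat (n + 2) * (of_nat (n + 2) - 1) * fps_nth F (n + 2) - of_nat n * (of_nat n - 1) * fps_nth F n
      + (1 + ?m) * (of_nat (n + 2) * fps_nth F (n + 2)) - (1 - 4 * ?s - ?m) * (of_nat n * fps_nth F n)
      - 2 * ?s * (2 * ?s + ?m) * fps_nth F n)"
    by (simp only: nth) simp
  also have "\<dots> = of_nat (n + 2) * (of_nat (n + 2) + ?m) * fps_nth F (n + 2)
      - (of_nat n - 2 * ?s) * (of_nat n - 2 * ?s - ?m) * fps_nth F n"
    by (simp only: of_nat_add of_nat_numeral) algebra
  finally show "of_nat (n + 2) * (of_nat (n + 2) + of_real \<mu>) * fps_nth F (n + 2)
      = (of_nat n - 2 * of_real s) * (of_nat n - 2 * of_real s - of_real \<mu>) * fps_nth F n"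
    by (rule eq_iff_diff_eq_0[THEN iffD2, OF sym])
qed

section \<open>Hypergeometric coefficients and the expansion of the Gegenbauer integral\<close>

definition hyp2F1 :: "real \<Rightarrow> real \<Rightarrow> real \<Rightarrow> nat \<Rightarrow> real" where
  "hyp2F1 a b c k = pochhammer a k * pochhammer b k / (pochhammer c k * fact k)"

lemma hyp2F1_0 [simp]: "hyp2F1 a b c 0 = 1"
  by (simp add: hyp2F1_def)

lemma hyp2F1_Suc:
  assumes "c > 0"
  shows "(c + real k) * (1 + real k) * hyp2F1 a b c (Suc k) = (a + real k) * (b + real k) * hyp2F1 a b c k"
proof -
  have "u * v * (P * x * (Q * y) / (R * u * (v * f))) = x * y * (P * Q / (R * f))"
    if "u \<noteq> 0" "v \<noteq> 0" for P Q R f u v x y :: real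
    using that by simp
  from this[of "c + real k" "1 + real k"] show ?thesis
    using assms by (simp add: hyp2F1_def pochhammer_Suc)
qed

definition gnorm :: "real \<Rightarrow> real" where
  "gnorm \<mu> = integral {0..pi} (\<lambda>x. sin x powr \<mu>)"

lemma gnorm_pos:
  assumes "\<mu> > 0"
  shows "gnorm \<mu> > 0"
proof -
  have "gnorm \<mu> \<noteq> 0"
  proof
    assume "gnorm \<mu> = 0"
    then have "\<forall>x\<in>{0..pi}. sin x powr \<mu> = 0"
      using integral_eq_0_iff[of 0 pi "\<lambda>x. sin x powr \<mu>"] continuous_on_sin_powr[OF assms]
      by (simp add: gnorm_def)
    from bspec[OF this, of "pi / 2"] show False by simp
  qed
  moreover have "gnorm \<mu> \<ge> 0" unfolding gnorm_def by (rule integral_nonneg)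
    (use assms in \<open>auto intro!: integrable_continuous_real continuous_intros\<close>)
  ultimately show ?thesis by simp
qed

lemma integral_complex_of_real_HK:
  fixes f :: "'a :: euclidean_space \<Rightarrow> real"
  assumes "f integrable_on S"
  shows "integral S (\<lambda>x. complex_of_real (f x)) = of_real (integral S f)"
  using has_integral_of_real[OF integrable_integral[OF assms]] by (rule integral_unique)

lemma gkern_powr_integrable:
  fixes \<rho> s \<mu> :: real
  assumes "\<mu> > 0" "\<bar>\<rho>\<bar> < 1"
  shows "(\<lambda>x. sin x powr \<mu> * gkern \<rho> x powr s) integrable_on {0..pi}"
proof (intro integrable_continuous_real continuous_on_mult continuous_on_sin_powr assms)
  show "continuous_on {0..pi} (\<lambda>x. gkern \<rho> x powr s)"
    using gkern_pos[OF assms(2)] by (intro continuous_on_powr continuous_intros) (auto simp: less_le)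
qed

text \<open>With s = -a and n = 2 k the recurrence of \<open>gint_coeffs\<close> is four times that
  of 2F1(a, a - \<mu>/2; \<mu>/2 + 1; \<rho>^2), and the odd coefficients vanish. The later choice
  \<mu> = 4\<beta> - 2 makes the lower parameter 2\<beta>.\<close>

lemma gegenbauer_integral_sums:
  fixes \<rho> a \<mu> :: real
  assumes \<mu>: "\<mu> > 0" and \<rho>: "\<bar>\<rho>\<bar> < 1"
  shows "(\<lambda>k. gnorm \<mu> * hyp2F1 a (a - \<mu> / 2) (\<mu> / 2 + 1) k * \<rho> ^ (2 * k)) sums
     integral {0..pi} (\<lambda>x. sin x powr \<mu> * gkern \<rho> x powr (- a))"
proof -
  define F where "F = fps_expansion (gint \<mu> (- a)) 0"
  define h where "h = hyp2F1 a (a - \<mu> / 2) (\<mu> / 2 + 1)"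
  have gint_real: "gint \<mu> (- a) (of_real r) =
      of_real (integral {0..pi} (\<lambda>x. sin x powr \<mu> * gkern r x powr (- a)))" if "\<bar>r\<bar> < 1" for r :: real
  proof -
    have "complex_of_real (sin x powr \<mu>) * gkern (of_real r) x powr of_real (- a) =
        of_real (sin x powr \<mu> * gkern r x powr (- a))" for x
      using powr_of_real[of "gkern r x" "- a"] gkern_nonneg[of r x] by (simp add: gkern_of_real)
    then show ?thesis
      unfolding gint_def by (simp only: integral_complex_of_real_HK gkern_powr_integrable[OF \<mu> that])
  qed
  have odd: "fps_nth F (Suc (2 * k)) = 0" for k
  proof (induction k)
    case 0
    then show ?case using gint_coeffs(1)[OF \<mu>, of "-a"] by (simp add: F_def)
  next
    case (Suc k)
    have "of_nat (Suc (2 * k) + 2) * (of_nat (Suc (2 * k) + 2) + complex_of_real \<mu>) * fps_nth F (Suc (2 * k) + 2) = 0"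
      using gint_coeffs(2)[OF \<mu>, of "Suc (2 * k)" "-a"] Suc unfolding F_def by simp
    moreover have "of_nat (Suc (2 * k) + 2) + complex_of_real \<mu> \<noteq> 0"
      using \<mu> by (auto simp: complex_eq_iff)
    ultimately have "fps_nth F (Suc (2 * k) + 2) = 0" by (simp del: of_nat_add of_nat_Suc)
    then show ?case by simp
  qed
  have even: "fps_nth F (2 * k) = of_real (gnorm \<mu> * h k)" for k
  proof (induction k)
    case 0
    have "fps_nth F 0 = gint \<mu> (- a) (of_real 0)" by (simp add: F_def fps_expansion_def)
    also have "\<dots> = of_real (gnorm \<mu>)"
      by (subst gint_real) (simp_all add: gnorm_def gkern_def)
    finally show ?case by (simp add: h_def)
  next
    case (Suc k)
    let ?r = "real k"
    have h: "4 * ((\<mu> / 2 + 1 + ?r) * (1 + ?r) * h (Suc k)) = 4 * ((a + ?r) * (a - \<mu> / 2 + ?r) * h k)"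
      unfolding h_def using hyp2F1_Suc[of "\<mu> / 2 + 1" k a "a - \<mu> / 2"] \<mu> by simp
    have "of_nat (2 * k + 2) * (of_nat (2 * k + 2) + complex_of_real \<mu>) * fps_nth F (2 * k + 2)
        = (of_nat (2 * k) - 2 * of_real (- a)) * (of_nat (2 * k) - 2 * of_real (- a) - of_real \<mu>) * fps_nth F (2 * k)"
      using gint_coeffs(2)[OF \<mu>, of "2 * k" "-a"] unfolding F_def .
    also have "\<dots> = of_real (gnorm \<mu> * (4 * ((a + ?r) * (a - \<mu> / 2 + ?r) * h k)))"
      unfolding Suc by (simp add: field_simps)
    also have "\<dots> = of_nat (2 * k + 2) * (of_nat (2 * k + 2) + complex_of_real \<mu>) * of_real (gnorm \<mu> * h (Suc k))"
      unfolding h[symmetric] by (simp add: field_simps)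
    finally have e: "of_nat (2 * k + 2) * (of_nat (2 * k + 2) + complex_of_real \<mu>) * fps_nth F (2 * k + 2)
       = of_nat (2 * k + 2) * (of_nat (2 * k + 2) + complex_of_real \<mu>) * of_real (gnorm \<mu> * h (Suc k))" .
    have nz: "of_nat (2 * k + 2) * (of_nat (2 * k + 2) + complex_of_real \<mu>) \<noteq> 0"
      using \<mu> by (auto simp: complex_eq_iff)
    have "fps_nth F (2 * k + 2) = of_real (gnorm \<mu> * h (Suc k))"
      by (rule mult_left_cancel[OF nz, THEN iffD1, OF e])
    then show ?case by simp
  qed
  have "(\<lambda>n. fps_nth F n * of_real \<rho> ^ n) sums gint \<mu> (- a) (of_real \<rho>)"
    using holomorphic_power_series[OF gint_holomorphic[OF \<mu>], of "of_real \<rho>" "- a"] \<rho>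
    by (simp add: F_def fps_expansion_def)
  then have "(\<lambda>k. fps_nth F (2 * k) * of_real \<rho> ^ (2 * k)) sums gint \<mu> (- a) (of_real \<rho>)"
  proof (subst sums_mono_reindex)
    show "fps_nth F n * of_real \<rho> ^ n = 0" if "n \<notin> range (\<lambda>k. 2 * k)" for n
    proof -
      have "odd n" using that by (auto elim!: evenE)
      then show ?thesis using odd by (auto elim!: oddE)
    qed
  qed (auto simp: strict_mono_def)
  then have "(\<lambda>k. complex_of_real (gnorm \<mu> * h k * \<rho> ^ (2 * k))) sums
      of_real (integral {0..pi} (\<lambda>x. sin x powr \<mu> * gkern \<rho> x powr (- a)))"
    unfolding even gint_real[OF \<rho>] by (simp add: mult_ac)
  then show ?thesis unfolding sums_of_real_iff h_def .
qed

section \<open>The wave recurrence\<close>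

text \<open>The coefficient form of \<open>L\<^sub>1 u = L\<^sub>2 u\<close>, where \<open>L = (1 - x)(x(1 - x)\<partial>\<^sup>2 + (2\<beta> - 2x)\<partial> - \<beta>(1 - \<beta>))\<close>
  acts on either variable.\<close>

definition jacobi_flux :: "real \<Rightarrow> (int \<Rightarrow> real) \<Rightarrow> int \<Rightarrow> real" where
  "jacobi_flux \<beta> u i = (of_int i + 1) * (of_int i + 2 * \<beta>) * u (i + 1)
     - (of_int i + \<beta>) * (of_int i + 1 - \<beta>) * u i"

text \<open>The flux is the coefficient sequence of x(1 - x)u'' + (2\<beta> - 2x)u' - \<beta>(1 -
  \<beta>)u; the outer factor 1 - x of L turns it into the difference of the fluxes at i and i -
  1.\<close>

definition wave_array :: "real \<Rightarrow> (int \<Rightarrow> int \<Rightarrow> real) \<Rightarrow> bool" where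
  "wave_array \<beta> a \<longleftrightarrow>
     (\<forall>i j. i < 0 \<or> j < 0 \<longrightarrow> a i j = 0) \<and>
     (\<forall>i j. jacobi_flux \<beta> (\<lambda>i. a i j) i - jacobi_flux \<beta> (\<lambda>i. a i j) (i - 1)
          = jacobi_flux \<beta> (a i) j - jacobi_flux \<beta> (a i) (j - 1))"

text \<open>Solved for its top term, the recurrence expresses the entry (i, j + 1) through (i + 1,
  j), (i, j), (i - 1, j) and (i, j - 1). So zeros at (i, 0) for i < M spread to the triangle i + j <
  M. The finite form is what truncated sums need; taking M large gives uniqueness.\<close>

lemma wave_array_eq_0:
  assumes a: "wave_array \<beta> a" and "\<beta> > 0" and a0: "\<And>i. i < M \<Longrightarrow> a i 0 = 0"
  shows "i + int j < M \<Longrightarrow> a i (int j) = 0"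
proof (induction j arbitrary: i rule: less_induct)
  case (less j)
  show ?case
  proof (cases j)
    case 0
    then show ?thesis using a0 less.prems by simp
  next
    case (Suc m)
    have *: "a i' (int j') = 0" if "j' < j" "i' + int j' < M" for i' j'
      using less.IH that by blast
    have z: "a i' (int m) = 0" if "i' \<le> i + 1" for i'
      using *[of m i'] Suc less.prems that by simp
    have z': "a i (int m - 1) = 0"
    proof (cases m)
      case 0 then show ?thesis using a by (simp add: wave_array_def)
    next
      case (Suc m')
      then show ?thesis using *[of m' i] \<open>j = Suc m\<close> less.prems by simp
    qed
    have "jacobi_flux \<beta> (\<lambda>i. a i (int m)) i - jacobi_flux \<beta> (\<lambda>i. a i (int m)) (i - 1)
        = jacobi_flux \<beta> (a i) (int m) - jacobi_flux \<beta> (a i) (int m - 1)"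
      using a by (simp add: wave_array_def)
    then have "(real m + 1) * (real m + 2 * \<beta>) * a i (int m + 1) = 0"
      by (simp add: jacobi_flux_def z z')
    moreover have "(real m + 1) * (real m + 2 * \<beta>) \<noteq> 0"
      using \<open>\<beta> > 0\<close> by simp
    ultimately have "a i (int m + 1) = 0" by simp
    then show ?thesis using Suc by (simp add: add.commute)
  qed
qed

lemma jacobi_flux_sum:
  "jacobi_flux \<beta> (\<lambda>i. \<Sum>m\<in>S. c m * u m i) i = (\<Sum>m\<in>S. c m * jacobi_flux \<beta> (u m) i)"
  unfolding jacobi_flux_def sum_distrib_left sum_subtractf[symmetric]
  by (rule sum.cong) (simp_all add: algebra_simps)

lemma wave_array_sum:
  assumes "\<And>m. m \<in> S \<Longrightarrow> wave_array \<beta> (a m)"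
  shows "wave_array \<beta> (\<lambda>i j. \<Sum>m\<in>S. c m * a m i j)"
  unfolding wave_array_def jacobi_flux_sum
  using assms by (auto simp: wave_array_def sum_subtractf[symmetric] right_diff_distrib[symmetric] intro!: sum.cong)

lemma wave_array_diff:
  assumes "wave_array \<beta> a" "wave_array \<beta> b"
  shows "wave_array \<beta> (\<lambda>i j. a i j - b i j)"
proof -
  have flux: "jacobi_flux \<beta> (\<lambda>i. u i - v i) i = jacobi_flux \<beta> u i - jacobi_flux \<beta> v i" for u v i
    by (simp add: jacobi_flux_def algebra_simps)
  have lin: "x - x' - (y - y') = z - z' - (t - t')" if "x - y = z - t" "x' - y' = z' - t'"
    for x x' y y' z z' t t' :: real
    using that by simp
  show ?thesis
    unfolding wave_array_def flux
  proof (intro conjI allI impI lin)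
    show "a i j - b i j = 0" if "i < 0 \<or> j < 0" for i j
      using assms that by (auto simp: wave_array_def)
  qed (use assms in \<open>simp_all add: wave_array_def\<close>)
qed

section \<open>Taylor coefficients of the translates of polynomials\<close>

definition pow_coeff :: "nat \<Rightarrow> int \<Rightarrow> real" where
  "pow_coeff l i = (if i < 0 then 0 else (-1) ^ nat i * real (l choose nat i))"

text \<open>Coefficient form of (1 - x) u' = - l u for u = (1 - x)^l. The extension by zero keeps it
  valid at i = -1, where both sides vanish.\<close>

lemma pow_coeff_Suc: "(of_int i + 1) * pow_coeff l (i + 1) = (of_int i - of_nat l) * pow_coeff l i"
proof (cases "i \<ge> 0")
  case True
  then obtain n where n: "i = int n" by (metis nonneg_int_cases)
  have e: "(real n + 1) * real (l choose Suc n) = (real l - real n) * real (l choose n)"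
    using gbinomial_mult_1[of "real l" n] by (simp add: binomial_gbinomial algebra_simps)
  have "(real n + 1) * ((-1) ^ Suc n * real (l choose Suc n)) = (-1) ^ Suc n * ((real n + 1) * real (l choose Suc n))"
    by simp
  also have "\<dots> = (real n - real l) * ((-1) ^ n * real (l choose n))"
    unfolding e by (simp add: algebra_simps)
  finally show ?thesis
    by (simp add: n pow_coeff_def nat_add_distrib)
next
  case False
  then show ?thesis by (cases "i = -1") (auto simp: pow_coeff_def)
qed

text \<open>\<open>x L (x ^ k (1 - x) ^ l) = (k(k - 1 + 2\<beta>) + q x + (k + l + \<beta>)(k + l + 1 - \<beta>) x\<^sup>2) x ^ k (1 - x) ^ l\<close>
  with the constant \<open>q = - 2(k + \<beta>)(k + l) - \<beta>(1 - \<beta>)\<close>.\<close>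

lemma jacobi_flux_pow_coeff:
  fixes k l :: nat and i :: int
  shows "jacobi_flux \<beta> (\<lambda>i. pow_coeff l (i - int k)) i - jacobi_flux \<beta> (\<lambda>i. pow_coeff l (i - int k)) (i - 1)
     = real k * (real k - 1 + 2 * \<beta>) * pow_coeff l (i + 1 - int k)
       + (- 2 * (real k + \<beta>) * (real k + real l) - \<beta> * (1 - \<beta>)) * pow_coeff l (i - int k)
       + (real k + real l + \<beta>) * (real k + real l + 1 - \<beta>) * pow_coeff l (i - 1 - int k)"
proof -
  define I K L where "I = real_of_int i" and "K = real k" and "L = real l"
  define w w0 w1 where "w = pow_coeff l (i - int k)" and "w0 = pow_coeff l (i - 1 - int k)"
    and "w1 = pow_coeff l (i + 1 - int k)"
  have "(I - K + 1) * w1 = (I - K - L) * w"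
    using pow_coeff_Suc[of "i - int k" l] by (simp add: w_def w1_def I_def K_def L_def algebra_simps)
  moreover have "(I - K) * w = (I - 1 - K - L) * w0"
    using pow_coeff_Suc[of "i - 1 - int k" l] by (simp add: w_def w0_def I_def K_def L_def algebra_simps)
  ultimately have "((I + 1) * (I + 2 * \<beta>) * w1 - (I + \<beta>) * (I + 1 - \<beta>) * w)
      - (I * (I - 1 + 2 * \<beta>) * w - (I - 1 + \<beta>) * (I - \<beta>) * w0)
     = K * (K - 1 + 2 * \<beta>) * w1 + (- 2 * (K + \<beta>) * (K + L) - \<beta> * (1 - \<beta>)) * w
       + (K + L + \<beta>) * (K + L + 1 - \<beta>) * w0"
    by algebra
  then show ?thesis
    by (simp add: jacobi_flux_def w_def w0_def w1_def I_def K_def L_def)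
qed

lemma pow_coeff_neg [simp]: "i < 0 \<Longrightarrow> pow_coeff l i = 0"
  by (simp add: pow_coeff_def)

lemma pow_coeff_0 [simp]: "pow_coeff l 0 = 1"
  by (simp add: pow_coeff_def)

text \<open>The Taylor coefficients of \<open>((1 - x)(1 - y)) ^ l \<^sub>2F\<^sub>1(\<beta> + l, l + 1 - \<beta>; 2\<beta>; xy)\<close>, which is the
  translate of \<open>(1 - X) ^ l\<close>; \<open>power_array\<close> below does the same for \<open>X ^ m\<close>.\<close>

definition zonal_array :: "real \<Rightarrow> nat \<Rightarrow> int \<Rightarrow> int \<Rightarrow> real" where
  "zonal_array \<beta> l i j = (\<Sum>k\<le>nat i. hyp2F1 (\<beta> + l) (real l + 1 - \<beta>) (2 * \<beta>) k
      * (pow_coeff l (i - int k) * pow_coeff l (j - int k)))"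

lemma zonal_array_eq:
  assumes "i \<le> int K"
  shows "zonal_array \<beta> l i j = (\<Sum>k\<le>K. hyp2F1 (\<beta> + l) (real l + 1 - \<beta>) (2 * \<beta>) k
      * (pow_coeff l (i - int k) * pow_coeff l (j - int k)))"
  unfolding zonal_array_def by (rule sum.mono_neutral_left) (use assms in auto)

lemma zonal_array_0: "zonal_array \<beta> l i 0 = pow_coeff l i"
proof -
  have "zonal_array \<beta> l i 0 = (\<Sum>k\<in>{0}. hyp2F1 (\<beta> + l) (real l + 1 - \<beta>) (2 * \<beta>) k
      * (pow_coeff l (i - int k) * pow_coeff l (0 - int k)))"
    unfolding zonal_array_def by (rule sum.mono_neutral_right) auto
  then show ?thesis by simp
qed

text \<open>In the formula for x L (x^k (1 - x)^l) the middle coefficient is the same for x and for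
  y and cancels in the difference. The outer two telescope in k, because the 2F1 recurrence says
  \<open>c (Suc k) * P (Suc k) = c k * Q k\<close>.\<close>

lemma wave_array_zonal:
  assumes "\<beta> > 0"
  shows "wave_array \<beta> (zonal_array \<beta> l)"
  unfolding wave_array_def
proof (intro conjI allI impI)
  fix i j :: int
  show "zonal_array \<beta> l i j = 0" if "i < 0 \<or> j < 0"
    unfolding zonal_array_def by (rule sum.neutral) (use that in auto)
  \<comment> \<open>This limit covers the index i + 1 of the flux, and it exceeds i, so that the
    boundary term \<open>S K\<close> of the telescoping sum vanishes.\<close>
  define K where "K = nat i + 2"
  define c where "c = hyp2F1 (\<beta> + l) (real l + 1 - \<beta>) (2 * \<beta>)"
  define w where "w = (\<lambda>k i. pow_coeff l (i - int k))"
  have zonal: "zonal_array \<beta> l i' j' = (\<Sum>k\<le>K. c k * (w k i' * w k j'))" if "i' \<le> i + 1" for i' j'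
    unfolding c_def w_def by (rule zonal_array_eq) (use that in \<open>simp add: K_def\<close>)
  have fi: "jacobi_flux \<beta> (\<lambda>i. zonal_array \<beta> l i j) i' = (\<Sum>k\<le>K. c k * (jacobi_flux \<beta> (w k) i' * w k j))" if "i' \<le> i" for i'
  proof -
    have "jacobi_flux \<beta> (\<lambda>i. zonal_array \<beta> l i j) i' = jacobi_flux \<beta> (\<lambda>i. \<Sum>k\<le>K. (c k * w k j) * w k i) i'"
      using that by (simp add: jacobi_flux_def zonal mult_ac)
    then show ?thesis unfolding jacobi_flux_sum[where u = w] by (simp add: mult_ac)
  qed
  have fj: "jacobi_flux \<beta> (zonal_array \<beta> l i) j' = (\<Sum>k\<le>K. c k * (w k i * jacobi_flux \<beta> (w k) j'))" for j'
  proof -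
    have "jacobi_flux \<beta> (zonal_array \<beta> l i) j' = jacobi_flux \<beta> (\<lambda>j. \<Sum>k\<le>K. (c k * w k i) * w k j) j'"
      by (simp add: jacobi_flux_def zonal mult_ac)
    then show ?thesis unfolding jacobi_flux_sum[where u = w] by (simp add: mult_ac)
  qed
  define P Q where "P = (\<lambda>k. real k * (real k - 1 + 2 * \<beta>))" and "Q = (\<lambda>k. (real k + real l + \<beta>) * (real k + real l + 1 - \<beta>))"
  define S where "S = (\<lambda>k. w k (i - 1) * w k j - w k i * w k (j - 1))"
  define S' where "S' = (\<lambda>k. w k (i + 1) * w k j - w k i * w k (j + 1))"
  have L: "jacobi_flux \<beta> (w k) i - jacobi_flux \<beta> (w k) (i - 1) = P k * w k (i + 1) 
      + (- 2 * (real k + \<beta>) * (real k + real l) - \<beta> * (1 - \<beta>)) * w k i + Q k * w k (i - 1)" for k i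
    unfolding w_def P_def Q_def by (rule jacobi_flux_pow_coeff)
  have tel: "(\<Sum>k\<le>n. c k * (P k * S' k + Q k * S k)) = c n * Q n * S n" for n
  proof (induction n)
    case (Suc n)
    have "S' (Suc n) = - S n" by (simp add: S_def S'_def w_def algebra_simps)
    moreover have "c (Suc n) * P (Suc n) = c n * Q n"
      using hyp2F1_Suc[of "2 * \<beta>" n "\<beta> + l" "real l + 1 - \<beta>"] assms
      by (simp add: c_def P_def Q_def algebra_simps)
    ultimately show ?case using Suc by (simp add: algebra_simps)
  qed (simp add: P_def)
  have "(jacobi_flux \<beta> (\<lambda>i. zonal_array \<beta> l i j) i - jacobi_flux \<beta> (\<lambda>i. zonal_array \<beta> l i j) (i - 1))
      - (jacobi_flux \<beta> (zonal_array \<beta> l i) j - jacobi_flux \<beta> (zonal_array \<beta> l i) (j - 1))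
     = (\<Sum>k\<le>K. c k * ((jacobi_flux \<beta> (w k) i - jacobi_flux \<beta> (w k) (i - 1)) * w k j
         - w k i * (jacobi_flux \<beta> (w k) j - jacobi_flux \<beta> (w k) (j - 1))))"
    by (simp add: fi fj sum_subtractf[symmetric] algebra_simps)
  also have "\<dots> = (\<Sum>k\<le>K. c k * (P k * S' k + Q k * S k))"
    unfolding L S_def S'_def by (rule sum.cong) (simp_all add: algebra_simps)
  also have "\<dots> = 0"
    unfolding tel by (simp add: S_def w_def K_def)
  finally show "jacobi_flux \<beta> (\<lambda>i. zonal_array \<beta> l i j) i - jacobi_flux \<beta> (\<lambda>i. zonal_array \<beta> l i j) (i - 1)
      = jacobi_flux \<beta> (zonal_array \<beta> l i) j - jacobi_flux \<beta> (zonal_array \<beta> l i) (j - 1)" by simp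
qed

definition power_array :: "real \<Rightarrow> nat \<Rightarrow> int \<Rightarrow> int \<Rightarrow> real" where
  "power_array \<beta> m i j = (\<Sum>l\<le>m. ((-1) ^ l * real (m choose l)) * zonal_array \<beta> l i j)"

lemma wave_array_power: "\<beta> > 0 \<Longrightarrow> wave_array \<beta> (power_array \<beta> m)"
  unfolding power_array_def[abs_def] by (intro wave_array_sum wave_array_zonal) auto

text \<open>Translation by y = 0 is the identity, so X^m must come back as a single coefficient 1;
  on coefficients this is the orthogonality relation of the binomial matrices.\<close>

lemma power_array_0: "power_array \<beta> m i 0 = (if i = int m then 1 else 0)"
proof (cases "i < 0")
  case False
  then obtain n where n: "i = int n" by (metis nonneg_int_cases linorder_not_less)
  have "power_array \<beta> m i 0 = (\<Sum>l\<le>m. (-1) ^ (l + n) * real ((m choose l) * (l choose n)))"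
    by (simp add: power_array_def zonal_array_0 pow_coeff_def n power_add mult_ac)
  also have "\<dots> = (if n = m then 1 else 0)"
  proof (cases "n \<le> m")
    case True
    have "(\<Sum>l\<le>m. (-1) ^ (l + n) * real ((m choose l) * (l choose n)))
        = (\<Sum>l\<in>{n..m}. (-1) ^ (l + n) * real ((m choose l) * (l choose n)))"
      by (rule sum.mono_neutral_right) auto
    also have "\<dots> = (\<Sum>l\<in>{n..m}. (-1) ^ (l + n) * real ((m choose n) * (m - n choose (l - n))))"
      by (rule sum.cong) (simp_all add: choose_mult)
    also have "\<dots> = (\<Sum>l\<in>{..m - n}. (-1) ^ l * real ((m choose n) * (m - n choose l)))"
      by (rule sum.reindex_bij_witness[of _ "\<lambda>l. l + n" "\<lambda>l. l - n"])
        (use True in \<open>auto simp: le_iff_add power_add mult_ac\<close>)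
    also have "\<dots> = real (m choose n) * (\<Sum>l\<le>m - n. (-1) ^ l * real (m - n choose l))"
      by (simp add: sum_distrib_left mult_ac)
    also have "\<dots> = (if n = m then 1 else 0)"
      using choose_alternating_sum[of "m - n", where ?'a = real] True by auto
    finally show ?thesis .
  qed (auto intro!: sum.neutral)
  finally show ?thesis by (simp add: n)
qed (auto simp: power_array_def zonal_array_0)

section \<open>The recurrences for the coefficients\<close>

text \<open>The consequences of the two recurrences from which B has been eliminated: the wave
  equation in each pair of variables and the equation on each axis. They determine the array, see
  \<open>neighbor_array_unique\<close>.\<close>

definition neighbor_array :: "real \<Rightarrow> (int \<Rightarrow> int \<Rightarrow> int \<Rightarrow> real) \<Rightarrow> bool" where
  "neighbor_array \<beta> a \<longleftrightarrow> a 0 0 0 = 1 \<and>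
     (\<forall>k. wave_array \<beta> (\<lambda>i j. a i j k)) \<and> (\<forall>j. wave_array \<beta> (\<lambda>i k. a i j k)) \<and>
     (\<forall>i. wave_array \<beta> (\<lambda>j k. a i j k)) \<and>
     (\<forall>u\<in>{\<lambda>i. a i 0 0, \<lambda>i. a 0 i 0, \<lambda>i. a 0 0 i}. \<forall>n. (2 * \<beta> + real n) * (1 + real n) * u (int (Suc n))
        = (\<beta> + real n) * (1 - 2 * \<beta> + real n) * u (int n))"

lemma wave_array_flip: "wave_array \<beta> a \<Longrightarrow> wave_array \<beta> (\<lambda>i j. a j i)"
  by (auto simp: wave_array_def)

lemma neighbor_array_swap:
  assumes "neighbor_array \<beta> a"
  shows "neighbor_array \<beta> (\<lambda>i j k. a k j i)" "neighbor_array \<beta> (\<lambda>i j k. a i k j)"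
  using assms by (auto simp: neighbor_array_def intro: wave_array_flip)

lemma neighbor_array_axis:
  assumes a: "neighbor_array \<beta> a" and "\<beta> > 0"
  shows "a (int n) 0 0 = hyp2F1 \<beta> (1 - 2 * \<beta>) (2 * \<beta>) n"
proof (induction n)
  case (Suc n)
  have "(2 * \<beta> + real n) * (1 + real n) * a (int (Suc n)) 0 0 =
      (2 * \<beta> + real n) * (1 + real n) * hyp2F1 \<beta> (1 - 2 * \<beta>) (2 * \<beta>) (Suc n)"
    using a hyp2F1_Suc[of "2 * \<beta>" n \<beta> "1 - 2 * \<beta>"] Suc \<open>\<beta> > 0\<close>
    by (simp add: neighbor_array_def)
  moreover have "(2 * \<beta> + real n) * (1 + real n) \<noteq> 0" using \<open>\<beta> > 0\<close> by simp
  ultimately show ?case by (rule mult_left_cancel[THEN iffD1, rotated])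
qed (use a in \<open>simp add: neighbor_array_def\<close>)

lemma wave_array_unique:
  assumes "wave_array \<beta> a" "wave_array \<beta> b" "\<beta> > 0" "\<And>i. a i 0 = b i 0"
  shows "a i j = b i j"
proof (cases "j \<ge> 0")
  case True
  then obtain m where m: "j = int m" by (metis nonneg_int_cases)
  have "a i (int m) - b i (int m) = 0"
    by (rule wave_array_eq_0[OF wave_array_diff[OF assms(1,2)] assms(3), of "i + int m + 1"])
      (use assms(4) in auto)
  then show ?thesis by (simp add: m)
qed (use assms(1,2) in \<open>auto simp: wave_array_def\<close>)

text \<open>The axis values determine a coordinate plane, and the plane determines the octant, each
  time by uniqueness for the wave recurrence.\<close>

lemma neighbor_array_unique:
  assumes a: "neighbor_array \<beta> a" and b: "neighbor_array \<beta> b" and "\<beta> > 0"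
  shows "a i j k = b i j k"
proof -
  have 1: "a i 0 0 = b i 0 0" for i
  proof (cases "i \<ge> 0")
    case True
    then obtain n where "i = int n" by (metis nonneg_int_cases)
    then show ?thesis using neighbor_array_axis[OF a] neighbor_array_axis[OF b] \<open>\<beta> > 0\<close> by simp
  next
    case False
    then show ?thesis using a b by (auto simp: neighbor_array_def wave_array_def)
  qed
  have 2: "a i 0 k = b i 0 k" for i k
    by (rule wave_array_unique[of \<beta> "\<lambda>i k. a i 0 k" "\<lambda>i k. b i 0 k"])
      (use a b 1 \<open>\<beta> > 0\<close> in \<open>auto simp: neighbor_array_def\<close>)
  show ?thesis
    by (rule wave_array_unique[of \<beta> "\<lambda>i j. a i j k" "\<lambda>i j. b i j k"])
      (use a b 2 \<open>\<beta> > 0\<close> in \<open>auto simp: neighbor_array_def\<close>)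
qed

text \<open>The determining relations are invariant under permutations of the coordinates, hence so
  is their only solution.\<close>

lemma neighbor_array_sym:
  assumes "neighbor_array \<beta> a" "\<beta> > 0"
  shows "a i j k = a k j i" "a i j k = a i k j"
  using neighbor_array_unique[OF assms(1) neighbor_array_swap(1)[OF assms(1)] assms(2)]
    neighbor_array_unique[OF assms(1) neighbor_array_swap(2)[OF assms(1)] assms(2)] by auto

section \<open>From the given recurrences to the wave equations\<close>

definition ext_array :: "(nat ^ 3 \<Rightarrow> real) \<Rightarrow> int \<Rightarrow> int \<Rightarrow> int \<Rightarrow> real" where
  "ext_array A i j k = zero_ext A (vector [i, j, k])"

lemma ext_array_neg: "i < 0 \<or> j < 0 \<or> k < 0 \<Longrightarrow> ext_array A i j k = 0"
  by (auto simp: ext_array_def zero_ext_def forall_3)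

lemma ext_array_nat: "ext_array A (int i) (int j) (int k) = A (vector [i, j, k])"
proof -
  have "(\<chi> l. nat ((vector [int i, int j, int k] :: int ^ 3) $ l)) = vector [i, j, k]"
    by (simp add: vec_eq_iff forall_3)
  then show ?thesis by (simp add: ext_array_def zero_ext_def forall_3)
qed

text \<open>With S_j the shift in direction j, the right-hand side of the first recurrence is (1 -
  S_j)(1 - S_k) B. One more difference, in direction l, completes the product over all three
  directions, which is symmetric: this yields the wave equations. On an axis a single value of B
  survives in each recurrence and can be eliminated.\<close>

lemma neighbor_array_ext_array:
  assumes nc: "neighbor_coeffs \<beta> A B" and "\<beta> > 0"
  shows "neighbor_array \<beta> (ext_array A)"
proof -
  let ?a = "ext_array A" and ?b = "ext_array B"
  have vec: "vector [i, j, k] + unit_vec 1 = vector [i + 1, j, k]"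
      "vector [i, j, k] + unit_vec 2 = vector [i, j + 1, k]"
      "vector [i, j, k] + unit_vec 3 = vector [i, j, k + 1]"
      "vector [i, j, k] - unit_vec 1 = vector [i - 1, j, k]"
      "vector [i, j, k] - unit_vec 2 = vector [i, j - 1, k]"
      "vector [i, j, k] - unit_vec 3 = vector [i, j, k - 1]" for i j k :: int
    by (simp_all add: vec_eq_iff forall_3 axis_def)
  have sets: "{2, 3, 1} = (UNIV :: 3 set)" "{1, 3, 2} = (UNIV :: 3 set)" "{1, 2, 3} = (UNIV :: 3 set)"
    by (auto simp: UNIV_3)
  have F1: "jacobi_flux \<beta> (\<lambda>i. ?a i j k) i = ?b i j k - ?b i (j - 1) k - ?b i j (k - 1) + ?b i (j - 1) (k - 1)"
    and G1: "(2 * of_int j * of_int k + \<beta> * of_int j + \<beta> * of_int k + \<beta> * of_int i + \<beta>\<^sup>2) * ?a i j k =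
       ?b (i - 1) (j - 1) k + ?b (i - 1) j (k - 1) - ?b i j k - ?b i (j - 1) (k - 1)" for i j k
    using nc[unfolded neighbor_coeffs_def Let_def, THEN conjunct2, rule_format, OF sets(1), of "vector [i, j, k]"]
    by (simp_all add: vec jacobi_flux_def ext_array_def)
  have F2: "jacobi_flux \<beta> (\<lambda>j. ?a i j k) j = ?b i j k - ?b (i - 1) j k - ?b i j (k - 1) + ?b (i - 1) j (k - 1)"
    and G2: "(2 * of_int i * of_int k + \<beta> * of_int i + \<beta> * of_int k + \<beta> * of_int j + \<beta>\<^sup>2) * ?a i j k =
       ?b (i - 1) (j - 1) k + ?b i (j - 1) (k - 1) - ?b i j k - ?b (i - 1) j (k - 1)" for i j k
    using nc[unfolded neighbor_coeffs_def Let_def, THEN conjunct2, rule_format, OF sets(2), of "vector [i, j, k]"]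
    by (simp_all add: vec jacobi_flux_def ext_array_def)
  have F3: "jacobi_flux \<beta> (\<lambda>k. ?a i j k) k = ?b i j k - ?b (i - 1) j k - ?b i (j - 1) k + ?b (i - 1) (j - 1) k"
    and G3: "(2 * of_int i * of_int j + \<beta> * of_int i + \<beta> * of_int j + \<beta> * of_int k + \<beta>\<^sup>2) * ?a i j k =
       ?b (i - 1) j (k - 1) + ?b i (j - 1) (k - 1) - ?b i j k - ?b (i - 1) (j - 1) k" for i j k
    using nc[unfolded neighbor_coeffs_def Let_def, THEN conjunct2, rule_format, OF sets(3), of "vector [i, j, k]"]
    by (simp_all add: vec jacobi_flux_def ext_array_def)
  have "?a 0 0 0 = 1"
  proof -
    have "(vector [0, 0, 0] :: nat ^ 3) = 0" by (simp add: vec_eq_iff forall_3)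
    then show ?thesis using ext_array_nat[of A 0 0 0] nc by (simp add: neighbor_coeffs_def)
  qed
  moreover have "wave_array \<beta> (\<lambda>i j. ?a i j k)" for k
    by (simp add: wave_array_def F1 F2 ext_array_neg)
  moreover have "wave_array \<beta> (\<lambda>i k. ?a i j k)" for j
    by (simp add: wave_array_def F1 F3 ext_array_neg)
  moreover have "wave_array \<beta> (\<lambda>j k. ?a i j k)" for i
    by (simp add: wave_array_def F2 F3 ext_array_neg)
  moreover have "(2 * \<beta> + real n) * (1 + real n) * ?a (int (Suc n)) 0 0 = (\<beta> + real n) * (1 - 2 * \<beta> + real n) * ?a (int n) 0 0" for n
    using F1[of 0 0 "int n"] G1[of 0 0 "int n"]
    by (simp add: jacobi_flux_def ext_array_neg algebra_simps power2_eq_square)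
  moreover have "(2 * \<beta> + real n) * (1 + real n) * ?a 0 (int (Suc n)) 0 = (\<beta> + real n) * (1 - 2 * \<beta> + real n) * ?a 0 (int n) 0" for n
    using F2[of 0 0 "int n"] G2[of 0 0 "int n"]
    by (simp add: jacobi_flux_def ext_array_neg algebra_simps power2_eq_square)
  moreover have "(2 * \<beta> + real n) * (1 + real n) * ?a 0 0 (int (Suc n)) = (\<beta> + real n) * (1 - 2 * \<beta> + real n) * ?a 0 0 (int n)" for n
    using F3[of 0 0 "int n"] G3[of 0 0 "int n"]
    by (simp add: jacobi_flux_def ext_array_neg algebra_simps power2_eq_square)
  ultimately show ?thesis unfolding neighbor_array_def by simp
qed

section \<open>Generalised translation\<close>

text \<open>\<open>txpt x y \<theta>\<close> is the squared modulus of the Moebius sum of \<open>sqrt x\<close> and \<open>- sqrt y exp(\<i>\<theta>)\<close>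
  in the unit disc.\<close>

definition txpt :: "real \<Rightarrow> real \<Rightarrow> real \<Rightarrow> real" where
  "txpt x y \<theta> = (x + y - 2 * sqrt (x * y) * cos \<theta>) / gkern (sqrt (x * y)) \<theta>"

text \<open>The division by \<open>gnorm\<close> makes translation by 0 the identity.\<close>

definition transl :: "real \<Rightarrow> (real \<Rightarrow> real) \<Rightarrow> real \<Rightarrow> real \<Rightarrow> real" where
  "transl \<beta> h x y = integral {0..pi} (\<lambda>\<theta>. sin \<theta> powr (4 * \<beta> - 2) * gkern (sqrt (x * y)) \<theta> powr (- \<beta>) * h (txpt x y \<theta>))
     / gnorm (4 * \<beta> - 2)"

text \<open>The last assumption keeps away from the only zero of W over [0, pi], which is at x = y =
  1 and \<theta> = 0.\<close>

lemma gkern_sqrt_pos: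
  assumes "x \<in> {0..1}" "y \<in> {0..1}" "\<theta> \<in> {0<..<pi} \<or> x * y < 1"
  shows "gkern (sqrt (x * y)) \<theta> > 0"
  using assms(3)
proof
  assume "\<theta> \<in> {0<..<pi}"
  then have "(sin \<theta>)\<^sup>2 > 0" by (simp add: sin_gt_zero less_imp_neq[THEN not_sym])
  then show ?thesis using gkern_ge_sin_squared[of \<theta>] by (rule less_le_trans)
next
  assume "x * y < 1"
  then have "\<bar>sqrt (x * y)\<bar> < 1" using assms by (simp add: real_sqrt_lt_1_iff)
  then show ?thesis by (rule gkern_pos)
qed

text \<open>Subtracting x + y - 2 sqrt (x y) cos \<theta> from W cancels the terms with the square
  root and leaves 1 + x y - x - y.\<close>

lemma one_minus_txpt:
  assumes "x \<in> {0..1}" "y \<in> {0..1}" "\<theta> \<in> {0<..<pi} \<or> x * y < 1"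
  shows "1 - txpt x y \<theta> = (1 - x) * (1 - y) / gkern (sqrt (x * y)) \<theta>"
  using gkern_sqrt_pos[OF assms] assms(1,2)
  by (simp add: txpt_def field_simps) (simp add: gkern_def algebra_simps)

lemma txpt_mem:
  assumes "x \<in> {0..1}" "y \<in> {0..1}" "\<theta> \<in> {0<..<pi} \<or> x * y < 1"
  shows "txpt x y \<theta> \<in> {0..1}"
proof -
  have "2 * sqrt (x * y) * cos \<theta> \<le> 2 * sqrt (x * y) * 1"
    by (intro mult_left_mono cos_le_one) (use assms in auto)
  also have "\<dots> \<le> x + y"
    using assms(1,2) arith_geo_mean_sqrt[of x y] by simp
  finally have "txpt x y \<theta> \<ge> 0"
    unfolding txpt_def using gkern_sqrt_pos[OF assms] by simp
  moreover have "1 - txpt x y \<theta> \<ge> 0"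
    unfolding one_minus_txpt[OF assms] using gkern_sqrt_pos[OF assms] assms by simp
  ultimately show ?thesis by simp
qed

lemma txpt_less_1:
  assumes "x \<in> {0..<1}" "y \<in> {0..<1}"
  shows "txpt x y \<theta> < 1"
proof -
  have xy: "x * y < 1" using assms mult_strict_mono'[of x 1 y 1] by simp
  then have "1 - txpt x y \<theta> > 0"
    using one_minus_txpt[of x y \<theta>] gkern_sqrt_pos[of x y \<theta>] assms by simp
  then show ?thesis by simp
qed

section \<open>Domination and continuity of the translation up to the boundary\<close>

lemma sin_ge_quarter:
  assumes "0 \<le> x" "x \<le> pi / 2"
  shows "x / 4 \<le> sin x"
\<comment> \<open>Up to pi/3 the function sin t - t/4 has derivative at least 1/4; beyond, sin x >=
  1/2 already exceeds x/4 <= pi/8.\<close>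
proof (cases "x \<le> pi / 3")
  case True
  have "(\<lambda>t. sin t - t / 4) 0 \<le> (\<lambda>t. sin t - t / 4) x"
  proof (rule DERIV_nonneg_imp_nondecreasing[OF assms(1)])
    fix t assume t: "0 \<le> t" "t \<le> x"
    have "cos (pi / 3) \<le> cos t"
      using t True by (intro cos_monotone_0_pi_le) auto
    then show "\<exists>y. ((\<lambda>t. sin t - t / 4) has_real_derivative y) (at t) \<and> 0 \<le> y"
      by (intro exI[of _ "cos t - 1 / 4"]) (auto intro!: derivative_eq_intros simp: cos_60)
  qed
  then show ?thesis by simp
next
  case False
  have "sin (pi / 6) \<le> sin x"
    using False assms by (intro sin_monotone_2pi_le) auto
  then show ?thesis using assms pi_less_4 by (simp add: sin_30)
qed

text \<open>For cos \<theta> <= 0 one has W >= 1 and the weight is at most 1. Otherwise W >= sin^2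
  leaves sin^(2\<beta> - 2), with exponent at least -2/3 precisely when \<beta> >= 2/3. Since pi <
  4, the bound in terms of \<theta>/4 is at least 1 everywhere and so covers the first case
  too.\<close>

lemma transl_weight_bound:
  assumes "\<beta> \<ge> 2 / 3" "\<rho> \<ge> 0" and \<theta>: "\<theta> \<in> {0<..<pi}"
  shows "sin \<theta> powr (4 * \<beta> - 2) * gkern \<rho> \<theta> powr (- \<beta>) \<le> (\<theta> / 4) powr (- 2 / 3)"
proof -
  have s: "0 < sin \<theta>" "sin \<theta> \<le> 1" using \<theta> by (auto simp: sin_gt_zero)
  have q: "0 < \<theta> / 4" "\<theta> / 4 \<le> 1" using \<theta> pi_less_4 by auto
  show ?thesis
  proof (cases "cos \<theta> \<le> 0")
    case True
    have "\<rho> * cos \<theta> \<le> 0" using True assms by (simp add: mult_nonneg_nonpos)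
    then have "gkern \<rho> \<theta> \<ge> 1"
      by (simp add: gkern_def add_increasing2)
    then have "gkern \<rho> \<theta> powr (- \<beta>) \<le> 1"
      using powr_mono[of "- \<beta>" 0 "gkern \<rho> \<theta>"] assms by simp
    moreover have "sin \<theta> powr (4 * \<beta> - 2) \<le> 1"
      using s assms powr_le1 by simp
    ultimately have "sin \<theta> powr (4 * \<beta> - 2) * gkern \<rho> \<theta> powr (- \<beta>) \<le> 1"
      by (intro mult_le_one) auto
    also have "1 \<le> (\<theta> / 4) powr (- 2 / 3)"
      using powr_mono'[of "- 2 / 3" 0 "\<theta> / 4"] q by simp
    finally show ?thesis .
  next
    case False
    have "\<theta> \<le> pi / 2"
    proof (rule ccontr)
      assume "\<not> \<theta> \<le> pi / 2"
      then have "cos \<theta> \<le> cos (pi / 2)" using \<theta> by (intro cos_monotone_0_pi_le) auto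
      with False show False by simp
    qed
    then have sq: "\<theta> / 4 \<le> sin \<theta>" using \<theta> by (intro sin_ge_quarter) auto
    have "gkern \<rho> \<theta> powr (- \<beta>) \<le> ((sin \<theta>)\<^sup>2) powr (- \<beta>)"
      using gkern_ge_sin_squared[of \<theta> \<rho>] s assms by (intro powr_mono2') auto
    also have "\<dots> = sin \<theta> powr (- 2 * \<beta>)"
      using s powr_powr[of "sin \<theta>" 2 "- \<beta>"] by (simp add: powr_numeral)
    finally have "sin \<theta> powr (4 * \<beta> - 2) * gkern \<rho> \<theta> powr (- \<beta>) \<le> sin \<theta> powr (4 * \<beta> - 2) * sin \<theta> powr (- 2 * \<beta>)"
      by (intro mult_left_mono) auto
    also have "\<dots> = sin \<theta> powr (2 * \<beta> - 2)" by (simp add: powr_add[symmetric])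
    also have "\<dots> \<le> sin \<theta> powr (- 2 / 3)"
      using s assms by (intro powr_mono') auto
    also have "\<dots> \<le> (\<theta> / 4) powr (- 2 / 3)"
      using sq q by (intro powr_mono2') auto
    finally show ?thesis .
  qed
qed

lemma continuous_on_transl_integrand:
  fixes H :: "real \<Rightarrow> real \<Rightarrow> real"
  assumes H: "continuous_on ({0..1} \<times> {0..1}) (\<lambda>(x, z). H x z)"
  shows "continuous_on (({0..1} \<times> {0..1} \<times> {0..1}) \<times> {0<..<pi}) (\<lambda>((x, y, z), \<theta>).
     sin \<theta> powr \<mu> * gkern (sqrt (x * y)) \<theta> powr s * H (txpt x y \<theta>) z)"
  unfolding split_def
proof (intro continuous_on_mult continuous_on_powr continuous_intros)
  let ?D = "({0..1} \<times> {0..1} \<times> {0..1}) \<times> {0<..<pi} :: ((real \<times> real \<times> real) \<times> real) set"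
  show "\<forall>p\<in>?D. sin (snd p) \<noteq> 0" by (auto simp: sin_gt_zero less_imp_neq[THEN not_sym])
  have pos: "gkern (sqrt (fst (fst p) * fst (snd (fst p)))) (snd p) > 0" if "p \<in> ?D" for p
    using that by (intro gkern_sqrt_pos) auto
  then show "\<forall>p\<in>?D. gkern (sqrt (fst (fst p) * fst (snd (fst p)))) (snd p) \<noteq> 0" by fastforce
  show "continuous_on ?D (\<lambda>p. H (txpt (fst (fst p)) (fst (snd (fst p))) (snd p)) (snd (snd (fst p))))"
  proof (rule continuous_on_compose2[OF H, where f = "\<lambda>p. (txpt (fst (fst p)) (fst (snd (fst p))) (snd p), snd (snd (fst p)))", unfolded split_def fst_conv snd_conv])
    show "continuous_on ?D (\<lambda>p. (txpt (fst (fst p)) (fst (snd (fst p))) (snd p), snd (snd (fst p))))"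
      unfolding txpt_def using pos by (intro continuous_intros) fastforce+
    show "(\<lambda>p. (txpt (fst (fst p)) (fst (snd (fst p))) (snd p), snd (snd (fst p)))) ` ?D \<subseteq> {0..1} \<times> {0..1}"
      using txpt_mem by fastforce
  qed
qed

text \<open>The variable z is a passive parameter for the second translation, which acts on a
  function of two variables. The open interval avoids the zero of W at \<theta> = 0, and
  \<open>transl_weight_bound\<close> supplies a majorant that is independent of the point of the
  cube.\<close>

lemma continuous_on_transl:
  fixes H :: "real \<Rightarrow> real \<Rightarrow> real"
  assumes \<beta>: "\<beta> \<ge> 2 / 3" and H: "continuous_on ({0..1} \<times> {0..1}) (\<lambda>(x, z). H x z)"
  shows "continuous_on ({0..1} \<times> {0..1} \<times> {0..1}) (\<lambda>(x, y, z). transl \<beta> (\<lambda>x. H x z) x y)"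
proof -
  let ?S = "{0..1} \<times> {0..1} \<times> {0..1} :: (real \<times> real \<times> real) set"
  define K where "K = (\<lambda>p \<theta>. case p of (x, y, z) \<Rightarrow>
     sin \<theta> powr (4 * \<beta> - 2) * gkern (sqrt (x * y)) \<theta> powr (- \<beta>) * H (txpt x y \<theta>) z)"
  have K: "continuous_on (?S \<times> {0<..<pi}) (\<lambda>(p, \<theta>). K p \<theta>)"
    using continuous_on_transl_integrand[OF H, of "4 * \<beta> - 2" "- \<beta>"] by (simp add: K_def split_def)
  obtain M where M: "\<And>x z. x \<in> {0..1} \<Longrightarrow> z \<in> {0..1} \<Longrightarrow> \<bar>H x z\<bar> \<le> M"
  proof -
    have "bounded ((\<lambda>(x, z). H x z) ` ({0..1} \<times> {0..1}))"
      by (intro compact_imp_bounded compact_continuous_image H compact_Times) auto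
    then show ?thesis using that by (force simp: bounded_real)
  qed
  define h where "h = (\<lambda>\<theta>. M * ((1 / 4) powr (- 2 / 3) * \<theta> powr (- 2 / 3)) :: real)"
  have h: "h integrable_on {0<..<pi}"
    using integrable_on_powr_from_0[of "- 2 / 3" pi] unfolding h_def
    by (intro integrable_on_mult_right) (simp add: integrable_on_Icc_iff_Ioo)
  have Kh: "\<bar>K p \<theta>\<bar> \<le> h \<theta>" if "p \<in> ?S" "\<theta> \<in> {0<..<pi}" for p \<theta>
  proof -
    obtain x y z where p: "p = (x, y, z)" by (cases p)
    have "\<bar>K p \<theta>\<bar> = \<bar>H (txpt x y \<theta>) z\<bar> * (sin \<theta> powr (4 * \<beta> - 2) * gkern (sqrt (x * y)) \<theta> powr (- \<beta>))"
      by (simp add: K_def p abs_mult)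
    also have "\<dots> \<le> M * (\<theta> / 4) powr (- 2 / 3)"
      using that p M[OF txpt_mem, of x y \<theta> z] by (intro mult_mono transl_weight_bound \<beta>) (auto intro: order_trans[OF abs_ge_zero])
    also have "\<dots> = h \<theta>"
      using that powr_mult[of "1/4" \<theta> "- 2 / 3"] by (simp add: h_def)
    finally show ?thesis .
  qed
  have Ki: "K p integrable_on {0<..<pi}" if "p \<in> ?S" for p
  proof (rule measurable_bounded_by_integrable_imp_integrable_real[OF _ h Kh[OF that]])
    have "continuous_on {0<..<pi} (\<lambda>\<theta>. case (p, \<theta>) of (p, \<theta>) \<Rightarrow> K p \<theta>)"
      by (rule continuous_on_compose2[OF K], intro continuous_intros) (use that in auto)
    then have "continuous_on {0<..<pi} (K p)" by simp
    then show "K p \<in> borel_measurable (lebesgue_on {0<..<pi})"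
      by (rule continuous_imp_measurable_on_sets_lebesgue) auto
  qed auto
  have "continuous_on ?S (\<lambda>p. integral {0<..<pi} (K p))"
  proof (rule continuous_on_sequentiallyI)
    fix u a assume u: "\<forall>n. u n \<in> ?S" and a: "a \<in> ?S" and lim: "u \<longlonglongrightarrow> a"
    show "(\<lambda>n. integral {0<..<pi} (K (u n))) \<longlonglongrightarrow> integral {0<..<pi} (K a)"
    proof (rule dominated_convergence(2)[OF _ h])
      show "K (u n) integrable_on {0<..<pi}" for n using Ki u by blast
      show "norm (K (u n) \<theta>) \<le> h \<theta>" if "\<theta> \<in> {0<..<pi}" for n \<theta> using Kh[OF _ that] u by simp
      show "(\<lambda>n. K (u n) \<theta>) \<longlonglongrightarrow> K a \<theta>" if "\<theta> \<in> {0<..<pi}" for \<theta>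
      proof -
        have "continuous_on ?S (\<lambda>p. case (p, \<theta>) of (p, \<theta>) \<Rightarrow> K p \<theta>)"
          by (rule continuous_on_compose2[OF K], intro continuous_intros) (use that in auto)
        then have "continuous_on ?S (\<lambda>p. K p \<theta>)" by simp
        then show ?thesis using u a lim by (auto intro: continuous_on_tendsto_compose)
      qed
    qed
  qed
  then have "continuous_on ?S (\<lambda>p. integral {0<..<pi} (K p) / gnorm (4 * \<beta> - 2))"
    using gnorm_pos[of "4 * \<beta> - 2"] \<beta> by (intro continuous_intros) auto
  moreover have "(\<lambda>(x, y, z). transl \<beta> (\<lambda>x. H x z) x y) = (\<lambda>p. integral {0<..<pi} (K p) / gnorm (4 * \<beta> - 2))"
    by (auto simp: fun_eq_iff transl_def K_def integral_open_interval_real)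
  ultimately show ?thesis by simp
qed

text \<open>For x = 1 every translated point is X = 1, so h leaves the integral and the mean of
  W^(-\<beta>) at radius sqrt y remains.\<close>

lemma transl_1_left:
  assumes \<beta>: "\<beta> \<ge> 2 / 3" and y: "y \<in> {0..<1}"
  shows "transl \<beta> h 1 y = h 1 * (\<Sum>k. hyp2F1 \<beta> (1 - \<beta>) (2 * \<beta>) k * y ^ k)"
proof -
  let ?\<mu> = "4 * \<beta> - 2"
  have x: "txpt 1 y \<theta> = 1" for \<theta>
    using one_minus_txpt[of 1 y \<theta>] y by simp
  have "(\<lambda>k. gnorm ?\<mu> * hyp2F1 \<beta> (\<beta> - ?\<mu> / 2) (?\<mu> / 2 + 1) k * sqrt y ^ (2 * k)) sums
     integral {0..pi} (\<lambda>x. sin x powr ?\<mu> * gkern (sqrt y) x powr (- \<beta>))"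
    using \<beta> y by (intro gegenbauer_integral_sums) (auto simp: real_sqrt_lt_1_iff)
  moreover have "\<beta> - ?\<mu> / 2 = 1 - \<beta>" "?\<mu> / 2 + 1 = 2 * \<beta>" by (simp_all add: field_simps)
  moreover have "sqrt y ^ (2 * k) = y ^ k" for k
    using y by (simp add: power_mult)
  ultimately have "(\<lambda>k. gnorm ?\<mu> * (hyp2F1 \<beta> (1 - \<beta>) (2 * \<beta>) k * y ^ k)) sums
     integral {0..pi} (\<lambda>x. sin x powr ?\<mu> * gkern (sqrt y) x powr (- \<beta>))" by (simp add: mult.assoc)
  from sums_divide[OF this, of "gnorm ?\<mu>"]
  have "(\<Sum>k. hyp2F1 \<beta> (1 - \<beta>) (2 * \<beta>) k * y ^ k) =
     integral {0..pi} (\<lambda>x. sin x powr ?\<mu> * gkern (sqrt y) x powr (- \<beta>)) / gnorm ?\<mu>"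
    using gnorm_pos[of ?\<mu>] \<beta> by (simp add: sums_iff)
  then show ?thesis
    by (simp add: transl_def x)
qed

section \<open>Hypergeometric series and Gauss's theorem\<close>

text \<open>Raabe's test: n (|u_n / u_(n+1)| - 1) tends to c + 1 - a - b > 1. A series with a
  vanishing term terminates and is treated apart, since the test divides by the terms.\<close>

lemma hyp2F1_summable:
  assumes c: "c > 0" and abc: "a + b < c"
  shows "summable (\<lambda>n. \<bar>hyp2F1 a b c n\<bar>)"
proof (cases "\<exists>N. hyp2F1 a b c N = 0")
  case True
  then obtain N where N: "hyp2F1 a b c N = 0" by blast
  have "hyp2F1 a b c n = 0" if "n \<ge> N" for n
    using that
  proof (induction n rule: dec_induct)
    case (step n)
    have "c + real n \<noteq> 0" using c by simp
    then show ?case using hyp2F1_Suc[OF c, of n a b] step by (simp del: of_nat_Suc)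
  qed (rule N)
  then show ?thesis by (intro summable_finite[of "{..<N}"]) auto
next
  case False
  let ?u = "\<lambda>n. \<bar>hyp2F1 a b c n\<bar>"
  have nz: "hyp2F1 a b c n \<noteq> 0" for n using False by blast
  have "((\<lambda>n. real n * ((c + real n) * (1 + real n) / ((a + real n) * (b + real n)) - 1)) \<longlongrightarrow> c + 1 - a - b) sequentially"
    by real_asymp
  moreover have "eventually (\<lambda>n. real n * ((c + real n) * (1 + real n) / ((a + real n) * (b + real n)) - 1)
      = real n * (?u n / ?u (Suc n) - 1)) sequentially"
  proof -
    have "eventually (\<lambda>n. real n > \<bar>a\<bar> + \<bar>b\<bar>) sequentially" by real_asymp
    then show ?thesis
    proof eventually_elim
      case (elim n)
      have p: "(a + real n) * (b + real n) > 0" "(c + real n) * (1 + real n) > 0"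
        using elim c by (auto intro!: mult_pos_pos)
      have "\<bar>(c + real n) * (1 + real n) * hyp2F1 a b c (Suc n)\<bar> = \<bar>(a + real n) * (b + real n) * hyp2F1 a b c n\<bar>"
        using hyp2F1_Suc[OF c, of n a b] by simp
      then have "((c + real n) * (1 + real n)) * ?u (Suc n) = ((a + real n) * (b + real n)) * ?u n"
        unfolding abs_mult[of _ "hyp2F1 a b c _"] using p by simp
      moreover have "?u (Suc n) > 0" using nz by simp
      moreover have "C / P = U / V" if "C * V = P * U" "P > 0" "V > 0" for C P U V :: real
        using that by (simp add: field_simps)
      ultimately show ?case using p by simp
    qed
  qed
  ultimately have "((\<lambda>n. real n * (?u n / ?u (Suc n) - 1)) \<longlongrightarrow> c + 1 - a - b) sequentially"
    by (rule Lim_transform_eventually)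
  then have "((\<lambda>n. ereal (real n * (?u n / ?u (Suc n) - 1))) \<longlongrightarrow> ereal (c + 1 - a - b)) sequentially"
    by simp
  then have "liminf (\<lambda>n. ereal (real n * (?u n / ?u (Suc n) - 1))) = ereal (c + 1 - a - b)"
    by (intro lim_imp_Liminf) auto
  then show ?thesis
    using abc nz by (intro raabes_test_convergence) (auto simp: one_ereal_def)
qed

lemma hyp2F1_series_continuous:
  assumes "c > 0" "a + b < c"
  shows "continuous_on {0..1} (\<lambda>x. \<Sum>n. hyp2F1 a b c n * x ^ n)"
proof -
  have "uniform_limit {0..1} (\<lambda>n x. \<Sum>i<n. hyp2F1 a b c i * x ^ i) (\<lambda>x. \<Sum>i. hyp2F1 a b c i * x ^ i) sequentially"
    by (rule Weierstrass_m_test[OF _ hyp2F1_summable[OF assms]])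
      (auto simp: abs_mult intro!: mult_left_le power_le_one)
  then show ?thesis
    by (rule uniform_limit_theorem[rotated]) (auto intro!: always_eventually continuous_intros)
qed

lemma f_beta_eq: "f_beta \<beta> x = (\<Sum>n. hyp2F1 (1 - \<beta>) \<beta> (2 * \<beta>) n * x ^ n)"
  by (simp add: f_beta_def eval_fps_def hyp2F1_def)

lemma hyp2F1_commute: "hyp2F1 a b c n = hyp2F1 b a c n"
  by (simp add: hyp2F1_def mult.commute)

text \<open>Euler's integral of \<open>(1 - t) powr (- a)\<close> against the Beta density, expanded in powers of \<open>t\<close>.\<close>

theorem gauss_hypergeometric:
  fixes a b c :: real
  assumes b: "b > 0" and cb: "c > b" and abc: "a + b < c" and a: "a < 0"
  shows "(\<Sum>n. hyp2F1 a b c n) = Gamma c * Gamma (c - a - b) / (Gamma (c - a) * Gamma (c - b))"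
proof -
  define w where "w = (\<lambda>t::real. t powr (b - 1) * (1 - t) powr (c - b - 1))"
  \<comment> \<open>This is (a)_n / n!, the coefficient of t^n in (1 - t)^(-a). Written as a 2F1
    coefficient, it is absolutely summable by the case a + 1 < 1 of \<open>hyp2F1_summable\<close>;
    here a < 0 enters, and the sum gives the majorant for dominated convergence.\<close>
  define d where "d = hyp2F1 a 1 1"
  have d_sum: "summable (\<lambda>n. \<bar>d n\<bar>)"
    unfolding d_def using a by (intro hyp2F1_summable) auto
  have d: "d n = pochhammer a n / fact n" for n
    by (simp add: d_def hyp2F1_def pochhammer_fact[symmetric])
  have wb: "(w has_integral Beta b (c - b)) {0..1}"
    unfolding w_def using b cb by (intro has_integral_Beta_real) auto
  have wn: "((\<lambda>t. w t * (d n * t ^ n)) has_integral Beta b (c - b) * hyp2F1 a b c n) {0<..<1}" for n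
  proof -
    have "((\<lambda>t. t powr (b + n - 1) * (1 - t) powr (c - b - 1)) has_integral Beta (b + n) (c - b)) {0<..<1}"
      using has_integral_Beta_real[of "b + n" "c - b"] b cb by (simp add: has_integral_Icc_iff_Ioo)
    from has_integral_mult_right[OF this, of "d n"]
    have I: "((\<lambda>t. d n * (t powr (b + n - 1) * (1 - t) powr (c - b - 1))) has_integral d n * Beta (b + n) (c - b)) {0<..<1}" .
    \<comment> \<open>The quotient of Beta(b + n, c - b) by Beta(b, c - b) is (b)_n / (c)_n.\<close>
    have val: "d n * Beta (b + n) (c - b) = Beta b (c - b) * hyp2F1 a b c n"
    proof -
      have "b \<notin> \<int>\<^sub>\<le>\<^sub>0" "c \<notin> \<int>\<^sub>\<le>\<^sub>0" using b cb by (auto elim!: nonpos_Ints_cases)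
      then have "Gamma (b + n) = pochhammer b n * Gamma b" "Gamma (c + n) = pochhammer c n * Gamma c"
        using pochhammer_Gamma[of b n] pochhammer_Gamma[of c n] by (auto simp: Gamma_eq_zero_iff)
      moreover have "pochhammer c n > 0" using b cb by (intro pochhammer_pos) simp
      ultimately show ?thesis
        using Gamma_real_pos[of c] b cb by (simp add: Beta_def d hyp2F1_def field_simps)
    qed
    have "d n * (t powr (b + n - 1) * (1 - t) powr (c - b - 1)) = w t * (d n * t ^ n)" if "t \<in> {0<..<1}" for t
      using that powr_add[of t "b - 1" n] by (simp add: w_def powr_realpow algebra_simps)
    from has_integral_eq[OF this I] show ?thesis unfolding val .
  qed
  define f where "f = (\<lambda>N t. \<Sum>n<N. w t * (d n * t ^ n))"
  have fi: "(f N has_integral (\<Sum>n<N. Beta b (c - b) * hyp2F1 a b c n)) {0<..<1}" for N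
    unfolding f_def by (intro has_integral_sum wn) auto
  have "(\<lambda>N. integral {0<..<1} (f N)) \<longlonglongrightarrow> integral {0<..<1} (\<lambda>t. w t * (1 - t) powr (- a))"
  proof (rule dominated_convergence(2))
    show "f N integrable_on {0<..<1}" for N using fi by blast
    show "(\<lambda>t. w t * (\<Sum>n. \<bar>d n\<bar>)) integrable_on {0<..<1}"
      using wb by (intro integrable_on_mult_left) (auto simp: has_integral_Icc_iff_Ioo)
    show "norm (f N t) \<le> w t * (\<Sum>n. \<bar>d n\<bar>)" if "t \<in> {0<..<1}" for N t
    proof -
      have "norm (f N t) \<le> (\<Sum>n<N. w t * \<bar>d n\<bar>)"
        unfolding f_def using that
        by (intro sum_norm_le) (auto simp: w_def abs_mult power_le_one intro!: mult_left_mono mult_left_le)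
      also have "\<dots> \<le> w t * (\<Sum>n. \<bar>d n\<bar>)"
        unfolding sum_distrib_left[symmetric]
        by (intro mult_left_mono sum_le_suminf d_sum) (auto simp: w_def)
      finally show ?thesis .
    qed
    show "(\<lambda>N. f N t) \<longlonglongrightarrow> w t * (1 - t) powr (- a)" if "t \<in> {0<..<1}" for t
    proof -
      have "(\<lambda>n. (- a gchoose n) * (- t) ^ n) sums (1 + - t) powr (- a)"
        using that by (intro gen_binomial_real) auto
      moreover have "(- a gchoose n) * (- t) ^ n = d n * t ^ n" for n
        unfolding power_minus[of t] by (simp add: gbinomial_pochhammer d)
      ultimately have "(\<lambda>n. d n * t ^ n) sums (1 - t) powr (- a)" by simp
      from sums_mult[OF this, of "w t"] show ?thesis
        by (simp add: f_def sums_def)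
    qed
  qed
  moreover have "integral {0<..<1} (\<lambda>t. w t * (1 - t) powr (- a)) = Beta b (c - a - b)"
  proof -
    have I: "((\<lambda>t. t powr (b - 1) * (1 - t) powr (c - a - b - 1)) has_integral Beta b (c - a - b)) {0<..<1}"
      using has_integral_Beta_real[of b "c - a - b"] b abc by (simp add: has_integral_Icc_iff_Ioo)
    have "t powr (b - 1) * (1 - t) powr (c - a - b - 1) = w t * (1 - t) powr (- a)" if "t \<in> {0<..<1}" for t
      using that by (simp add: w_def powr_add[symmetric] algebra_simps)
    from has_integral_eq[OF this I] show ?thesis by (rule integral_unique)
  qed
  ultimately have "(\<lambda>N. \<Sum>n<N. Beta b (c - b) * hyp2F1 a b c n) \<longlonglongrightarrow> Beta b (c - a - b)"
    using integral_unique[OF fi] by simp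
  then have "(\<lambda>n. Beta b (c - b) * hyp2F1 a b c n) sums Beta b (c - a - b)"
    by (simp add: sums_def)
  moreover have Bpos: "Beta b (c - b) > 0"
    using b cb by (simp add: Beta_def Gamma_real_pos)
  ultimately have "(\<lambda>n. hyp2F1 a b c n) sums (Beta b (c - a - b) / Beta b (c - b))"
    using sums_divide[of "\<lambda>n. Beta b (c - b) * hyp2F1 a b c n" _ "Beta b (c - b)"] by simp
  then have "(\<Sum>n. hyp2F1 a b c n) = Beta b (c - a - b) / Beta b (c - b)"
    by (simp add: sums_iff)
  also have "\<dots> = Gamma c * Gamma (c - a - b) / (Gamma (c - a) * Gamma (c - b))"
  proof -
    have "x * y / z / (x * u / v) = v * y / (z * u)" if "x \<noteq> 0" for x y z u v :: real
      using that by simp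
    moreover have "b + (c - a - b) = c - a" "b + (c - b) = c" by simp_all
    ultimately show ?thesis
      unfolding Beta_def using Gamma_real_pos[OF b] by simp
  qed
  finally show ?thesis .
qed

section \<open>Analytic functions of three variables\<close>

lemma vector_3_eq: "(vector [a, b, c] :: 'a::zero ^ 3) = (\<chi> i. if i = 1 then a else if i = 2 then b else c)"
  by (simp add: vec_eq_iff forall_3)

lemma monomial3_3: "monomial3 r n = (r $ 1) ^ (n $ 1) * (r $ 2) ^ (n $ 2) * (r $ 3) ^ (n $ 3)"
  unfolding monomial3_def UNIV_3 by (simp add: mult.assoc)

lemma norm_monomial3_le:
  assumes "\<And>i. norm (r $ i) \<le> s"
  shows "norm (monomial3 r n) \<le> (\<Prod>i\<in>UNIV. s ^ (n $ i))"
  unfolding monomial3_def prod_norm[symmetric] norm_power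
  by (intro prod_mono) (auto intro!: power_mono assms)

text \<open>At the point with all coordinates s >= 0 the monomials equal their absolute values, so
  unconditional summability there controls the whole closed polydisc of radius s.\<close>

lemma polydisc_coeffs_summable:
  assumes "((\<lambda>n. c n * monomial3 (\<chi> i. of_real s) n) has_sum L) UNIV" "s \<ge> 0"
  shows "(\<lambda>n. norm (c n) * (\<Prod>i\<in>UNIV. s ^ (n $ i))) summable_on UNIV"
proof -
  have "(\<lambda>n. norm (c n * monomial3 (\<chi> i. of_real s) n)) summable_on UNIV"
    using assms(1) unfolding summable_on_iff_abs_summable_on_complex[symmetric] by (rule has_sum_imp_summable)
  moreover have "norm (c n * monomial3 (\<chi> i. of_real s) n) = norm (c n) * (\<Prod>i\<in>UNIV. s ^ (n $ i))" for n
    using assms(2) by (simp add: norm_mult monomial3_def prod_norm[symmetric] norm_power)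
  ultimately show ?thesis by simp
qed

lemma analytic3_onE:
  assumes "analytic3_on G U" "z \<in> U"
  obtains c \<epsilon> where "\<epsilon> > 0"
    "\<And>w. (\<forall>i. norm (w $ i - z $ i) < \<epsilon>) \<Longrightarrow> ((\<lambda>n. c n * monomial3 (w - z) n) has_sum G w) UNIV"
proof -
  from bspec[OF conjunct2[OF assms(1)[unfolded analytic3_on_def]] assms(2)]
  obtain c \<epsilon> where "\<epsilon> > 0"
      and *: "\<forall>w. (\<forall>i. norm (w $ i - z $ i) < \<epsilon>) \<longrightarrow> ((\<lambda>n. c n * monomial3 (w - z) n) has_sum G w) UNIV"
    by (elim exE conjE)
  show ?thesis
  proof (rule that[OF \<open>\<epsilon> > 0\<close>])
    fix w assume "\<forall>i. norm (w $ i - z $ i) < \<epsilon>"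
    with spec[OF *, of w] show "((\<lambda>n. c n * monomial3 (w - z) n) has_sum G w) UNIV" by (rule mp)
  qed
qed

text \<open>Halving the radius leaves room for the point z + (\<epsilon>/2, \<epsilon>/2,
  \<epsilon>/2), whose absolutely convergent series is the majorant in the M-test.\<close>

lemma analytic3_uniform_limit:
  assumes eps: "\<epsilon> > 0" and hs: "\<And>w. (\<forall>i. norm (w $ i - z $ i) < \<epsilon>) \<Longrightarrow> ((\<lambda>n. c n * monomial3 (w - z) n) has_sum G w) UNIV"
    and w: "\<And>y i. y \<in> Y \<Longrightarrow> norm (w y $ i - z $ i) \<le> \<epsilon> / 2"
  shows "uniform_limit Y (\<lambda>S y. \<Sum>n\<in>S. c n * monomial3 (w y - z) n) (\<lambda>y. G (w y)) (finite_subsets_at_top UNIV)"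
proof (rule Weierstrass_m_test_general')
  let ?v = "z + (\<chi> i. complex_of_real (\<epsilon> / 2))"
  have "((\<lambda>n. c n * monomial3 (?v - z) n) has_sum G ?v) UNIV"
    using eps by (intro hs) (simp add: norm_divide)
  then have *: "((\<lambda>n. c n * monomial3 (\<chi> i. of_real (\<epsilon> / 2)) n) has_sum G ?v) UNIV" by simp
  show "(\<lambda>n. norm (c n) * (\<Prod>i\<in>UNIV. (\<epsilon> / 2) ^ (n $ i))) summable_on UNIV"
    using eps by (intro polydisc_coeffs_summable[OF *]) auto
  show "norm (c n * monomial3 (w y - z) n) \<le> norm (c n) * (\<Prod>i\<in>UNIV. (\<epsilon> / 2) ^ (n $ i))" if "y \<in> Y" for n y
    unfolding norm_mult using w[OF that] by (intro mult_left_mono norm_monomial3_le) auto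
  show "((\<lambda>n. c n * monomial3 (w y - z) n) has_sum G (w y)) UNIV" if "y \<in> Y" for y
    using eps by (intro hs allI, intro le_less_trans[OF w[OF that]]) simp
qed

lemma analytic3_continuous_on:
  assumes "analytic3_on G U"
  shows "continuous_on U G"
proof -
  have "isCont G z" if z: "z \<in> U" for z
  proof -
    obtain c \<epsilon> where eps: "\<epsilon> > 0" and hs: "\<And>w. (\<forall>i. norm (w $ i - z $ i) < \<epsilon>) \<Longrightarrow> ((\<lambda>n. c n * monomial3 (w - z) n) has_sum G w) UNIV"
      by (rule analytic3_onE[OF assms z]) (rule that)
    have "continuous_on (ball z (\<epsilon> / 2)) G"
    proof (rule uniform_limit_theorem)
      show "uniform_limit (ball z (\<epsilon> / 2)) (\<lambda>S w. \<Sum>n\<in>S. c n * monomial3 (w - z) n) G (finite_subsets_at_top UNIV)"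
      proof (rule analytic3_uniform_limit[OF eps hs])
        fix y i assume "y \<in> ball z (\<epsilon> / 2)"
        then show "norm (y $ i - z $ i) \<le> \<epsilon> / 2"
          using Finite_Cartesian_Product.norm_nth_le[of "y - z" i] by (simp add: dist_norm norm_minus_commute)
      qed
      show "\<forall>\<^sub>F S in finite_subsets_at_top UNIV. continuous_on (ball z (\<epsilon> / 2)) (\<lambda>w. \<Sum>n\<in>S. c n * monomial3 (w - z) n)"
        unfolding monomial3_def by (intro always_eventually allI continuous_intros)
    qed simp
    then show ?thesis using eps by (simp add: continuous_on_eq_continuous_at)
  qed
  then show ?thesis by (simp add: continuous_at_imp_continuous_on)
qed

text \<open>Locally the composition is a uniform limit of polynomials in the holomorphic coordinates
  of w.\<close>

lemma analytic3_compose_holomorphic: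
  assumes G: "analytic3_on G U" and V: "open V" and w: "\<And>i. (\<lambda>t. w t $ i) holomorphic_on V" "w ` V \<subseteq> U"
  shows "(\<lambda>t. G (w t)) holomorphic_on V"
proof -
  have "(\<lambda>t. G (w t)) field_differentiable at t0" if t0: "t0 \<in> V" for t0
  proof -
    define z where "z = w t0"
    have zU: "z \<in> U" using w(2) t0 by (auto simp: z_def)
    obtain c \<epsilon> where eps: "\<epsilon> > 0" and hs: "\<And>v. (\<forall>i. norm (v $ i - z $ i) < \<epsilon>) \<Longrightarrow> ((\<lambda>n. c n * monomial3 (v - z) n) has_sum G v) UNIV"
      by (rule analytic3_onE[OF G zU]) (rule that)
    have "eventually (\<lambda>t. norm (w t $ i - z $ i) < \<epsilon> / 2) (nhds t0)" for i
    proof -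
      have "isCont (\<lambda>t. w t $ i) t0"
        using w(1)[of i] V t0 by (metis continuous_on_eq_continuous_at holomorphic_on_imp_continuous_on)
      then have "((\<lambda>t. w t $ i) \<longlongrightarrow> w t0 $ i) (nhds t0)"
        unfolding isCont_def by (rule tendsto_at_iff_tendsto_nhds[THEN iffD1])
      from tendstoD[OF this, of "\<epsilon> / 2"] show ?thesis
        using eps by (simp add: z_def dist_norm)
    qed
    then have "eventually (\<lambda>t. t \<in> V \<and> (\<forall>i. norm (w t $ i - z $ i) < \<epsilon> / 2)) (nhds t0)"
      using V t0 by (intro eventually_conj eventually_all_finite eventually_nhds_in_open) auto
    then obtain d where d: "d > 0" "\<And>t. dist t t0 < d \<Longrightarrow> t \<in> V \<and> (\<forall>i. norm (w t $ i - z $ i) < \<epsilon> / 2)"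
      unfolding eventually_nhds_metric by blast
    have cb: "cball t0 (d / 2) \<subseteq> V" using d by (auto simp: dist_commute)
    have ul: "uniform_limit (cball t0 (d / 2)) (\<lambda>S t. \<Sum>n\<in>S. c n * monomial3 (w t - z) n) (\<lambda>t. G (w t)) (finite_subsets_at_top UNIV)"
    proof (rule analytic3_uniform_limit[OF eps hs])
      fix y i assume "y \<in> cball t0 (d / 2)"
      then have "dist y t0 < d" using d(1) by (simp add: dist_commute)
      then show "norm (w y $ i - z $ i) \<le> \<epsilon> / 2" using d(2) less_imp_le by blast
    qed
    have hol: "(\<lambda>t. \<Sum>n\<in>S. c n * monomial3 (w t - z) n) holomorphic_on V" for S
      unfolding monomial3_def vector_minus_component by (intro holomorphic_intros w)
    have "(\<lambda>t. G (w t)) holomorphic_on ball t0 (d / 2)"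
    proof (rule holomorphic_uniform_limit[OF _ ul])
      have "continuous_on (cball t0 (d / 2)) (\<lambda>t. \<Sum>n\<in>S. c n * monomial3 (w t - z) n)
          \<and> (\<lambda>t. \<Sum>n\<in>S. c n * monomial3 (w t - z) n) holomorphic_on ball t0 (d / 2)" for S
        using holomorphic_on_subset[OF hol cb] ball_subset_cball[of t0 "d / 2"]
        by (blast intro: holomorphic_on_imp_continuous_on holomorphic_on_subset)
      then show "\<forall>\<^sub>F S in finite_subsets_at_top UNIV. continuous_on (cball t0 (d / 2)) (\<lambda>t. \<Sum>n\<in>S. c n * monomial3 (w t - z) n)
          \<and> (\<lambda>t. \<Sum>n\<in>S. c n * monomial3 (w t - z) n) holomorphic_on ball t0 (d / 2)"
        by (intro always_eventually) auto
    qed auto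
    then show ?thesis
      using d(1) by (auto intro: holomorphic_on_imp_differentiable_at)
  qed
  then show ?thesis
    by (simp add: holomorphic_on_def field_differentiable_at_within)
qed

text \<open>A monomial outside the N x N x N box has total degree at least N, so scaling the
  polydisc of radius 1/20 by s gains s^N. The constant is the absolute sum at radius 1/20, safely
  inside the polydisc of radius 1/10.\<close>

lemma polydisc_truncation:
  assumes hs: "\<And>r. r \<in> small_polydisc \<Longrightarrow> ((\<lambda>n. c n * monomial3 r n) has_sum G r) UNIV"
  obtains M where "M \<ge> 0" "\<And>N s r. 0 \<le> s \<Longrightarrow> s \<le> 1 \<Longrightarrow> (\<And>i. norm (r $ i) \<le> s / 20) \<Longrightarrow>
     norm (G r - (\<Sum>i<N. \<Sum>j<N. \<Sum>k<N. c (vector [i, j, k]) * (r $ 1) ^ i * (r $ 2) ^ j * (r $ 3) ^ k)) \<le> M * s ^ N"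
proof -
  let ?m = "\<lambda>n. norm (c n) * (\<Prod>i\<in>UNIV. (1 / 20) ^ (n $ i))"
  define M where "M = (\<Sum>\<^sub>\<infinity>n. ?m n)"
  have "((\<lambda>n. c n * monomial3 (\<chi> i. of_real (1 / 20)) n) has_sum G (\<chi> i. of_real (1 / 20))) UNIV"
    by (intro hs) (simp add: small_polydisc_def norm_divide)
  from polydisc_coeffs_summable[OF this] have sm: "?m summable_on UNIV" by simp
  have nn: "?m n \<ge> 0" for n by (intro mult_nonneg_nonneg prod_nonneg) auto
  have M0: "M \<ge> 0" unfolding M_def by (intro infsum_nonneg nn)
  show ?thesis
  proof (rule that[OF M0])
    fix N s and r :: "complex ^ 3" assume s: "0 \<le> s" "s \<le> (1::real)" and r: "\<And>i. norm (r $ i) \<le> s / 20"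
    let ?f = "\<lambda>n. c n * monomial3 r n"
    define S where "S = (\<lambda>(i, j, k). vector [i, j, k] :: nat ^ 3) ` ({..<N} \<times> {..<N} \<times> {..<N})"
    have "norm (r $ i) < 1 / 10" for i using r[of i] s by simp
    then have "r \<in> small_polydisc" by (simp add: small_polydisc_def)
    from hs[OF this] have "(?f has_sum G r) UNIV" .
    then have D: "(?f has_sum (G r - sum ?f S)) (UNIV - S)"
      by (intro has_sum_Diff has_sum_finite) (auto simp: S_def)
    have inj: "inj_on (\<lambda>(i, j, k). vector [i, j, k] :: nat ^ 3) ({..<N} \<times> {..<N} \<times> {..<N})"
      by (auto simp: inj_on_def vec_eq_iff forall_3)
    have "sum ?f S = (\<Sum>(i, j, k)\<in>{..<N} \<times> {..<N} \<times> {..<N}. c (vector [i, j, k]) * (r $ 1) ^ i * (r $ 2) ^ j * (r $ 3) ^ k)"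
      unfolding S_def sum.reindex[OF inj] by (simp add: o_def split_def monomial3_3 mult.assoc)
    also have "\<dots> = (\<Sum>i<N. \<Sum>j<N. \<Sum>k<N. c (vector [i, j, k]) * (r $ 1) ^ i * (r $ 2) ^ j * (r $ 3) ^ k)"
      by (simp add: sum.cartesian_product split_def)
    finally have S: "sum ?f S = \<dots>" .
    have "norm (G r - sum ?f S) \<le> (\<Sum>\<^sub>\<infinity>n\<in>UNIV - S. s ^ N * ?m n)"
    proof (rule norm_infsum_le[OF D])
      show "((\<lambda>n. s ^ N * ?m n) has_sum (\<Sum>\<^sub>\<infinity>n\<in>UNIV - S. s ^ N * ?m n)) (UNIV - S)"
        by (intro has_sum_infsum summable_on_cmult_right summable_on_subset_banach[OF sm]) auto
      fix n assume n: "n \<in> UNIV - S"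
      have "\<exists>i. n $ i \<ge> N"
      proof (rule ccontr)
        assume "\<not> ?thesis"
        then have "(n $ 1, n $ 2, n $ 3) \<in> {..<N} \<times> {..<N} \<times> {..<N}" by (auto simp: not_le)
        moreover have "n = (\<lambda>(i, j, k). vector [i, j, k]) (n $ 1, n $ 2, n $ 3)"
          by (simp add: vec_eq_iff forall_3)
        ultimately have "n \<in> S" unfolding S_def by (rule rev_image_eqI)
        with n show False by simp
      qed
      then obtain i where i: "n $ i \<ge> N" by blast
      have "i = 1 \<or> i = 2 \<or> i = 3" by (rule exhaust_3)
      with i have "N \<le> n $ 1 + n $ 2 + n $ 3" by auto
      then have "s ^ (n $ 1 + n $ 2 + n $ 3) \<le> s ^ N" using s by (intro power_decreasing)
      then have le: "norm (c n) * (s ^ (n $ 1 + n $ 2 + n $ 3) * (\<Prod>i\<in>UNIV. (1 / 20) ^ (n $ i)))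
          \<le> norm (c n) * (s ^ N * (\<Prod>i\<in>UNIV. (1 / 20) ^ (n $ i)))"
        by (intro mult_left_mono mult_right_mono prod_nonneg) auto
      have p: "(\<Prod>i\<in>UNIV. (s / 20) ^ (n $ i)) = s ^ (n $ 1 + n $ 2 + n $ 3) * (\<Prod>i\<in>UNIV. (1 / 20) ^ (n $ i))"
      proof -
        have "(s / 20) ^ k = s ^ k * (1 / 20) ^ k" for k
          by (simp only: power_mult_distrib[symmetric] times_divide_eq_right mult_1_right)
        moreover have "(\<Prod>i\<in>UNIV. s ^ (n $ i)) = s ^ (n $ 1 + n $ 2 + n $ 3)"
          by (simp only: power_sum[symmetric] sum_3)
        ultimately show ?thesis by (simp only: prod.distrib)
      qed
      have "norm (?f n) \<le> norm (c n) * (\<Prod>i\<in>UNIV. (s / 20) ^ (n $ i))"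
        unfolding norm_mult by (intro mult_left_mono norm_monomial3_le r) auto
      also note le[folded p]
      also have "norm (c n) * (s ^ N * (\<Prod>i\<in>UNIV. (1 / 20) ^ (n $ i))) = s ^ N * ?m n"
        by (rule mult.left_commute)
      finally show "norm (?f n) \<le> s ^ N * ?m n" .
    qed
    also have "\<dots> = s ^ N * (\<Sum>\<^sub>\<infinity>n\<in>UNIV - S. ?m n)"
      by (rule infsum_cmult_right')
    also have "\<dots> \<le> s ^ N * M"
    proof (rule mult_left_mono)
      show "(\<Sum>\<^sub>\<infinity>n\<in>UNIV - S. ?m n) \<le> M"
        unfolding M_def
        by (rule infsum_mono_neutral[OF summable_on_subset_banach[OF sm] sm]) (simp_all only: nn order_refl Diff_subset subset_UNIV Diff_UNIV empty_iff)
    qed (use s in simp)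
    finally show "norm (G r - (\<Sum>i<N. \<Sum>j<N. \<Sum>k<N. c (vector [i, j, k]) * (r $ 1) ^ i * (r $ 2) ^ j * (r $ 3) ^ k)) \<le> M * s ^ N"
      unfolding S mult.commute[of "s ^ N" M] .
  qed
qed

section \<open>Expansion of translated powers at the origin\<close>

definition eqO :: "nat \<Rightarrow> (real \<Rightarrow> 'a :: real_normed_field) \<Rightarrow> (real \<Rightarrow> 'a) \<Rightarrow> bool" where
  "eqO N f g \<longleftrightarrow> (\<lambda>t. f t - g t) \<in> O[at_right 0](\<lambda>t. of_real t ^ N)"

lemma eventually_unit_at_right: "eventually (\<lambda>t. t \<in> {0<..<1}) (at_right (0::real))"
  by (rule eventually_at_right_real) simp

lemma eqO_boundI:
  fixes f g :: "real \<Rightarrow> 'a :: real_normed_field"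
  assumes "\<delta> > 0" "\<And>t. 0 < t \<Longrightarrow> t < \<delta> \<Longrightarrow> norm (f t - g t) \<le> M * t ^ N"
  shows "eqO N f g"
  unfolding eqO_def
proof (rule bigoI[where c = M])
  have "eventually (\<lambda>t. t \<in> {0<..<\<delta>}) (at_right (0::real))"
    using assms(1) by (rule eventually_at_right_real)
  then show "eventually (\<lambda>t. norm (f t - g t) \<le> M * norm (of_real t ^ N :: 'a)) (at_right 0)"
    by eventually_elim (use assms(2) in \<open>simp add: norm_power\<close>)
qed

lemma eqO_refl [simp]: "eqO N f f"
  by (simp add: eqO_def)

lemma eqO_trans [trans]: "eqO N f g \<Longrightarrow> eqO N g h \<Longrightarrow> eqO N f h"
  unfolding eqO_def using sum_in_bigo(1)[of "\<lambda>t. f t - g t" "at_right 0" "\<lambda>t. of_real t ^ N" "\<lambda>t. g t - h t"]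
  by simp

lemma eqO_sym: "eqO N f g \<Longrightarrow> eqO N g f"
  unfolding eqO_def using landau_o.big.uminus_in_iff[of "\<lambda>t. f t - g t"] by simp

lemma eqO_sum:
  assumes "\<And>i. i \<in> S \<Longrightarrow> eqO N (f i) (g i)"
  shows "eqO N (\<lambda>t. \<Sum>i\<in>S. f i t) (\<lambda>t. \<Sum>i\<in>S. g i t)"
  using assms unfolding eqO_def sum_subtractf[symmetric] by (intro big_sum_in_bigo)

lemma eqO_cmult: "eqO N f g \<Longrightarrow> eqO N (\<lambda>t. c * f t) (\<lambda>t. c * g t)"
  unfolding eqO_def right_diff_distrib[symmetric] by simp

lemma eqO_mult:
  fixes f g :: "real \<Rightarrow> 'a :: real_normed_field"
  assumes "eqO N f1 g1" "eqO N f2 g2"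
    and f2: "\<And>t. t \<in> {0<..<1} \<Longrightarrow> norm (f2 t) \<le> B" and g1: "\<And>t. t \<in> {0<..<1} \<Longrightarrow> norm (g1 t) \<le> C"
  shows "eqO N (\<lambda>t. f1 t * f2 t) (\<lambda>t. g1 t * g2 t)"
proof -
  have "f2 \<in> O[at_right 0](\<lambda>_. 1)"
    by (rule bigoI[where c = B], use eventually_unit_at_right in eventually_elim) (use f2 in auto)
  then have "(\<lambda>t. (f1 t - g1 t) * f2 t) \<in> O[at_right 0](\<lambda>t. of_real t ^ N * 1)"
    using assms(1) unfolding eqO_def by (intro landau_o.big.mult)
  moreover have "g1 \<in> O[at_right 0](\<lambda>_. 1)"
    by (rule bigoI[where c = C], use eventually_unit_at_right in eventually_elim) (use g1 in auto)
  then have "(\<lambda>t. g1 t * (f2 t - g2 t)) \<in> O[at_right 0](\<lambda>t. 1 * of_real t ^ N)"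
    using assms(2) unfolding eqO_def by (intro landau_o.big.mult)
  ultimately have "(\<lambda>t. (f1 t - g1 t) * f2 t + g1 t * (f2 t - g2 t)) \<in> O[at_right 0](\<lambda>t. of_real t ^ N)"
    by (intro sum_in_bigo) simp_all
  then show ?thesis unfolding eqO_def by (simp add: algebra_simps)
qed

text \<open>For t < 1/2 one has 2 a t^2 <= t, so the tail is at most t^N times the absolute tail of
  the series at 1/2; that series converges absolutely because the power series converges at
  3/4.\<close>

lemma eqO_power_series:
  fixes c :: "nat \<Rightarrow> real"
  assumes c: "\<And>r. 0 \<le> r \<Longrightarrow> r < 1 \<Longrightarrow> summable (\<lambda>k. c k * r ^ k)" and a: "0 \<le> a" "a \<le> 1"
  shows "eqO N (\<lambda>t. \<Sum>k. c k * (a * t\<^sup>2) ^ k) (\<lambda>t. \<Sum>k<N. c k * (a * t\<^sup>2) ^ k)"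
proof (rule eqO_boundI)
  have sm: "summable (\<lambda>k. \<bar>c k\<bar> * (1 / 2) ^ k)"
    using powser_insidea[OF c[of "3 / 4"], of "1 / 2"] by (simp add: abs_mult)
  fix t :: real assume t: "0 < t" "t < 1 / 2"
  define w where "w = a * t\<^sup>2"
  have w: "0 \<le> w" "2 * w \<le> t"
  proof -
    have "a * t\<^sup>2 \<le> 1 * (t * (1 / 2))"
      unfolding power2_eq_square using a t by (intro mult_mono) auto
    then show "0 \<le> w" "2 * w \<le> t" using a by (simp_all add: w_def)
  qed
  have "norm ((\<Sum>k. c k * w ^ k) - (\<Sum>k<N. c k * w ^ k)) = norm (\<Sum>k. c (k + N) * w ^ (k + N))"
    using suminf_split_initial_segment[OF c[of w], of N] w t by simp
  also have "\<dots> \<le> (\<Sum>k. t ^ N * (\<bar>c (k + N)\<bar> * (1 / 2) ^ (k + N)))"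
  proof (rule norm_suminf_le)
    show "summable (\<lambda>k. t ^ N * (\<bar>c (k + N)\<bar> * (1 / 2) ^ (k + N)))"
      by (intro summable_mult summable_ignore_initial_segment[OF sm])
    fix k
    have "w ^ (k + N) = (2 * w) ^ (k + N) * (1 / 2) ^ (k + N)"
      by (subst power_mult_distrib[symmetric]) simp
    also have "(2 * w) ^ (k + N) \<le> t ^ (k + N)" using w by (intro power_mono) auto
    also have "t ^ (k + N) \<le> t ^ N" using t by (intro power_decreasing) auto
    finally have "w ^ (k + N) \<le> t ^ N * (1 / 2) ^ (k + N)" by (simp add: mult_right_mono)
    then have "\<bar>c (k + N)\<bar> * w ^ (k + N) \<le> \<bar>c (k + N)\<bar> * (t ^ N * (1 / 2) ^ (k + N))"
      by (intro mult_left_mono) auto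
    then show "norm (c (k + N) * w ^ (k + N)) \<le> t ^ N * (\<bar>c (k + N)\<bar> * (1 / 2) ^ (k + N))"
      using w by (simp add: abs_mult mult.left_commute)
  qed
  also have "\<dots> = (\<Sum>k. \<bar>c (k + N)\<bar> * (1 / 2) ^ (k + N)) * t ^ N"
    using suminf_mult[OF summable_ignore_initial_segment[OF sm], of "t ^ N" N] by (simp add: mult.commute)
  finally show "norm ((\<Sum>k. c k * (a * t\<^sup>2) ^ k) - (\<Sum>k<N. c k * (a * t\<^sup>2) ^ k)) \<le> (\<Sum>k. \<bar>c (k + N)\<bar> * (1 / 2) ^ (k + N)) * t ^ N"
    by (simp add: w_def)
qed simp

section \<open>Expansion of the translates of (1 - X)^l and of X^m\<close>

lemma one_minus_power_eq: "(1 - u) ^ l = (\<Sum>p\<le>l. pow_coeff l (int p) * u ^ p)" for u :: real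
proof -
  have "(- u + 1) ^ l = (\<Sum>p\<le>l. real (l choose p) * (- u) ^ p * 1 ^ (l - p))"
    by (rule binomial_ring)
  also have "\<dots> = (\<Sum>p\<le>l. pow_coeff l (int p) * u ^ p)"
    by (rule sum.cong) (simp_all add: pow_coeff_def power_minus[of u])
  finally show ?thesis by simp
qed

lemma eqO_shifted_power:
  assumes x: "0 \<le> x" "x \<le> (1::real)"
  shows "eqO N (\<lambda>t. (t * x) ^ k * (1 - t * x) ^ l) (\<lambda>t. \<Sum>i<N. pow_coeff l (int i - int k) * (t * x) ^ i)"
proof (rule eqO_boundI)
  fix t :: real assume t: "0 < t" "t < 1"
  \<comment> \<open>This exceeds N and every exponent p + k with p at most l, so the whole
    polynomial is a sum below it and only the part from N on is discarded.\<close>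
  let ?K = "N + k + l + 1" and ?w = "\<lambda>i. pow_coeff l (int i - int k)"
  define u where "u = t * x"
  have u: "0 \<le> u" "u \<le> t" using x t by (simp_all add: u_def mult_left_le)
  have "u ^ k * (1 - u) ^ l = (\<Sum>p\<le>l. pow_coeff l (int p) * u ^ (p + k))"
    unfolding one_minus_power_eq sum_distrib_left by (simp add: power_add mult_ac)
  also have "\<dots> = (\<Sum>i\<in>{k..k + l}. ?w i * u ^ i)"
    by (rule sum.reindex_bij_witness[of _ "\<lambda>i. i - k" "\<lambda>p. p + k"]) auto
  also have "\<dots> = (\<Sum>i<?K. ?w i * u ^ i)"
    by (rule sum.mono_neutral_left) (auto simp: pow_coeff_def nat_diff_distrib binomial_eq_0)
  also have "{..<?K} = {..<N} \<union> {N..<?K}" by auto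
  also have "(\<Sum>i\<in>{..<N} \<union> {N..<?K}. ?w i * u ^ i) = (\<Sum>i<N. ?w i * u ^ i) + (\<Sum>i\<in>{N..<?K}. ?w i * u ^ i)"
    by (rule sum.union_disjoint) auto
  finally have "\<bar>u ^ k * (1 - u) ^ l - (\<Sum>i<N. ?w i * u ^ i)\<bar> = \<bar>\<Sum>i\<in>{N..<?K}. ?w i * u ^ i\<bar>" by simp
  also have "\<dots> \<le> (\<Sum>i\<in>{N..<?K}. \<bar>?w i\<bar> * t ^ N)"
  proof (rule order_trans[OF sum_abs sum_mono])
    fix i assume i: "i \<in> {N..<?K}"
    have "u ^ i \<le> t ^ i" using u by (intro power_mono) auto
    also have "\<dots> \<le> t ^ N" using t i by (intro power_decreasing) auto
    finally show "\<bar>?w i * u ^ i\<bar> \<le> \<bar>?w i\<bar> * t ^ N"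
      using u by (simp add: abs_mult mult_left_mono)
  qed
  finally show "norm ((t * x) ^ k * (1 - t * x) ^ l - (\<Sum>i<N. ?w i * (t * x) ^ i)) \<le> (\<Sum>i\<in>{N..<?K}. \<bar>?w i\<bar>) * t ^ N"
    unfolding u_def[symmetric] real_norm_def sum_distrib_right .
qed simp

lemma transl_integrand_integrable:
  assumes \<beta>: "\<beta> > 1 / 2" and uv: "u \<in> {0..<1}" "v \<in> {0..<1}" and h: "continuous_on {0..1} h"
  shows "(\<lambda>\<theta>. sin \<theta> powr (4 * \<beta> - 2) * gkern (sqrt (u * v)) \<theta> powr (- \<beta>) * h (txpt u v \<theta>)) integrable_on {0..pi}"
proof -
  have uv1: "u * v < 1" using uv mult_strict_mono'[of u 1 v 1] by simp
  have g: "gkern (sqrt (u * v)) \<theta> > 0" for \<theta> using uv uv1 by (intro gkern_sqrt_pos) auto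
  have "continuous_on {0..pi} (\<lambda>\<theta>. h (txpt u v \<theta>))"
  proof (rule continuous_on_compose2[OF h])
    show "continuous_on {0..pi} (txpt u v)"
      unfolding txpt_def using g by (intro continuous_intros) (auto simp: less_imp_neq[THEN not_sym])
    show "txpt u v ` {0..pi} \<subseteq> {0..1}" using uv uv1 txpt_mem[of u v] by auto
  qed
  then show ?thesis
    using \<beta> g by (intro integrable_continuous_real continuous_on_mult continuous_on_sin_powr continuous_on_powr
        continuous_intros) (auto simp: less_imp_neq[THEN not_sym])
qed

lemma transl_sum:
  assumes \<beta>: "\<beta> > 1 / 2" and uv: "u \<in> {0..<1}" "v \<in> {0..<1}" and h: "\<And>l. l \<in> S \<Longrightarrow> continuous_on {0..1} (h l)"
    and "finite S"
  shows "transl \<beta> (\<lambda>x. \<Sum>l\<in>S. c l * h l x) u v = (\<Sum>l\<in>S. c l * transl \<beta> (h l) u v)"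
proof -
  let ?w = "\<lambda>\<theta>. sin \<theta> powr (4 * \<beta> - 2) * gkern (sqrt (u * v)) \<theta> powr (- \<beta>)"
  have "((\<lambda>\<theta>. \<Sum>l\<in>S. c l * (?w \<theta> * h l (txpt u v \<theta>))) has_integral
      (\<Sum>l\<in>S. c l * integral {0..pi} (\<lambda>\<theta>. ?w \<theta> * h l (txpt u v \<theta>)))) {0..pi}"
    using transl_integrand_integrable[OF \<beta> uv h] assms(5)
    by (intro has_integral_sum has_integral_mult_right integrable_integral) auto
  then have "integral {0..pi} (\<lambda>\<theta>. ?w \<theta> * (\<Sum>l\<in>S. c l * h l (txpt u v \<theta>)))
      = (\<Sum>l\<in>S. c l * integral {0..pi} (\<lambda>\<theta>. ?w \<theta> * h l (txpt u v \<theta>)))"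
    by (subst (asm) has_integral_cong[where g = "\<lambda>\<theta>. ?w \<theta> * (\<Sum>l\<in>S. c l * h l (txpt u v \<theta>))"])
      (auto simp: sum_distrib_left mult.left_commute intro: integral_unique)
  then show ?thesis
    by (simp add: transl_def sum_divide_distrib)
qed

text \<open>The factor W^(-l) of (1 - X)^l merges with W^(-\<beta>), so
  \<open>gegenbauer_integral_sums\<close> applies with a = \<beta> + l and \<mu> = 4\<beta> -
  2.\<close>

lemma transl_zonal:
  assumes \<beta>: "\<beta> > 1 / 2" and uv: "u \<in> {0..<1}" "v \<in> {0..<1}"
  shows "(\<lambda>k. hyp2F1 (\<beta> + l) (real l + 1 - \<beta>) (2 * \<beta>) k * (u * v) ^ k) sums
      (transl \<beta> (\<lambda>x. (1 - x) ^ l) u v / ((1 - u) * (1 - v)) ^ l)"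
proof -
  let ?\<mu> = "4 * \<beta> - 2" and ?r = "sqrt (u * v)"
  have uv1: "u * v < 1" using uv mult_strict_mono'[of u 1 v 1] by simp
  have r: "\<bar>?r\<bar> < 1" using uv uv1 by (simp add: real_sqrt_lt_1_iff)
  have "(\<lambda>k. gnorm ?\<mu> * hyp2F1 (\<beta> + l) (\<beta> + l - ?\<mu> / 2) (?\<mu> / 2 + 1) k * ?r ^ (2 * k)) sums
     integral {0..pi} (\<lambda>x. sin x powr ?\<mu> * gkern ?r x powr (- (\<beta> + l)))"
    using \<beta> r by (intro gegenbauer_integral_sums) auto
  moreover have "\<beta> + l - ?\<mu> / 2 = real l + 1 - \<beta>" "?\<mu> / 2 + 1 = 2 * \<beta>" by (simp_all add: field_simps)
  moreover have "?r ^ (2 * k) = (u * v) ^ k" for k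
    using uv by (simp add: power_mult)
  ultimately have "(\<lambda>k. gnorm ?\<mu> * (hyp2F1 (\<beta> + l) (real l + 1 - \<beta>) (2 * \<beta>) k * (u * v) ^ k)) sums
     integral {0..pi} (\<lambda>x. sin x powr ?\<mu> * gkern ?r x powr (- (\<beta> + l)))" by (simp add: mult.assoc)
  from sums_divide[OF this, of "gnorm ?\<mu>"]
  have s: "(\<lambda>k. hyp2F1 (\<beta> + l) (real l + 1 - \<beta>) (2 * \<beta>) k * (u * v) ^ k) sums
     (integral {0..pi} (\<lambda>x. sin x powr ?\<mu> * gkern ?r x powr (- (\<beta> + l))) / gnorm ?\<mu>)"
    using gnorm_pos[of ?\<mu>] \<beta> by simp
  have e: "sin x powr ?\<mu> * gkern ?r x powr (- \<beta>) * (1 - txpt u v x) ^ l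
      = ((1 - u) * (1 - v)) ^ l * (sin x powr ?\<mu> * gkern ?r x powr (- (\<beta> + l)))" for x
  proof -
    have g: "gkern ?r x > 0" using uv uv1 by (intro gkern_sqrt_pos) auto
    have "gkern ?r x powr (- (\<beta> + l)) = gkern ?r x powr (- \<beta>) / gkern ?r x ^ l"
      using g by (simp add: powr_diff powr_realpow flip: diff_conv_add_uminus)
    moreover have "1 - txpt u v x = (1 - u) * (1 - v) / gkern ?r x"
      using uv uv1 by (intro one_minus_txpt) auto
    ultimately show ?thesis by (simp add: power_divide)
  qed
  have "transl \<beta> (\<lambda>x. (1 - x) ^ l) u v
      = ((1 - u) * (1 - v)) ^ l * (integral {0..pi} (\<lambda>x. sin x powr ?\<mu> * gkern ?r x powr (- (\<beta> + l))) / gnorm ?\<mu>)"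
    unfolding transl_def e by simp
  moreover have "((1 - u) * (1 - v)) ^ l \<noteq> 0" using uv by simp
  ultimately show ?thesis using s by simp
qed

text \<open>Once the 2F1 series in x y t^2 is truncated, each term times ((1 - t x)(1 - t y))^l
  factors into a function of x and one of y. These are expanded separately, and
  \<open>zonal_array\<close> collects the products.\<close>

lemma eqO_zonal:
  assumes \<beta>: "\<beta> > 1 / 2" and x: "x \<in> {0..<1}" and y: "y \<in> {0..<1}"
  shows "eqO N (\<lambda>t. transl \<beta> (\<lambda>X. (1 - X) ^ l) (t * x) (t * y))
     (\<lambda>t. \<Sum>i<N. \<Sum>j<N. zonal_array \<beta> l (int i) (int j) * (t * x) ^ i * (t * y) ^ j)"
proof -
  define c where "c = hyp2F1 (\<beta> + l) (real l + 1 - \<beta>) (2 * \<beta>)"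
  let ?w = "\<lambda>k i. pow_coeff l (int i - int k)"
  let ?P = "\<lambda>x k t. \<Sum>i<N. ?w k i * (t * x) ^ i"
  let ?S = "\<lambda>t. \<Sum>k<N. c k * (x * y * t\<^sup>2) ^ k"
  let ?R = "\<lambda>(x :: real) k t. (t * x) ^ k * (1 - t * x) ^ l"
  have unit: "t * u \<in> {0..<1}" if "t \<in> {0<..<1}" "u \<in> {0..<1}" for t u :: real
    using that mult_strict_mono'[of t 1 u 1] by simp
  have bR: "norm (?R u k t) \<le> 1" if "t \<in> {0<..<1}" "u \<in> {0..<1}" for t u k
  proof -
    have "norm (v ^ k * (1 - v) ^ l) \<le> 1" if "v \<in> {0..<1}" for v :: real
      using that by (auto simp: abs_mult power_abs intro!: mult_le_one power_le_one)
    from this[OF unit[OF that]] show ?thesis .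
  qed
  have bP: "norm (?P u k t) \<le> (\<Sum>i<N. \<bar>?w k i\<bar>)" if "t \<in> {0<..<1}" "u \<in> {0..<1}" for t u k
  proof -
    have "norm (\<Sum>i<N. ?w k i * v ^ i) \<le> (\<Sum>i<N. \<bar>?w k i\<bar>)" if "v \<in> {0..<1}" for v
      using that by (intro sum_norm_le) (auto simp: abs_mult power_abs intro!: mult_left_le power_le_one)
    from this[OF unit[OF that]] show ?thesis .
  qed
  have bW: "norm (((1 - t * x) * (1 - t * y)) ^ l) \<le> 1" if "t \<in> {0<..<1}" for t
  proof -
    have "norm (((1 - u) * (1 - v)) ^ l) \<le> 1" if "u \<in> {0..<1}" "v \<in> {0..<1}" for u v :: real
      using that by (auto simp: abs_mult power_abs intro!: mult_le_one power_le_one)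
    from this[OF unit[OF that x] unit[OF that y]] show ?thesis .
  qed
  have e1: "eqO N (\<lambda>t. \<Sum>k. c k * (x * y * t\<^sup>2) ^ k) ?S"
  proof (rule eqO_power_series)
    fix r :: real assume "0 \<le> r" "r < 1"
    \<comment> \<open>Convergence at r is read off from \<open>transl_zonal\<close> with both
      arguments equal to sqrt r.\<close>
    then show "summable (\<lambda>k. c k * r ^ k)"
      using transl_zonal[OF \<beta>, of "sqrt r" "sqrt r" l] by (simp add: c_def sums_iff real_sqrt_lt_1_iff)
  qed (use x y in \<open>auto intro: mult_le_one\<close>)
  have a1: "eqO N (\<lambda>t. (\<Sum>k. c k * (x * y * t\<^sup>2) ^ k) * ((1 - t * x) * (1 - t * y)) ^ l) (\<lambda>t. ?S t * ((1 - t * x) * (1 - t * y)) ^ l)"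
  proof (rule eqO_mult[OF e1 eqO_refl bW])
    fix t :: real assume t: "t \<in> {0<..<1}"
    have "x * y * t\<^sup>2 = (t * x) * (t * y)" by (simp add: power2_eq_square)
    also have "\<dots> \<in> {0..1}" using unit[OF t x] unit[OF t y] by (auto intro: mult_le_one)
    finally show "norm (?S t) \<le> (\<Sum>k<N. \<bar>c k\<bar>)"
      by (intro sum_norm_le) (auto simp: abs_mult power_abs intro!: mult_left_le power_le_one)
  qed
  have a2: "(\<lambda>t. ?S t * ((1 - t * x) * (1 - t * y)) ^ l) = (\<lambda>t. \<Sum>k<N. c k * (?R x k t * ?R y k t))"
    unfolding sum_distrib_right
    by (intro ext sum.cong refl) (simp add: power_mult_distrib power2_eq_square mult_ac)
  have a3: "eqO N (\<lambda>t. \<Sum>k<N. c k * (?R x k t * ?R y k t)) (\<lambda>t. \<Sum>k<N. c k * (?P x k t * ?P y k t))"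
    by (intro eqO_sum eqO_cmult eqO_mult[OF eqO_shifted_power eqO_shifted_power bR bP]) (use x y in auto)
  have a4: "(\<lambda>t. \<Sum>k<N. c k * (?P x k t * ?P y k t)) =
      (\<lambda>t. \<Sum>i<N. \<Sum>j<N. zonal_array \<beta> l (int i) (int j) * (t * x) ^ i * (t * y) ^ j)"
  proof
    fix t
    have z: "zonal_array \<beta> l (int i) (int j) = (\<Sum>k<N. c k * (?w k i * ?w k j))" if "i < N" for i j
    proof -
      obtain M where M: "N = Suc M" using \<open>i < N\<close> by (cases N) auto
      show ?thesis unfolding M lessThan_Suc_atMost c_def by (rule zonal_array_eq) (use that M in simp)
    qed
    have "(\<Sum>k<N. c k * (?P x k t * ?P y k t)) = (\<Sum>k<N. \<Sum>i<N. \<Sum>j<N. c k * (?w k i * ?w k j) * (t * x) ^ i * (t * y) ^ j)"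
    proof -
      have pp: "?P x k t * ?P y k t = (\<Sum>i<N. \<Sum>j<N. (?w k i * (t * x) ^ i) * (?w k j * (t * y) ^ j))" for k
        by (rule sum_product)
      show ?thesis unfolding pp unfolding sum_distrib_left by (intro sum.cong refl) (simp only: mult_ac)
    qed
    also have "\<dots> = (\<Sum>i<N. \<Sum>k<N. \<Sum>j<N. c k * (?w k i * ?w k j) * (t * x) ^ i * (t * y) ^ j)"
      by (rule sum.swap)
    also have "\<dots> = (\<Sum>i<N. \<Sum>j<N. \<Sum>k<N. c k * (?w k i * ?w k j) * (t * x) ^ i * (t * y) ^ j)"
      by (rule sum.cong[OF refl sum.swap])
    also have "\<dots> = (\<Sum>i<N. \<Sum>j<N. zonal_array \<beta> l (int i) (int j) * (t * x) ^ i * (t * y) ^ j)"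
      by (intro sum.cong refl) (simp add: z sum_distrib_right)
    finally show "(\<Sum>k<N. c k * (?P x k t * ?P y k t)) = \<dots>" .
  qed
  have main: "eqO N (\<lambda>t. (\<Sum>k. c k * (x * y * t\<^sup>2) ^ k) * ((1 - t * x) * (1 - t * y)) ^ l)
      (\<lambda>t. \<Sum>i<N. \<Sum>j<N. zonal_array \<beta> l (int i) (int j) * (t * x) ^ i * (t * y) ^ j)"
    using eqO_trans[OF a1[unfolded a2] a3] unfolding a4 .
  have "eqO N (\<lambda>t. transl \<beta> (\<lambda>X. (1 - X) ^ l) (t * x) (t * y))
      (\<lambda>t. (\<Sum>k. c k * (x * y * t\<^sup>2) ^ k) * ((1 - t * x) * (1 - t * y)) ^ l)"
  proof (rule eqO_boundI)
    fix t :: real assume "0 < t" "t < 1"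
    then have t: "t \<in> {0<..<1}" by simp
    have "((1 - t * x) * (1 - t * y)) ^ l \<noteq> 0" using unit[OF t x] unit[OF t y] by simp
    moreover have "(\<Sum>k. c k * (t * x * (t * y)) ^ k) = transl \<beta> (\<lambda>X. (1 - X) ^ l) (t * x) (t * y) / ((1 - t * x) * (1 - t * y)) ^ l"
      unfolding c_def by (rule sums_unique[symmetric, OF transl_zonal[OF \<beta> unit[OF t x] unit[OF t y]]])
    ultimately have "transl \<beta> (\<lambda>X. (1 - X) ^ l) (t * x) (t * y) = (\<Sum>k. c k * (t * x * (t * y)) ^ k) * ((1 - t * x) * (1 - t * y)) ^ l"
      by (metis nonzero_divide_eq_eq)
    moreover have "t * x * (t * y) = x * y * t\<^sup>2" by (simp add: power2_eq_square)
    ultimately show "norm (transl \<beta> (\<lambda>X. (1 - X) ^ l) (t * x) (t * y) -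
        (\<Sum>k. c k * (x * y * t\<^sup>2) ^ k) * ((1 - t * x) * (1 - t * y)) ^ l) \<le> 0 * t ^ N" by simp
  qed simp
  from eqO_trans[OF this main] show ?thesis .
qed

text \<open>By linearity, from the expansion of X^m = (1 - (1 - X))^m in powers of 1 - X, which is
  the combination behind \<open>power_array\<close>.\<close>

lemma eqO_transl_power:
  assumes \<beta>: "\<beta> > 1 / 2" and x: "x \<in> {0..<1}" and y: "y \<in> {0..<1}"
  shows "eqO N (\<lambda>t. transl \<beta> (\<lambda>X. X ^ m) (t * x) (t * y))
     (\<lambda>t. \<Sum>i<N. \<Sum>j<N. power_array \<beta> m (int i) (int j) * (t * x) ^ i * (t * y) ^ j)"
proof -
  let ?c = "\<lambda>l. (-1) ^ l * real (m choose l)"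
  let ?Z = "\<lambda>l t. \<Sum>i<N. \<Sum>j<N. zonal_array \<beta> l (int i) (int j) * (t * x) ^ i * (t * y) ^ j"
  have X: "X ^ m = (\<Sum>l\<le>m. ?c l * (1 - X) ^ l)" for X :: real
  proof -
    have "(- (1 - X) + 1) ^ m = (\<Sum>l\<le>m. real (m choose l) * (- (1 - X)) ^ l * 1 ^ (m - l))"
      by (rule binomial_ring)
    also have "\<dots> = (\<Sum>l\<le>m. ?c l * (1 - X) ^ l)"
      unfolding power_minus[of "1 - X"] by (simp add: mult_ac)
    finally show ?thesis by simp
  qed
  have "eqO N (\<lambda>t. transl \<beta> (\<lambda>X. X ^ m) (t * x) (t * y)) (\<lambda>t. \<Sum>l\<le>m. ?c l * transl \<beta> (\<lambda>X. (1 - X) ^ l) (t * x) (t * y))"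
  proof (rule eqO_boundI)
    fix t :: real assume t: "0 < t" "t < 1"
    have u: "t * u \<in> {0..<1}" if "u \<in> {0..<1}" for u
      using that t mult_strict_mono'[of t 1 u 1] by simp
    have "transl \<beta> (\<lambda>X. X ^ m) (t * x) (t * y) = (\<Sum>l\<le>m. ?c l * transl \<beta> (\<lambda>X. (1 - X) ^ l) (t * x) (t * y))"
      unfolding X by (rule transl_sum[OF \<beta> u[OF x] u[OF y]]) (auto intro!: continuous_intros)
    then show "norm (transl \<beta> (\<lambda>X. X ^ m) (t * x) (t * y) - (\<Sum>l\<le>m. ?c l * transl \<beta> (\<lambda>X. (1 - X) ^ l) (t * x) (t * y))) \<le> 0 * t ^ N"
      by simp
  qed simp
  also have "eqO N \<dots> (\<lambda>t. \<Sum>l\<le>m. ?c l * ?Z l t)"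
    by (intro eqO_sum eqO_cmult eqO_zonal assms)
  also have "(\<lambda>t. \<Sum>l\<le>m. ?c l * ?Z l t) = (\<lambda>t. \<Sum>i<N. \<Sum>j<N. power_array \<beta> m (int i) (int j) * (t * x) ^ i * (t * y) ^ j)"
  proof
    fix t
    have "(\<Sum>l\<le>m. ?c l * ?Z l t) = (\<Sum>l\<le>m. \<Sum>i<N. \<Sum>j<N. ?c l * zonal_array \<beta> l (int i) (int j) * (t * x) ^ i * (t * y) ^ j)"
      unfolding sum_distrib_left by (intro sum.cong refl) (simp add: mult_ac)
    also have "\<dots> = (\<Sum>i<N. \<Sum>l\<le>m. \<Sum>j<N. ?c l * zonal_array \<beta> l (int i) (int j) * (t * x) ^ i * (t * y) ^ j)"
      by (rule sum.swap)
    also have "\<dots> = (\<Sum>i<N. \<Sum>j<N. \<Sum>l\<le>m. ?c l * zonal_array \<beta> l (int i) (int j) * (t * x) ^ i * (t * y) ^ j)"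
      by (rule sum.cong[OF refl sum.swap])
    also have "\<dots> = (\<Sum>i<N. \<Sum>j<N. power_array \<beta> m (int i) (int j) * (t * x) ^ i * (t * y) ^ j)"
      unfolding power_array_def sum_distrib_right ..
    finally show "(\<Sum>l\<le>m. ?c l * ?Z l t) = \<dots>" .
  qed
  finally show ?thesis .
qed

section \<open>The translation formula\<close>

lemma continuous_on_vector_3:
  fixes a b c :: "'b :: topological_space \<Rightarrow> 'a :: {topological_space, zero}"
  assumes "continuous_on S a" "continuous_on S b" "continuous_on S c"
  shows "continuous_on S (\<lambda>p. vector [a p, b p, c p] :: 'a ^ 3)"
  unfolding vector_3_eq
proof (rule continuous_on_vec_lambda)
  show "continuous_on S (\<lambda>p. if i = 1 then a p else if i = 2 then b p else c p)" for i :: 3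
    using assms by (cases "i = 1"; cases "i = 2") simp_all
qed

lemma holomorphic_on_vector_3:
  assumes "a holomorphic_on V" "b holomorphic_on V" "c holomorphic_on V"
  shows "(\<lambda>t. (vector [a t, b t, c t] :: complex ^ 3) $ i) holomorphic_on V"
  unfolding vector_3_eq vec_lambda_beta using assms by (cases "i = 1"; cases "i = 2") simp_all

text \<open>A tube around the compact set [0, 1] x [a, b]. V is the Minkowski sum of the segment and
  a disc, hence convex, so that the intersection of two such neighbourhoods is connected, as the
  identity theorem requires.\<close>

lemma segment_neighbourhood:
  fixes W :: "(complex \<times> real) set"
  assumes W: "open W" and seg: "\<And>s x. s \<in> {0..1} \<Longrightarrow> x \<in> {a..b} \<Longrightarrow> (of_real s, x) \<in> W"
  obtains V where "open V" "convex V" "\<And>s. s \<in> {0..1} \<Longrightarrow> of_real s \<in> V" "V \<times> {a..b} \<subseteq> W"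
proof -
  let ?I = "complex_of_real ` {0..1}"
  have "compact (?I \<times> {a..b})"
    by (intro compact_Times compact_continuous_image continuous_intros) auto
  moreover have "?I \<times> {a..b} \<subseteq> W" using seg by auto
  ultimately obtain e where e: "e > 0" "(\<Union>p\<in>?I \<times> {a..b}. ball p e) \<subseteq> W"
    using compact_subset_open_imp_ball_epsilon_subset[OF _ W] by metis
  define V where "V = (\<Union>s\<in>?I. \<Union>w\<in>ball 0 e. {s + w})"
  have "(\<Union>w\<in>ball 0 e. {s + w}) = ball s e" for s :: complex
  proof (intro equalityI subsetI)
    fix t assume "t \<in> ball s e"
    then have "t - s \<in> ball 0 e" by (simp add: dist_norm norm_minus_commute)
    then show "t \<in> (\<Union>w\<in>ball 0 e. {s + w})" by (rule UN_I) simp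
  qed (auto simp: dist_norm)
  then have V: "V = (\<Union>s\<in>?I. ball s e)" unfolding V_def by simp
  show ?thesis
  proof
    show "open V" unfolding V by auto
    have "convex ?I" by (intro convex_linear_image linear_of_real) auto
    then show "convex V" unfolding V_def by (intro convex_sums) auto
    show "of_real s \<in> V" if "s \<in> {0..1}" for s unfolding V
      by (rule UN_I[of "of_real s"]) (use that e(1) in auto)
    show "V \<times> {a..b} \<subseteq> W"
    proof clarify
      fix t x assume "t \<in> V" and x: "x \<in> {a..b}"
      then obtain s where s: "s \<in> ?I" "t \<in> ball s e" unfolding V by auto
      then have "(t, x) \<in> ball (s, x) e" by (simp add: dist_Pair_Pair)
      then show "(t, x) \<in> W" using e(2) s(1) x by blast
    qed
  qed
qed

lemma eqO_of_real: 
  assumes "eqO N f g"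
  shows "eqO N (\<lambda>t. complex_of_real (f t)) (\<lambda>t. of_real (g t))"
proof -
  obtain C where "eventually (\<lambda>t. norm (f t - g t) \<le> C * norm (of_real t ^ N :: real)) (at_right 0)"
    using assms unfolding eqO_def by (elim landau_o.bigE)
  then show ?thesis
    unfolding eqO_def by (intro bigoI[where c = C]) (simp add: norm_power power_abs flip: of_real_diff)
qed

lemma eqO_mult_left:
  fixes f g h :: "real \<Rightarrow> 'a :: real_normed_field"
  assumes "eqO N f g" "\<And>t. t \<in> {0<..<1} \<Longrightarrow> norm (h t) \<le> C"
  shows "eqO N (\<lambda>t. h t * f t) (\<lambda>t. h t * g t)"
proof -
  have "h \<in> O[at_right 0](\<lambda>_. 1)"
    by (rule bigoI[where c = C], use eventually_unit_at_right in eventually_elim) (use assms(2) in auto)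
  then have "(\<lambda>t. h t * (f t - g t)) \<in> O[at_right 0](\<lambda>t. 1 * of_real t ^ N)"
    using assms(1) unfolding eqO_def by (intro landau_o.big.mult)
  then show ?thesis unfolding eqO_def by (simp add: right_diff_distrib)
qed

lemma gkern_ge_small:
  assumes "0 \<le> r" "r \<le> (1 / 2 :: real)"
  shows "1 / 4 \<le> gkern r \<theta>"
proof -
  have "r * cos \<theta> \<le> r" using assms by (simp add: mult_left_le)
  then have "(1 - r)\<^sup>2 \<le> gkern r \<theta>" by (simp add: gkern_def power2_eq_square algebra_simps)
  moreover have "(1 / 2)\<^sup>2 \<le> (1 - r)\<^sup>2" using assms by (intro power_mono) auto
  ultimately show ?thesis by (simp add: power2_eq_square)
qed

lemma sqrt_scale: "t \<ge> 0 \<Longrightarrow> sqrt (t * x * (t * y)) = t * sqrt (x * y)"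
proof -
  assume "t \<ge> 0"
  have "t * x * (t * y) = t\<^sup>2 * (x * y)" by (simp add: power2_eq_square)
  then show ?thesis using \<open>t \<ge> 0\<close> by (simp add: real_sqrt_mult)
qed

lemma txpt_mem_half_open:
  assumes "x \<in> {0..<1}" "y \<in> {0..<1}"
  shows "txpt x y \<theta> \<in> {0..<1}"
proof -
  have "x * y < 1" using assms mult_strict_mono'[of x 1 y 1] by simp
  then show ?thesis using txpt_mem[of x y \<theta>] txpt_less_1[OF assms] assms by simp
qed

section \<open>Uniqueness along rays and symmetry of the continuation\<close>

locale neighbor_extension =
  fixes \<beta> :: real and A :: "nat ^ 3 \<Rightarrow> real" and G :: "complex ^ 3 \<Rightarrow> complex" and U :: "(complex ^ 3) set"
  assumes \<beta>: "\<beta> \<ge> 2 / 3"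
    and arr: "neighbor_array \<beta> (ext_array A)"
    and G: "analytic3_on G U" and U: "complex_vec ` half_open_cube \<subseteq> U"
    and G_sum: "\<And>r. r \<in> small_polydisc \<Longrightarrow> ((\<lambda>n. complex_of_real (A n) * monomial3 r n) has_sum G r) UNIV"
begin

abbreviation a :: "nat \<Rightarrow> nat \<Rightarrow> nat \<Rightarrow> real" where
  "a i j k \<equiv> ext_array A (int i) (int j) (int k)"

lemma open_U: "open U"
  using G by (simp add: analytic3_on_def)

lemma cube_mem_U:
  assumes "x \<in> {0..<1}" "y \<in> {0..<1}" "z \<in> {0..<1}"
  shows "vector [of_real x, of_real y, of_real z] \<in> U"
proof -
  have "(vector [of_real x, of_real y, of_real z] :: complex ^ 3) = complex_vec (vector [x, y, z])"
    by (simp add: complex_vec_def vec_eq_iff forall_3)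
  moreover have "vector [x, y, z] \<in> half_open_cube"
    using assms by (simp add: half_open_cube_def forall_3)
  ultimately show ?thesis using U by auto
qed

lemma truncation:
  obtains M where "M \<ge> 0" "\<And>N s u v w. 0 \<le> s \<Longrightarrow> s \<le> 1 / 20 \<Longrightarrow> norm u \<le> s \<Longrightarrow> norm v \<le> s \<Longrightarrow> norm w \<le> s \<Longrightarrow>
     norm (G (vector [u, v, w]) - (\<Sum>i<N. \<Sum>j<N. \<Sum>k<N. of_real (a i j k) * u ^ i * v ^ j * w ^ k)) \<le> M * (20 * s) ^ N"
proof (rule polydisc_truncation[OF G_sum])
  fix M assume M: "M \<ge> 0" "\<And>N s r. 0 \<le> s \<Longrightarrow> s \<le> 1 \<Longrightarrow> (\<And>i. norm (r $ i) \<le> s / 20) \<Longrightarrow>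
     norm (G r - (\<Sum>i<N. \<Sum>j<N. \<Sum>k<N. of_real (A (vector [i, j, k])) * (r $ 1) ^ i * (r $ 2) ^ j * (r $ 3) ^ k)) \<le> M * s ^ N"
  show thesis
  proof (rule that[OF M(1)])
    fix N s and u v w :: complex assume s: "0 \<le> s" "s \<le> 1 / 20" "norm u \<le> s" "norm v \<le> s" "norm w \<le> s"
    have "norm ((vector [u, v, w] :: complex ^ 3) $ i) \<le> 20 * s / 20" for i
      unfolding vector_3_eq vec_lambda_beta using s by (cases "i = 1"; cases "i = 2") simp_all
    from M(2)[OF _ _ this, of N] s
    show "norm (G (vector [u, v, w]) - (\<Sum>i<N. \<Sum>j<N. \<Sum>k<N. of_real (a i j k) * u ^ i * v ^ j * w ^ k)) \<le> M * (20 * s) ^ N"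
      by (simp add: ext_array_nat)
  qed
qed auto

definition ray :: "real \<Rightarrow> real \<Rightarrow> real \<Rightarrow> complex \<Rightarrow> complex" where
  "ray x y z t = G (vector [t * of_real x, t * of_real y, t * of_real z])"

definition ray_sum :: "nat \<Rightarrow> real \<Rightarrow> real \<Rightarrow> real \<Rightarrow> real \<Rightarrow> real" where
  "ray_sum N x y z t = (\<Sum>i<N. \<Sum>j<N. \<Sum>k<N. a i j k * (t * x) ^ i * (t * y) ^ j * (t * z) ^ k)"

lemma ray_expansion:
  assumes "x \<in> {0..<1}" "y \<in> {0..<1}" "z \<in> {0..<1}"
  shows "eqO N (\<lambda>t. ray x y z (of_real t)) (\<lambda>t. of_real (ray_sum N x y z t))"
proof -
  obtain M where M: "M \<ge> 0" "\<And>N s u v w. 0 \<le> s \<Longrightarrow> s \<le> 1 / 20 \<Longrightarrow> norm u \<le> s \<Longrightarrow> norm v \<le> s \<Longrightarrow> norm w \<le> s \<Longrightarrow>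
     norm (G (vector [u, v, w]) - (\<Sum>i<N. \<Sum>j<N. \<Sum>k<N. of_real (a i j k) * u ^ i * v ^ j * w ^ k)) \<le> M * (20 * s) ^ N"
    by (rule truncation) (rule that)
  show ?thesis
  proof (rule eqO_boundI)
    fix t :: real assume t: "0 < t" "t < 1 / 20"
    have "norm (complex_of_real t * of_real u) \<le> t" if "u \<in> {0..<1}" for u
      using that t by (simp add: norm_mult mult_left_le)
    from M(2)[OF _ _ this[OF assms(1)] this[OF assms(2)] this[OF assms(3)], of N] t
    show "norm (ray x y z (of_real t) - of_real (ray_sum N x y z t)) \<le> (M * 20 ^ N) * t ^ N"
      by (simp add: ray_def ray_sum_def power_mult_distrib mult.assoc)
  qed simp
qed

lemma ray_neighbourhood:
  assumes "x \<in> {0..<1}" "y \<in> {0..<1}" "z \<in> {0..<1}"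
  obtains V where "open V" "convex V" "\<And>s. s \<in> {0..1} \<Longrightarrow> of_real s \<in> V" "ray x y z holomorphic_on V"
proof -
  let ?w = "\<lambda>t. vector [t * of_real x, t * of_real y, t * of_real z] :: complex ^ 3"
  have unit: "s * u \<in> {0..<1}" if "s \<in> {0..1}" "u \<in> {0..<1}" for s u :: real
  proof -
    have "s * u \<le> 1 * u" using that by (intro mult_right_mono) auto
    then show ?thesis using that by auto
  qed
  have o1: "open ((\<lambda>p :: complex \<times> real. ?w (fst p)) -` U)"
    by (intro open_vimage open_U continuous_on_vector_3 continuous_intros)
  have o2: "(of_real s, x') \<in> (\<lambda>p :: complex \<times> real. ?w (fst p)) -` U" if "s \<in> {0..1}" for s x'
    using cube_mem_U[OF unit[OF that assms(1)] unit[OF that assms(2)] unit[OF that assms(3)]] by simp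
  obtain V where V: "open V" "convex V" "\<And>s. s \<in> {0..1} \<Longrightarrow> of_real s \<in> V"
      "V \<times> {0..0} \<subseteq> (\<lambda>p :: complex \<times> real. ?w (fst p)) -` U"
    by (rule segment_neighbourhood[OF o1, of 0 0]) (rule o2, assumption, rule that)
  have "(\<lambda>t. G (?w t)) holomorphic_on V"
    by (rule analytic3_compose_holomorphic[OF G V(1)])
      (use V(4) in \<open>auto intro!: holomorphic_on_vector_3 holomorphic_intros\<close>)
  then have "ray x y z holomorphic_on V" unfolding ray_def[abs_def] .
  from that[OF V(1,2,3) this] show ?thesis .
qed

text \<open>The difference of the two functions is flat at 0 and holomorphic near [0, 1], so it
  vanishes up to t = 1. This carries information from the Taylor coefficients at the origin to all
  of the half-open cube.\<close>

lemma ray_unique: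
  assumes xyz: "x \<in> {0..<1}" "y \<in> {0..<1}" "z \<in> {0..<1}"
    and W: "open W" "convex W" "\<And>s. s \<in> {0..1} \<Longrightarrow> of_real s \<in> W" and f: "f holomorphic_on W"
    and eq: "\<And>N. eqO N (\<lambda>t. f (of_real t)) (\<lambda>t. c * of_real (ray_sum N x y z t))"
  shows "f 1 = c * G (vector [of_real x, of_real y, of_real z])"
proof -
  obtain V where V: "open V" "convex V" "\<And>s. s \<in> {0..1} \<Longrightarrow> of_real s \<in> V" "ray x y z holomorphic_on V"
    by (rule ray_neighbourhood[OF xyz]) (rule that)
  have "f 1 - c * ray x y z 1 = 0"
  proof (rule holomorphic_flat_eq_0[where f = "\<lambda>t. f t - c * ray x y z t" and V = "V \<inter> W"])
    show "(\<lambda>t. f t - c * ray x y z t) holomorphic_on V \<inter> W"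
      using V(4) f by (intro holomorphic_intros) (auto elim: holomorphic_on_subset)
    show "connected (V \<inter> W)" using V(2) W(2) by (intro convex_connected convex_Int)
    show "(\<lambda>t. f (of_real t) - c * ray x y z (of_real t)) \<in> O[at_right 0](\<lambda>t. of_real t ^ N)" for N
      using eqO_trans[OF eq[of N] eqO_sym[OF eqO_cmult[OF ray_expansion[OF xyz, of N], of c]]]
      by (simp add: eqO_def)
  qed (use V W V(3)[of 0] V(3)[of 1] W(3)[of 0] W(3)[of 1] in auto)
  then show ?thesis by (simp add: ray_def)
qed

text \<open>Symmetric coefficients give equal ray sums, and \<open>ray_unique\<close> transfers the
  symmetry to G although U need not be a symmetric domain.\<close>

lemma G_swap:
  assumes xyz: "x \<in> {0..<1}" "y \<in> {0..<1}" "z \<in> {0..<1}"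
  shows "G (vector [of_real z, of_real y, of_real x]) = G (vector [of_real x, of_real y, of_real z])"
    and "G (vector [of_real x, of_real z, of_real y]) = G (vector [of_real x, of_real y, of_real z])"
proof -
  have b: "\<beta> > 0" using \<beta> by simp
  have s1: "ray_sum N z y x t = ray_sum N x y z t" for N t
  proof -
    have "ray_sum N z y x t = (\<Sum>i<N. \<Sum>k<N. \<Sum>j<N. a i j k * (t * z) ^ i * (t * y) ^ j * (t * x) ^ k)"
      unfolding ray_sum_def by (rule sum.cong[OF refl sum.swap])
    also have "\<dots> = (\<Sum>k<N. \<Sum>i<N. \<Sum>j<N. a i j k * (t * z) ^ i * (t * y) ^ j * (t * x) ^ k)"
      by (rule sum.swap)
    also have "\<dots> = (\<Sum>k<N. \<Sum>j<N. \<Sum>i<N. a i j k * (t * z) ^ i * (t * y) ^ j * (t * x) ^ k)"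
      by (rule sum.cong[OF refl sum.swap])
    also have "\<dots> = ray_sum N x y z t"
      unfolding ray_sum_def
    proof (intro sum.cong refl)
      fix i j k :: nat
      show "a k j i * (t * z) ^ k * (t * y) ^ j * (t * x) ^ i = a i j k * (t * x) ^ i * (t * y) ^ j * (t * z) ^ k"
        using neighbor_array_sym(1)[OF arr b, of "int i" "int j" "int k"] by (simp add: mult_ac)
    qed
    finally show ?thesis .
  qed
  have s2: "ray_sum N x z y t = ray_sum N x y z t" for N t
  proof -
    have "ray_sum N x z y t = (\<Sum>i<N. \<Sum>k<N. \<Sum>j<N. a i j k * (t * x) ^ i * (t * z) ^ j * (t * y) ^ k)"
      unfolding ray_sum_def by (rule sum.cong[OF refl sum.swap])
    also have "\<dots> = ray_sum N x y z t"
      unfolding ray_sum_def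
    proof (intro sum.cong refl)
      fix i j k :: nat
      show "a i k j * (t * x) ^ i * (t * z) ^ k * (t * y) ^ j = a i j k * (t * x) ^ i * (t * y) ^ j * (t * z) ^ k"
        using neighbor_array_sym(2)[OF arr b, of "int i" "int j" "int k"] by (simp add: mult_ac)
    qed
    finally show ?thesis .
  qed
  obtain V where V: "open V" "convex V" "\<And>s. s \<in> {0..1} \<Longrightarrow> of_real s \<in> V" "ray z y x holomorphic_on V"
    by (rule ray_neighbourhood[OF xyz(3,2,1)]) (rule that)
  have "ray z y x 1 = 1 * G (vector [of_real x, of_real y, of_real z])"
  proof (rule ray_unique[OF xyz V])
    show "eqO N (\<lambda>t. ray z y x (of_real t)) (\<lambda>t. 1 * of_real (ray_sum N x y z t))" for N
      unfolding mult_1_left s1[symmetric] by (rule ray_expansion[OF xyz(3,2,1)])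
  qed
  then show "G (vector [of_real z, of_real y, of_real x]) = G (vector [of_real x, of_real y, of_real z])"
    by (simp add: ray_def)
  obtain V where V: "open V" "convex V" "\<And>s. s \<in> {0..1} \<Longrightarrow> of_real s \<in> V" "ray x z y holomorphic_on V"
    by (rule ray_neighbourhood[OF xyz(1,3,2)]) (rule that)
  have "ray x z y 1 = 1 * G (vector [of_real x, of_real y, of_real z])"
  proof (rule ray_unique[OF xyz V])
    show "eqO N (\<lambda>t. ray x z y (of_real t)) (\<lambda>t. 1 * of_real (ray_sum N x y z t))" for N
      unfolding mult_1_left s2[symmetric] by (rule ray_expansion[OF xyz(1,3,2)])
  qed
  then show "G (vector [of_real x, of_real z, of_real y]) = G (vector [of_real x, of_real y, of_real z])"
    by (simp add: ray_def)
qed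

section \<open>The translated integral along a ray\<close>

definition txray :: "real \<Rightarrow> real \<Rightarrow> complex \<Rightarrow> real \<Rightarrow> complex" where
  "txray x y t \<theta> = t * of_real (x + y - 2 * sqrt (x * y) * cos \<theta>) / gkern (t * of_real (sqrt (x * y))) \<theta>"

lemma txray_of_real:
  assumes "0 \<le> t"
  shows "txray x y (of_real t) \<theta> = of_real (txpt (t * x) (t * y) \<theta>)"
  using assms unfolding txray_def txpt_def sqrt_scale[OF assms] of_real_mult[symmetric] gkern_of_real of_real_divide[symmetric]
  by (simp add: algebra_simps)

text \<open>For t in [0, 1], up to the factor \<open>gnorm\<close>, this is the translation of G(X,
  0, t z) to the point t (x, y). It makes sense for complex t because sqrt (t x t y) is written as t
  sqrt (x y).\<close>

definition txint :: "real \<Rightarrow> real \<Rightarrow> real \<Rightarrow> complex \<Rightarrow> complex" where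
  "txint x y z t = integral {0..pi} (\<lambda>\<theta>. of_real (sin \<theta> powr (4 * \<beta> - 2)) *
     gkern (t * of_real (sqrt (x * y))) \<theta> powr of_real (- \<beta>) * G (vector [txray x y t \<theta>, 0, t * of_real z]))"

lemma unit_scale:
  assumes "s \<in> {0..1}" "u \<in> {0..<1}"
  shows "s * u \<in> {0..<(1::real)}"
proof -
  have "s * u \<le> 1 * u" using assms by (intro mult_right_mono) auto
  then show ?thesis using assms by auto
qed

text \<open>For s in [0, 1] the translated point stays in [0, 1), so the argument of G lies in the
  half-open cube for every \<theta>; compactness in s and \<theta> then gives the
  neighbourhood.\<close>

lemma txint_neighbourhood:
  assumes xyz: "x \<in> {0..<1}" "y \<in> {0..<1}" "z \<in> {0..<1}"
  obtains V where "open V" "convex V" "\<And>s. s \<in> {0..1} \<Longrightarrow> of_real s \<in> V" "txint x y z holomorphic_on V"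
proof -
  let ?\<rho> = "complex_of_real (sqrt (x * y))" and ?\<mu> = "4 * \<beta> - 2"
  let ?w = "\<lambda>t \<theta>. vector [txray x y t \<theta>, 0, t * of_real z] :: complex ^ 3"
  \<comment> \<open>On this set W is off the branch cut of the power and does not vanish in the
    denominator of \<open>txray\<close>.\<close>
  define D where "D = {p :: complex \<times> real. norm (fst p * ?\<rho>) < 1}"
  have D: "open D" unfolding D_def by (intro open_Collect_less continuous_intros)
  have nz: "gkern (t * ?\<rho>) \<theta> \<noteq> 0" if "norm (t * ?\<rho>) < 1" for t \<theta>
    using gkern_notin_nonpos_Reals[OF that, of \<theta>] by auto
  have cw: "continuous_on D (\<lambda>p. ?w (fst p) (snd p))"
    unfolding txray_def by (intro continuous_on_vector_3 continuous_intros) (use nz in \<open>auto simp: D_def\<close>)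
  have oW: "open (D \<inter> (\<lambda>p. ?w (fst p) (snd p)) -` U)"
    by (rule continuous_open_preimage[OF cw D open_U])
  have mem: "(of_real s, \<theta>) \<in> D \<inter> (\<lambda>p. ?w (fst p) (snd p)) -` U" if s: "s \<in> {0..1}" for s \<theta>
  proof -
    have xy: "x * y < 1" using xyz mult_strict_mono'[of x 1 y 1] by simp
    have sx: "s * x \<in> {0..<1}" "s * y \<in> {0..<1}" using unit_scale[OF s] xyz by auto
    have "s * sqrt (x * y) \<in> {0..<1}" using xyz xy by (intro unit_scale[OF s]) (auto simp: real_sqrt_lt_1_iff)
    then have "(of_real s, \<theta>) \<in> D" by (simp add: D_def flip: of_real_mult)
    moreover have "s * x * (s * y) < 1" using sx mult_strict_mono'[of "s * x" 1 "s * y" 1] by simp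
    then have "txpt (s * x) (s * y) \<theta> \<in> {0..<1}"
      using txpt_mem[of "s * x" "s * y" \<theta>] txpt_less_1[OF sx] sx by simp
    from cube_mem_U[OF this _ unit_scale[OF s xyz(3)], of 0]
    have "?w (of_real s) \<theta> \<in> U"
      using s by (simp add: txray_of_real)
    ultimately show ?thesis by simp
  qed
  obtain V where V: "open V" "convex V" "\<And>s. s \<in> {0..1} \<Longrightarrow> of_real s \<in> V"
      "V \<times> {0..pi} \<subseteq> D \<inter> (\<lambda>p. ?w (fst p) (snd p)) -` U"
    by (rule segment_neighbourhood[OF oW, of 0 pi]) (rule mem, assumption, rule that)
  have VD: "norm (t * ?\<rho>) < 1" if "t \<in> V" for t
  proof -
    have "(t, 0) \<in> V \<times> {0..pi}" using that by simp
    with V(4) have "(t, 0) \<in> D" by blast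
    then show ?thesis by (simp add: D_def)
  qed
  have VU: "?w t \<theta> \<in> U" if "t \<in> V" "\<theta> \<in> {0..pi}" for t \<theta>
  proof -
    have "(t, \<theta>) \<in> V \<times> {0..pi}" using that by simp
    with V(4) have "(t, \<theta>) \<in> (\<lambda>p. ?w (fst p) (snd p)) -` U" by blast
    then show ?thesis by simp
  qed
  have "txint x y z holomorphic_on V"
    unfolding txint_def[abs_def]
  proof (rule parametric_integral_holomorphic[OF V(1)])
    have c1: "continuous_on (V \<times> {0..pi}) (\<lambda>p. complex_of_real (sin (snd p) powr ?\<mu>))"
      by (rule continuous_on_compose2[of "{0..pi}" "\<lambda>\<theta>. complex_of_real (sin \<theta> powr ?\<mu>)"])
        (use \<beta> in \<open>auto intro!: continuous_on_of_real continuous_on_sin_powr continuous_on_snd continuous_on_id\<close>)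
    have c2: "continuous_on (V \<times> {0..pi}) (\<lambda>p. gkern (fst p * ?\<rho>) (snd p) powr of_real (- \<beta>))"
      by (intro continuous_on_gkern_powr continuous_intros) (auto intro: VD)
    have c3: "continuous_on (V \<times> {0..pi}) (\<lambda>p. G (?w (fst p) (snd p)))"
      by (rule continuous_on_compose2[OF analytic3_continuous_on[OF G] continuous_on_subset[OF cw]]) (use V(4) in auto)
    show "continuous_on (V \<times> {0..pi}) (\<lambda>(t, \<theta>). of_real (sin \<theta> powr ?\<mu>) * gkern (t * ?\<rho>) \<theta> powr of_real (- \<beta>) * G (?w t \<theta>))"
      unfolding split_def by (intro continuous_on_mult c1 c2 c3)
    fix \<theta> assume \<theta>: "\<theta> \<in> {0..pi}"
    have h: "(\<lambda>t. gkern (t * ?\<rho>) \<theta> powr of_real (- \<beta>)) holomorphic_on V"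
      by (intro holomorphic_on_powr holomorphic_on_gkern holomorphic_intros gkern_notin_nonpos_Reals VD)
    have "(\<lambda>t. txray x y t \<theta>) holomorphic_on V"
      unfolding txray_def by (intro holomorphic_intros nz VD)
    then have "(\<lambda>t. G (?w t \<theta>)) holomorphic_on V"
      by (intro analytic3_compose_holomorphic[OF G V(1)] holomorphic_on_vector_3 holomorphic_intros) (use VU \<theta> in auto)
    then show "(\<lambda>t. of_real (sin \<theta> powr ?\<mu>) * gkern (t * ?\<rho>) \<theta> powr of_real (- \<beta>) * G (?w t \<theta>)) holomorphic_on V"
      by (intro holomorphic_on_mult holomorphic_on_const h)
  qed
  from that[OF V(1,2,3) this] show ?thesis .
qed

definition txsum :: "nat \<Rightarrow> real \<Rightarrow> real \<Rightarrow> real \<Rightarrow> real \<Rightarrow> real" where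
  "txsum N x y z t = (\<Sum>k<N. \<Sum>m<N. (a m 0 k * (t * z) ^ k) * transl \<beta> (\<lambda>X. X ^ m) (t * x) (t * y))"

text \<open>Subtracting the translates of the axis values leaves an array that solves the wave recurrence
  with vanishing initial row, so only terms of order at least \<open>N\<close> remain.\<close>

lemma txsum_expansion:
  assumes xyz: "x \<in> {0..<1}" "y \<in> {0..<1}" "z \<in> {0..<1}"
  shows "eqO N (txsum N x y z) (ray_sum N x y z)"
proof -
  have b: "\<beta> > 1 / 2" using \<beta> by simp
  let ?p = "\<lambda>m t. \<Sum>i<N. \<Sum>j<N. power_array \<beta> m (int i) (int j) * (t * x) ^ i * (t * y) ^ j"
  have "eqO N (txsum N x y z) (\<lambda>t. \<Sum>k<N. \<Sum>m<N. (a m 0 k * (t * z) ^ k) * ?p m t)"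
    unfolding txsum_def[abs_def]
  proof (intro eqO_sum eqO_mult_left eqO_transl_power[OF b xyz(1,2)])
    fix k m t assume t: "t \<in> {0<..<(1::real)}"
    have "norm (a m 0 k * v ^ k) \<le> \<bar>a m 0 k\<bar>" if "v \<in> {0..<1}" for v
      using that by (simp add: abs_mult power_abs mult_left_le power_le_one)
    from this[OF unit_scale] show "norm (a m 0 k * (t * z) ^ k) \<le> \<bar>a m 0 k\<bar>"
      using t xyz(3) by simp
  qed
  also have "eqO N \<dots> (ray_sum N x y z)"
  proof -
    let ?d = "\<lambda>i j k. (\<Sum>m<N. a m 0 k * power_array \<beta> m (int i) (int j)) - a i j k"
    have d0: "?d i j k = 0" if "i + j < N" for i j k
    proof -
      have w: "wave_array \<beta> (\<lambda>i j. (\<Sum>m<N. a m 0 k * power_array \<beta> m i j) - ext_array A i j (int k))"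
        using arr b by (intro wave_array_diff wave_array_sum wave_array_power) (auto simp: neighbor_array_def)
      have z: "(\<Sum>m<N. a m 0 k * power_array \<beta> m i 0) - ext_array A i 0 (int k) = 0" if i: "i < int N" for i
      proof (cases "i < 0")
        case True
        then show ?thesis by (simp add: power_array_0 ext_array_neg)
      next
        case False
        then obtain n where n: "i = int n" by (metis nonneg_int_cases linorder_not_less)
        have "(\<Sum>m<N. a m 0 k * power_array \<beta> m i 0) = (\<Sum>m<N. if m = n then a n 0 k else 0)"
          unfolding n power_array_0 by (rule sum.cong) auto
        also have "\<dots> = a n 0 k" using i n by simp
        finally show ?thesis by (simp add: n)
      qed
      show ?thesis
        by (rule wave_array_eq_0[OF w, where M = "int N"]) (use \<beta> z that in auto)
    qed
    have "(\<Sum>k<N. \<Sum>m<N. (a m 0 k * (t * z) ^ k) * ?p m t) - ray_sum N x y z t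
        = (\<Sum>k<N. \<Sum>i<N. \<Sum>j<N. ?d i j k * ((t * x) ^ i * (t * y) ^ j * (t * z) ^ k))" for t
    proof -
      have "(\<Sum>m<N. (a m 0 k * (t * z) ^ k) * ?p m t) = (\<Sum>i<N. \<Sum>j<N. (\<Sum>m<N. a m 0 k * power_array \<beta> m (int i) (int j)) * ((t * x) ^ i * (t * y) ^ j * (t * z) ^ k))" for k
      proof -
        have "(\<Sum>m<N. (a m 0 k * (t * z) ^ k) * ?p m t)
            = (\<Sum>m<N. \<Sum>i<N. \<Sum>j<N. a m 0 k * power_array \<beta> m (int i) (int j) * ((t * x) ^ i * (t * y) ^ j * (t * z) ^ k))"
          unfolding sum_distrib_left by (intro sum.cong refl) (simp only: mult_ac)
        also have "\<dots> = (\<Sum>i<N. \<Sum>m<N. \<Sum>j<N. a m 0 k * power_array \<beta> m (int i) (int j) * ((t * x) ^ i * (t * y) ^ j * (t * z) ^ k))"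
          by (rule sum.swap)
        also have "\<dots> = (\<Sum>i<N. \<Sum>j<N. \<Sum>m<N. a m 0 k * power_array \<beta> m (int i) (int j) * ((t * x) ^ i * (t * y) ^ j * (t * z) ^ k))"
          by (rule sum.cong[OF refl sum.swap])
        finally show ?thesis unfolding sum_distrib_right .
      qed
      moreover have "ray_sum N x y z t = (\<Sum>k<N. \<Sum>i<N. \<Sum>j<N. a i j k * ((t * x) ^ i * (t * y) ^ j * (t * z) ^ k))"
      proof -
        have "ray_sum N x y z t = (\<Sum>i<N. \<Sum>k<N. \<Sum>j<N. a i j k * (t * x) ^ i * (t * y) ^ j * (t * z) ^ k)"
          unfolding ray_sum_def by (rule sum.cong[OF refl sum.swap])
        also have "\<dots> = (\<Sum>k<N. \<Sum>i<N. \<Sum>j<N. a i j k * (t * x) ^ i * (t * y) ^ j * (t * z) ^ k)"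
          by (rule sum.swap)
        finally show ?thesis by (simp only: mult.assoc)
      qed
      ultimately show ?thesis by (simp only: sum_subtractf left_diff_distrib)
    qed
    moreover have "eqO N (\<lambda>t. \<Sum>k<N. \<Sum>i<N. \<Sum>j<N. ?d i j k * ((t * x) ^ i * (t * y) ^ j * (t * z) ^ k)) (\<lambda>t. \<Sum>k<N. \<Sum>i<N. \<Sum>j<N. 0)"
    proof (intro eqO_sum)
      fix i j k
      show "eqO N (\<lambda>t. ?d i j k * ((t * x) ^ i * (t * y) ^ j * (t * z) ^ k)) (\<lambda>t. 0)"
      proof (cases "i + j < N")
        case True
        then show ?thesis unfolding d0[OF True] by simp
      next
        case False
        show ?thesis
        proof (rule eqO_boundI)
          fix t :: real assume t: "0 < t" "t < 1"
          have 1: "0 \<le> (t * u) ^ n" "(t * u) ^ n \<le> t ^ n" if "u \<in> {0..<1}" for u n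
            using that t by (auto intro!: power_mono mult_left_le)
          have "(t * x) ^ i * (t * y) ^ j * (t * z) ^ k \<le> t ^ i * t ^ j * t ^ k"
            using 1 xyz t by (intro mult_mono) auto
          also have "\<dots> = t ^ (i + j + k)" by (simp add: power_add)
          also have "\<dots> \<le> t ^ N" using t False by (intro power_decreasing) auto
          finally have "(t * x) ^ i * (t * y) ^ j * (t * z) ^ k \<le> t ^ N" .
          moreover have "0 \<le> (t * x) ^ i * (t * y) ^ j * (t * z) ^ k"
            using 1 xyz by (intro mult_nonneg_nonneg) auto
          ultimately show "norm (?d i j k * ((t * x) ^ i * (t * y) ^ j * (t * z) ^ k) - 0) \<le> \<bar>?d i j k\<bar> * t ^ N"
            by (simp add: abs_mult mult_left_mono del: power_mult_distrib)
        qed simp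
      qed
    qed
    ultimately show ?thesis by (simp add: eqO_def)
  qed
  finally show ?thesis .
qed

text \<open>Since X = O(t) uniformly in \<theta>, truncating G costs O(t^N) uniformly in \<theta>,
  and the error survives integration against a bounded weight.\<close>

lemma txint_expansion:
  assumes xyz: "x \<in> {0..<1}" "y \<in> {0..<1}" "z \<in> {0..<1}"
  shows "eqO N (\<lambda>t. txint x y z (of_real t)) (\<lambda>t. of_real (gnorm (4 * \<beta> - 2) * txsum N x y z t))"
proof -
  let ?\<mu> = "4 * \<beta> - 2"
  have b: "\<beta> > 1 / 2" using \<beta> by simp
  obtain M where M: "M \<ge> 0" "\<And>N s u v w. 0 \<le> s \<Longrightarrow> s \<le> 1 / 20 \<Longrightarrow> norm u \<le> s \<Longrightarrow> norm v \<le> s \<Longrightarrow> norm w \<le> s \<Longrightarrow>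
     norm (G (vector [u, v, w]) - (\<Sum>i<N. \<Sum>j<N. \<Sum>k<N. of_real (a i j k) * u ^ i * v ^ j * w ^ k)) \<le> M * (20 * s) ^ N"
    by (rule truncation) (rule that)
  show ?thesis
  proof (rule eqO_boundI)
    \<comment> \<open>The numerator of X is at most 4 t and W >= 1/4, so X <= 16 t. The truncation
      estimate for G needs 16 t <= 1/20, hence t < 1/320.\<close>
    fix t :: real assume t: "0 < t" "t < 1 / 320"
    let ?r = "sqrt (t * x * (t * y))"
    let ?w = "\<lambda>\<theta>. sin \<theta> powr ?\<mu> * gkern ?r \<theta> powr (- \<beta>)"
    let ?X = "txpt (t * x) (t * y)"
    let ?p = "\<lambda>X. \<Sum>k<N. \<Sum>m<N. (a m 0 k * (t * z) ^ k) * X ^ m"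
    have tx: "t * x \<in> {0..<1}" "t * y \<in> {0..<1}" "t * z \<in> {0..<1}"
      using unit_scale[of t x] unit_scale[of t y] unit_scale[of t z] t xyz by auto
    have tle: "t * u \<le> t" if "u \<in> {0..<1}" for u using that t by (simp add: mult_left_le)
    have rt: "?r \<le> t"
    proof -
      have "x * y \<le> 1" using xyz by (auto intro: mult_le_one)
      then have "t * sqrt (x * y) \<le> t * 1" using t by (intro mult_left_mono) auto
      then show ?thesis unfolding sqrt_scale[OF less_imp_le[OF t(1)]] mult_1_right .
    qed
    have r: "0 \<le> ?r" "?r \<le> 1 / 2" using tx rt t by simp_all
    have g: "1 / 4 \<le> gkern ?r \<theta>" for \<theta> by (rule gkern_ge_small[OF r])
    have X: "0 \<le> ?X \<theta>" "?X \<theta> \<le> 16 * t" for \<theta>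
    proof -
      show "0 \<le> ?X \<theta>" using txpt_mem_half_open[OF tx(1,2), of \<theta>] by simp
      have "2 * ?r * (- cos \<theta>) \<le> 2 * ?r * 1"
        using r(1) cos_ge_minus_one[of \<theta>] by (intro mult_left_mono) auto
      then have "t * x + t * y - 2 * ?r * cos \<theta> \<le> 16 * t * (1 / 4)"
        using tle[OF xyz(1)] tle[OF xyz(2)] rt by linarith
      also have "16 * t * (1 / 4) \<le> 16 * t * gkern ?r \<theta>"
        using g[of \<theta>] t by (intro mult_left_mono) auto
      finally show "?X \<theta> \<le> 16 * t" unfolding txpt_def using g[of \<theta>] by (simp add: divide_le_eq)
    qed
    have wle: "norm (?w \<theta>) \<le> (1 / 4) powr (- \<beta>)" if "\<theta> \<in> {0..pi}" for \<theta>
    proof -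
      have "gkern ?r \<theta> powr (- \<beta>) \<le> (1 / 4) powr (- \<beta>)" using g[of \<theta>] b by (intro powr_mono2') auto
      moreover have "sin \<theta> powr ?\<mu> \<le> 1" using that b sin_ge_zero[of \<theta>] by (intro powr_le1) auto
      ultimately have "?w \<theta> \<le> 1 * (1 / 4) powr (- \<beta>)" by (intro mult_mono) auto
      then show ?thesis by simp
    qed
    have integrand: "complex_of_real (sin \<theta> powr ?\<mu>) * gkern (of_real t * of_real (sqrt (x * y))) \<theta> powr of_real (- \<beta>)
        * G (vector [txray x y (of_real t) \<theta>, 0, of_real t * of_real z])
       = of_real (?w \<theta>) * G (vector [of_real (?X \<theta>), 0, of_real (t * z)])" for \<theta>
    proof -
      have "gkern (of_real t * of_real (sqrt (x * y))) \<theta> powr of_real (- \<beta>) = complex_of_real (gkern ?r \<theta> powr (- \<beta>))"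
        using powr_of_real[OF gkern_nonneg[of ?r \<theta>], of "- \<beta>"] t
        by (simp only: of_real_mult[symmetric] gkern_of_real sqrt_scale less_imp_le)
      then show ?thesis using t by (simp add: txray_of_real)
    qed
    have diff: "norm (G (vector [of_real (?X \<theta>), 0, of_real (t * z)]) - of_real (?p (?X \<theta>))) \<le> M * (20 * (16 * t)) ^ N" for \<theta>
    proof -
      have "(\<Sum>i<N. \<Sum>j<N. \<Sum>k<N. complex_of_real (a i j k) * of_real (?X \<theta>) ^ i * 0 ^ j * of_real (t * z) ^ k) = of_real (?p (?X \<theta>))"
      proof -
        \<comment> \<open>Because 0^0 = 1, exactly the summand j = 0 survives.\<close>
        have "(\<Sum>j<N. \<Sum>k<N. complex_of_real (a i j k) * of_real (?X \<theta>) ^ i * 0 ^ j * of_real (t * z) ^ k)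
            = (\<Sum>k<N. complex_of_real (a i 0 k) * of_real (?X \<theta>) ^ i * of_real (t * z) ^ k)" for i
        proof (cases N)
          case (Suc n)
          then show ?thesis unfolding Suc sum.lessThan_Suc_shift by simp
        qed simp
        then have "(\<Sum>i<N. \<Sum>j<N. \<Sum>k<N. complex_of_real (a i j k) * of_real (?X \<theta>) ^ i * 0 ^ j * of_real (t * z) ^ k)
            = (\<Sum>i<N. \<Sum>k<N. complex_of_real (a i 0 k) * of_real (?X \<theta>) ^ i * of_real (t * z) ^ k)" by simp
        also have "\<dots> = (\<Sum>k<N. \<Sum>i<N. complex_of_real (a i 0 k) * of_real (?X \<theta>) ^ i * of_real (t * z) ^ k)"
          by (rule sum.swap)
        finally show ?thesis by (simp add: mult_ac)
      qed
      moreover have "norm (complex_of_real (?X \<theta>)) \<le> 16 * t" using X[of \<theta>] by simp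
      moreover have "norm (complex_of_real (t * z)) \<le> 16 * t" using tx(3) tle[OF xyz(3)] t by (simp only: norm_of_real abs_of_nonneg) auto
      ultimately show ?thesis
        using M(2)[of "16 * t" "of_real (?X \<theta>)" 0 "of_real (t * z)" N] t by simp
    qed
    have fin: "integral {0..pi} (\<lambda>\<theta>. complex_of_real (?w \<theta> * ?p (?X \<theta>))) = of_real (gnorm ?\<mu> * txsum N x y z t)"
      and fin_int: "(\<lambda>\<theta>. complex_of_real (?w \<theta> * ?p (?X \<theta>))) integrable_on {0..pi}"
    proof -
      have i: "(\<lambda>\<theta>. ?w \<theta> * ?p (?X \<theta>)) integrable_on {0..pi}"
        by (rule transl_integrand_integrable[OF b tx(1,2)]) (intro continuous_intros)
      show "(\<lambda>\<theta>. complex_of_real (?w \<theta> * ?p (?X \<theta>))) integrable_on {0..pi}"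
        by (rule has_integral_integrable[OF has_integral_of_real[OF integrable_integral[OF i]]])
      have gn: "gnorm ?\<mu> \<noteq> 0" using gnorm_pos[of ?\<mu>] b by simp
      have "transl \<beta> ?p (t * x) (t * y) = transl \<beta> (\<lambda>X. \<Sum>k<N. 1 * (\<Sum>m<N. (a m 0 k * (t * z) ^ k) * X ^ m)) (t * x) (t * y)"
        by simp
      also have "\<dots> = (\<Sum>k<N. 1 * transl \<beta> (\<lambda>X. \<Sum>m<N. (a m 0 k * (t * z) ^ k) * X ^ m) (t * x) (t * y))"
        by (rule transl_sum[OF b tx(1,2)]) (auto intro!: continuous_intros)
      also have "\<dots> = txsum N x y z t"
        unfolding txsum_def mult_1_left
        by (intro sum.cong refl transl_sum[OF b tx(1,2)]) (auto intro!: continuous_intros)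
      finally have e: "integral {0..pi} (\<lambda>\<theta>. ?w \<theta> * ?p (?X \<theta>)) = gnorm ?\<mu> * txsum N x y z t"
        unfolding transl_def nonzero_divide_eq_eq[OF gn] by (simp only: mult.commute)
      show "integral {0..pi} (\<lambda>\<theta>. complex_of_real (?w \<theta> * ?p (?X \<theta>))) = of_real (gnorm ?\<mu> * txsum N x y z t)"
        unfolding integral_complex_of_real_HK[OF i] e ..
    qed
    let ?F = "\<lambda>\<theta>. of_real (?w \<theta>) * G (vector [of_real (?X \<theta>), 0, of_real (t * z)])"
    have Fint: "?F integrable_on {0..pi}"
    proof (intro integrable_continuous_real continuous_on_mult continuous_on_of_real)
      have gp: "gkern ?r \<theta> \<noteq> 0" for \<theta> using g[of \<theta>] by auto
      show "continuous_on {0..pi} (\<lambda>\<theta>. sin \<theta> powr ?\<mu>)" using b by (intro continuous_on_sin_powr) simp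
      show "continuous_on {0..pi} (\<lambda>\<theta>. gkern ?r \<theta> powr (- \<beta>))"
        using gp by (intro continuous_on_powr continuous_intros) auto
      show "continuous_on {0..pi} (\<lambda>\<theta>. G (vector [of_real (?X \<theta>), 0, of_real (t * z)]))"
      proof (rule continuous_on_compose2[OF analytic3_continuous_on[OF G]])
        show "continuous_on {0..pi} (\<lambda>\<theta>. vector [complex_of_real (?X \<theta>), 0, of_real (t * z)] :: complex ^ 3)"
          unfolding txpt_def using gp by (intro continuous_on_vector_3 continuous_intros) auto
        have Xm: "?X \<theta> \<in> {0..<1}" for \<theta> by (rule txpt_mem_half_open[OF tx(1,2)])
        show "(\<lambda>\<theta>. vector [complex_of_real (?X \<theta>), 0, of_real (t * z)]) ` {0..pi} \<subseteq> U"
        proof (rule image_subsetI)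
          fix \<theta>
          show "vector [complex_of_real (?X \<theta>), 0, of_real (t * z)] \<in> U"
            using cube_mem_U[OF Xm[of \<theta>] _ tx(3), of 0] by simp
        qed
      qed
    qed
    have I: "((\<lambda>\<theta>. ?F \<theta> - of_real (?w \<theta> * ?p (?X \<theta>))) has_integral
        (txint x y z (of_real t) - of_real (gnorm ?\<mu> * txsum N x y z t))) {0..pi}"
      unfolding txint_def integrand fin[symmetric]
      by (intro has_integral_diff integrable_integral Fint fin_int)
    have "norm (txint x y z (of_real t) - of_real (gnorm ?\<mu> * txsum N x y z t))
        \<le> ((1 / 4) powr (- \<beta>) * (M * (20 * (16 * t)) ^ N)) * measure lborel {0..pi}"
    proof (rule has_integral_bound_real[OF _ finite.emptyI I])
      show "0 \<le> (1 / 4) powr (- \<beta>) * (M * (20 * (16 * t)) ^ N)"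
        using M(1) t by simp
      fix \<theta> assume \<theta>: "\<theta> \<in> {0..pi} - {}"
      have "?F \<theta> - of_real (?w \<theta> * ?p (?X \<theta>)) = of_real (?w \<theta>) * (G (vector [of_real (?X \<theta>), 0, of_real (t * z)]) - of_real (?p (?X \<theta>)))"
        by (simp only: of_real_mult right_diff_distrib)
      also have "norm \<dots> \<le> (1 / 4) powr (- \<beta>) * (M * (20 * (16 * t)) ^ N)"
        unfolding norm_mult norm_of_real using wle[of \<theta>] \<theta> diff[of \<theta>] by (intro mult_mono) auto
      finally show "norm (?F \<theta> - of_real (?w \<theta> * ?p (?X \<theta>))) \<le> (1 / 4) powr (- \<beta>) * (M * (20 * (16 * t)) ^ N)" .
    qed
    moreover have "measure lborel {0..pi} = pi" by simp
    moreover have "(20 * (16 * t)) ^ N = 320 ^ N * t ^ N"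
      by (subst power_mult_distrib[symmetric]) simp
    ultimately show "norm (txint x y z (of_real t) - of_real (gnorm ?\<mu> * txsum N x y z t))
        \<le> (pi * ((1 / 4) powr (- \<beta>) * (M * 320 ^ N))) * t ^ N"
      by (simp only: mult_ac)
  qed simp
qed

text \<open>This is \<open>ray_unique\<close> for \<open>txint\<close>, read at t = 1.\<close>

lemma translation_formula:
  assumes xyz: "x \<in> {0..<1}" "y \<in> {0..<1}" "z \<in> {0..<1}"
  shows "of_real (gnorm (4 * \<beta> - 2)) * G (vector [of_real x, of_real y, of_real z]) =
    integral {0..pi} (\<lambda>\<theta>. of_real (sin \<theta> powr (4 * \<beta> - 2) * gkern (sqrt (x * y)) \<theta> powr (- \<beta>))
      * G (vector [of_real (txpt x y \<theta>), 0, of_real z]))"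
proof -
  obtain V where V: "open V" "convex V" "\<And>s. s \<in> {0..1} \<Longrightarrow> of_real s \<in> V" "txint x y z holomorphic_on V"
    by (rule txint_neighbourhood[OF xyz]) (rule that)
  have "txint x y z 1 = of_real (gnorm (4 * \<beta> - 2)) * G (vector [of_real x, of_real y, of_real z])"
  proof (rule ray_unique[OF xyz V])
    fix N
    have "eqO N (\<lambda>t. gnorm (4 * \<beta> - 2) * txsum N x y z t) (\<lambda>t. gnorm (4 * \<beta> - 2) * ray_sum N x y z t)"
      by (rule eqO_cmult[OF txsum_expansion[OF xyz]])
    from eqO_trans[OF txint_expansion[OF xyz] eqO_of_real[OF this]]
    show "eqO N (\<lambda>t. txint x y z (of_real t)) (\<lambda>t. of_real (gnorm (4 * \<beta> - 2)) * of_real (ray_sum N x y z t))"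
      by (simp only: of_real_mult)
  qed
  moreover have "txint x y z 1 = integral {0..pi} (\<lambda>\<theta>. of_real (sin \<theta> powr (4 * \<beta> - 2) * gkern (sqrt (x * y)) \<theta> powr (- \<beta>))
      * G (vector [of_real (txpt x y \<theta>), 0, of_real z]))"
  proof -
    have "gkern (1 * of_real (sqrt (x * y))) \<theta> powr of_real (- \<beta>) = complex_of_real (gkern (sqrt (x * y)) \<theta> powr (- \<beta>))" for \<theta>
      using powr_of_real[OF gkern_nonneg[of "sqrt (x * y)" \<theta>], of "- \<beta>"]
      by (simp only: mult_1_left gkern_of_real)
    moreover have "txray x y 1 \<theta> = of_real (txpt x y \<theta>)" for \<theta>
      using txray_of_real[of 1 x y \<theta>] by simp
    ultimately show ?thesis unfolding txint_def of_real_mult by simp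
  qed
  ultimately show ?thesis by simp
qed

end

section \<open>The extension to the closed cube\<close>

lemma continuous_on_unique_at_1:
  fixes f g :: "real \<Rightarrow> real"
  assumes "continuous_on {0..1} f" "continuous_on {0..1} g" "\<And>x. x \<in> {0..<1} \<Longrightarrow> f x = g x" "x \<in> {0..1}"
  shows "f x = g x"
proof -
  have cl: "closure {0..<1} = {0..1 :: real}" by simp
  have "(\<lambda>x. f x - g x) x = 0"
    by (rule continuous_constant_on_closure[where S = "{0..<1}"])
      (use assms in \<open>auto simp: cl intro!: continuous_intros\<close>)
  then show ?thesis by simp
qed

text \<open>On [0, 1) this is the restriction of F to a coordinate axis, see
  \<open>G_axis\<close>.\<close>

definition gauss_g :: "real \<Rightarrow> real \<Rightarrow> real" where
  "gauss_g \<beta> x = (\<Sum>n. hyp2F1 \<beta> (1 - 2 * \<beta>) (2 * \<beta>) n * x ^ n)"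

text \<open>On the half-open square this is the restriction of F to a coordinate plane, see
  \<open>G_plane\<close>.\<close>

definition plane_fn :: "real \<Rightarrow> real \<Rightarrow> real \<Rightarrow> real" where
  "plane_fn \<beta> = transl \<beta> (gauss_g \<beta>)"

definition cube_fn :: "real \<Rightarrow> real \<Rightarrow> real \<Rightarrow> real \<Rightarrow> real" where
  "cube_fn \<beta> x y z = transl \<beta> (\<lambda>X. plane_fn \<beta> X z) x y"

lemma continuous_gauss_g:
  assumes "\<beta> \<ge> 2 / 3"
  shows "continuous_on {0..1} (gauss_g \<beta>)"
  unfolding gauss_g_def[abs_def] using assms by (intro hyp2F1_series_continuous) auto

lemma continuous_f_beta:
  assumes "\<beta> \<ge> 2 / 3"
  shows "continuous_on {0..1} (f_beta \<beta>)"
  unfolding f_beta_eq[abs_def] using assms by (intro hyp2F1_series_continuous) auto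

lemma continuous_plane_fn:
  assumes "\<beta> \<ge> 2 / 3"
  shows "continuous_on ({0..1} \<times> {0..1}) (\<lambda>(x, z). plane_fn \<beta> x z)"
proof -
  have "continuous_on ({0..1} \<times> {0..1} \<times> {0..1}) (\<lambda>(x, y, z :: real). transl \<beta> (\<lambda>x. gauss_g \<beta> x) x y)"
    by (rule continuous_on_transl[OF assms])
      (auto simp: split_def intro!: continuous_on_compose2[OF continuous_gauss_g[OF assms]] continuous_intros)
  then have "continuous_on ({0..1} \<times> {0..1}) (\<lambda>p. case (fst p, snd p, 0 :: real) of (x, y, z) \<Rightarrow> transl \<beta> (\<lambda>x. gauss_g \<beta> x) x y)"
    by (rule continuous_on_compose2) (auto intro!: continuous_intros)
  then show ?thesis by (simp add: split_def plane_fn_def)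
qed

lemma continuous_cube_fn:
  assumes "\<beta> \<ge> 2 / 3"
  shows "continuous_on ({0..1} \<times> {0..1} \<times> {0..1}) (\<lambda>(x, y, z). cube_fn \<beta> x y z)"
  unfolding cube_fn_def by (rule continuous_on_transl[OF assms continuous_plane_fn[OF assms]])

lemma gauss_g_1:
  assumes "\<beta> \<ge> 2 / 3"
  shows "gauss_g \<beta> 1 = Gamma (2 * \<beta>) * Gamma (3 * \<beta> - 1) / (Gamma \<beta> * Gamma (4 * \<beta> - 1))"
proof -
  \<comment> \<open>The upper parameters are exchanged so that the negative one, 1 - 2\<beta>, takes
    the place of a in Gauss's theorem.\<close>
  have "gauss_g \<beta> 1 = (\<Sum>n. hyp2F1 (1 - 2 * \<beta>) \<beta> (2 * \<beta>) n)"
    by (simp add: gauss_g_def hyp2F1_commute[of \<beta>])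
  also have "\<dots> = Gamma (2 * \<beta>) * Gamma (2 * \<beta> - (1 - 2 * \<beta>) - \<beta>) / (Gamma (2 * \<beta> - (1 - 2 * \<beta>)) * Gamma (2 * \<beta> - \<beta>))"
    using assms by (intro gauss_hypergeometric) auto
  also have "2 * \<beta> - (1 - 2 * \<beta>) - \<beta> = 3 * \<beta> - 1" by simp
  also have "2 * \<beta> - (1 - 2 * \<beta>) = 4 * \<beta> - 1" by simp
  also have "2 * \<beta> - \<beta> = \<beta>" by simp
  finally show ?thesis by (simp add: mult.commute)
qed

text \<open>At y = 1 the kernel degenerates at \<theta> = 0 and the Gegenbauer expansion, valid for
  radius below 1, is out of reach; that value comes from continuity of both sides.\<close>

lemma transl_1:
  assumes \<beta>: "\<beta> \<ge> 2 / 3" and y: "y \<in> {0..1}" and c: "continuous_on {0..1} (\<lambda>y. transl \<beta> h 1 y)"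
  shows "transl \<beta> h 1 y = h 1 * f_beta \<beta> y"
proof (rule continuous_on_unique_at_1[OF c _ _ y])
  show "continuous_on {0..1} (\<lambda>y. h 1 * f_beta \<beta> y)"
    by (intro continuous_intros continuous_f_beta \<beta>)
  show "transl \<beta> h 1 y = h 1 * f_beta \<beta> y" if "y \<in> {0..<1}" for y
    using transl_1_left[OF \<beta> that, of h] by (simp add: f_beta_eq hyp2F1_commute[of \<beta>])
qed

lemma cube_fn_1:
  assumes \<beta>: "\<beta> \<ge> 2 / 3" and y: "y \<in> {0..1}" and z: "z \<in> {0..1}"
  shows "cube_fn \<beta> 1 y z = gauss_g \<beta> 1 * f_beta \<beta> y * f_beta \<beta> z"
proof -
  have "continuous_on {0..1} (\<lambda>y. case (1, y) of (x, z) \<Rightarrow> plane_fn \<beta> x z)"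
    by (rule continuous_on_compose2[OF continuous_plane_fn[OF \<beta>]]) (auto intro!: continuous_intros)
  then have p: "plane_fn \<beta> 1 z = gauss_g \<beta> 1 * f_beta \<beta> z"
    unfolding plane_fn_def by (intro transl_1 \<beta> z) simp
  have "continuous_on {0..1} (\<lambda>y. case (1, y, z) of (x, y, z) \<Rightarrow> cube_fn \<beta> x y z)"
    by (rule continuous_on_compose2[OF continuous_cube_fn[OF \<beta>]]) (use z in \<open>auto intro!: continuous_intros\<close>)
  then have "cube_fn \<beta> 1 y z = plane_fn \<beta> 1 z * f_beta \<beta> y"
    unfolding cube_fn_def by (intro transl_1 \<beta> y) simp
  then show ?thesis by (simp add: p)
qed

section \<open>Identification of the extension and its symmetry\<close>

context neighbor_extension
begin

text \<open>The coefficients on the axis are known, but the given series represents G only in the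
  small polydisc; the ray carries the equality to all of [0, 1).\<close>

lemma G_axis:
  assumes x: "x \<in> {0..<1}"
  shows "G (vector [of_real x, 0, 0]) = of_real (gauss_g \<beta> x)"
proof -
  let ?h = "hyp2F1 \<beta> (1 - 2 * \<beta>) (2 * \<beta>)"
  have b: "\<beta> > 0" using \<beta> by simp
  have sm: "summable (\<lambda>n. \<bar>?h n\<bar>)" using \<beta> by (intro hyp2F1_summable) auto
  define f where "f = (\<lambda>w :: complex. \<Sum>n. of_real (?h n) * w ^ n)"
  have fs: "(\<lambda>n. of_real (?h n) * w ^ n) sums f w" if "norm w < 1" for w :: complex
    unfolding f_def
    by (intro summable_sums summable_comparison_test'[OF sm, of 0])
      (use that in \<open>auto simp: norm_mult norm_power intro!: mult_left_le power_le_one\<close>)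
  have fr: "f (of_real u) = of_real (gauss_g \<beta> u)" if "u \<in> {0..<1}" for u
  proof -
    have "(\<lambda>n. complex_of_real (?h n * u ^ n)) sums f (of_real u)"
      using fs[of "of_real u"] that by simp
    moreover have "summable (\<lambda>n. ?h n * u ^ n)"
      by (rule summable_comparison_test'[OF sm, of 0])
        (use that in \<open>auto simp: abs_mult power_abs intro!: mult_left_le power_le_one\<close>)
    then have "(\<lambda>n. complex_of_real (?h n * u ^ n)) sums of_real (gauss_g \<beta> u)"
      unfolding gauss_g_def sums_of_real_iff by (rule summable_sums)
    ultimately show ?thesis by (rule sums_unique2)
  qed
  have fh: "f holomorphic_on ball 0 1"
    by (rule power_series_holomorphic[where a = "\<lambda>n. of_real (?h n)"]) (use fs in simp)
  define W where "W = {t :: complex. norm (t * of_real x) < 1}"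
  have W: "open W" "convex W" "\<And>s. s \<in> {0..1} \<Longrightarrow> of_real s \<in> W"
  proof -
    show "open W" unfolding W_def by (intro open_Collect_less continuous_intros)
    have "W = (\<lambda>t. t * of_real x) -` ball 0 1" by (auto simp: W_def)
    then show "convex W"
      by (simp add: convex_linear_vimage bounded_linear.linear bounded_linear_mult_left)
    show "of_real s \<in> W" if "s \<in> {0..1}" for s
      using unit_scale[OF that x] by (simp add: W_def flip: of_real_mult)
  qed
  have zero: "(0::real) \<in> {0..<1}" by simp
  have "(\<lambda>t. f (t * of_real x)) 1 = 1 * G (vector [of_real x, of_real 0, of_real 0])"
  proof (rule ray_unique[OF x zero zero W])
    have "(f \<circ> (\<lambda>t. t * of_real x)) holomorphic_on W"
      by (rule holomorphic_on_compose_gen[OF _ fh]) (auto simp: W_def intro!: holomorphic_intros)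
    then show "(\<lambda>t. f (t * of_real x)) holomorphic_on W" by (simp add: o_def)
    fix N
    show "eqO N (\<lambda>t. f (of_real t * of_real x)) (\<lambda>t. 1 * of_real (ray_sum N x 0 0 t))"
    proof (rule eqO_boundI)
      fix t :: real assume t: "0 < t" "t < 1"
      define u where "u = t * x"
      have u: "u \<in> {0..<1}" "u \<le> t" using t x unit_scale[of t x] by (auto simp: u_def mult_left_le)
      have su: "summable (\<lambda>n. ?h n * u ^ n)"
        by (rule summable_comparison_test'[OF sm, of 0])
          (use u in \<open>auto simp: abs_mult power_abs intro!: mult_left_le power_le_one\<close>)
      have r: "ray_sum N x 0 0 t = (\<Sum>n<N. ?h n * u ^ n)"
      proof (cases N)
        case (Suc m)
        have "ray_sum N x 0 0 t = (\<Sum>i<N. a i 0 0 * u ^ i)"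
          unfolding ray_sum_def Suc sum.lessThan_Suc_shift[of _ m] u_def by simp
        then show ?thesis using neighbor_array_axis[OF arr b] by simp
      qed (simp add: ray_sum_def)
      have fu: "f (of_real t * of_real x) = of_real (gauss_g \<beta> u)"
        using fr[OF u(1)] by (simp add: u_def)
      have "norm (f (of_real t * of_real x) - of_real (ray_sum N x 0 0 t)) = norm (gauss_g \<beta> u - (\<Sum>n<N. ?h n * u ^ n))"
        unfolding fu r of_real_diff[symmetric] norm_of_real real_norm_def ..
      also have "\<dots> = norm (\<Sum>n. ?h (n + N) * u ^ (n + N))"
        using suminf_split_initial_segment[OF su, of N] by (simp add: gauss_g_def)
      also have "\<dots> \<le> (\<Sum>n. t ^ N * \<bar>?h (n + N)\<bar>)"
      proof (rule norm_suminf_le)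
        show "summable (\<lambda>n. t ^ N * \<bar>?h (n + N)\<bar>)"
          by (intro summable_mult summable_ignore_initial_segment[OF sm])
        fix n
        have "u ^ (n + N) \<le> t ^ (n + N)" using u by (intro power_mono) auto
        also have "\<dots> \<le> t ^ N" using t by (intro power_decreasing) auto
        finally have "\<bar>?h (n + N)\<bar> * u ^ (n + N) \<le> \<bar>?h (n + N)\<bar> * t ^ N" by (intro mult_left_mono) auto
        moreover have "norm (?h (n + N) * u ^ (n + N)) = \<bar>?h (n + N)\<bar> * u ^ (n + N)"
          using u by (simp add: abs_mult)
        ultimately show "norm (?h (n + N) * u ^ (n + N)) \<le> t ^ N * \<bar>?h (n + N)\<bar>"
          by (simp only: mult.commute)
      qed
      also have "\<dots> = (\<Sum>n. \<bar>?h (n + N)\<bar>) * t ^ N"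
        using suminf_mult[OF summable_ignore_initial_segment[OF sm, of N], of "t ^ N"] by (simp add: mult.commute)
      finally show "norm (f (of_real t * of_real x) - 1 * of_real (ray_sum N x 0 0 t)) \<le> (\<Sum>n. \<bar>?h (n + N)\<bar>) * t ^ N"
        by simp
    qed simp
  qed
  then show ?thesis using fr[OF x] by simp
qed

lemma translation_formula_real:
  assumes xyz: "x \<in> {0..<1}" "y \<in> {0..<1}" "z \<in> {0..<1}"
    and h: "\<And>X. X \<in> {0..<1} \<Longrightarrow> G (vector [of_real X, 0, of_real z]) = of_real (h X)" "continuous_on {0..1} h"
  shows "G (vector [of_real x, of_real y, of_real z]) = of_real (transl \<beta> h x y)"
proof -
  have b: "\<beta> > 1 / 2" and gn: "gnorm (4 * \<beta> - 2) \<noteq> 0"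
    using \<beta> gnorm_pos[of "4 * \<beta> - 2"] by auto
  have "of_real (gnorm (4 * \<beta> - 2)) * G (vector [of_real x, of_real y, of_real z]) =
      integral {0..pi} (\<lambda>\<theta>. of_real (sin \<theta> powr (4 * \<beta> - 2) * gkern (sqrt (x * y)) \<theta> powr (- \<beta>) * h (txpt x y \<theta>)))"
    unfolding translation_formula[OF xyz] h(1)[OF txpt_mem_half_open[OF xyz(1,2)]] of_real_mult ..
  also have "\<dots> = of_real (gnorm (4 * \<beta> - 2) * transl \<beta> h x y)"
    unfolding integral_complex_of_real_HK[OF transl_integrand_integrable[OF b xyz(1,2) h(2)]] transl_def
    using gn by simp
  finally show ?thesis using gn by simp
qed

text \<open>The translation formula produces G(x, z, 0) from the axis; symmetry moves the zero to
  the middle slot, where the second translation expects it.\<close>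

lemma G_plane:
  assumes x: "x \<in> {0..<1}" and z: "z \<in> {0..<1}"
  shows "G (vector [of_real x, 0, of_real z]) = of_real (plane_fn \<beta> x z)"
proof -
  have zero: "(0::real) \<in> {0..<1}" by simp
  have "G (vector [of_real x, of_real z, of_real 0]) = of_real (plane_fn \<beta> x z)"
    unfolding plane_fn_def
    by (rule translation_formula_real[OF x z zero _ continuous_gauss_g[OF \<beta>]]) (use G_axis in simp)
  then show ?thesis using G_swap(2)[OF x z zero] by simp
qed

lemma G_cube:
  assumes xyz: "x \<in> {0..<1}" "y \<in> {0..<1}" "z \<in> {0..<1}"
  shows "G (vector [of_real x, of_real y, of_real z]) = of_real (cube_fn \<beta> x y z)"
  unfolding cube_fn_def
proof (rule translation_formula_real[OF xyz])
  have "continuous_on {0..1} (\<lambda>x. case (x, z) of (x, z) \<Rightarrow> plane_fn \<beta> x z)"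
    by (rule continuous_on_compose2[OF continuous_plane_fn[OF \<beta>]]) (use xyz in \<open>auto intro!: continuous_intros\<close>)
  then show "continuous_on {0..1} (\<lambda>X. plane_fn \<beta> X z)" by simp
qed (rule G_plane[OF _ xyz(3)])

text \<open>The iterated integral does not display this symmetry. It is inherited from G on the
  half-open cube and passes to the closed cube by density.\<close>

lemma cube_fn_swap:
  assumes "x \<in> {0..1}" "y \<in> {0..1}" "z \<in> {0..1}"
  shows "cube_fn \<beta> x y z = cube_fn \<beta> z y x" "cube_fn \<beta> x y z = cube_fn \<beta> x z y"
proof -
  let ?H = "{0..<1} \<times> {0..<1} \<times> {0..<1} :: (real \<times> real \<times> real) set"
  let ?C = "{0..1} \<times> {0..1} \<times> {0..1} :: (real \<times> real \<times> real) set"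
  have cl: "closure ?H = ?C" by (simp add: closure_Times)
  have c: "continuous_on ?C (\<lambda>p. cube_fn \<beta> (fst p) (fst (snd p)) (snd (snd p)))"
    using continuous_cube_fn[OF \<beta>] by (simp add: split_def)
  have c1: "continuous_on ?C (\<lambda>p. cube_fn \<beta> (snd (snd p)) (fst (snd p)) (fst p))"
    by (rule continuous_on_compose2[OF c, where f = "\<lambda>p. (snd (snd p), fst (snd p), fst p)", simplified]) (auto intro!: continuous_intros)
  have c2: "continuous_on ?C (\<lambda>p. cube_fn \<beta> (fst p) (snd (snd p)) (fst (snd p)))"
    by (rule continuous_on_compose2[OF c, where f = "\<lambda>p. (fst p, snd (snd p), fst (snd p))", simplified]) (auto intro!: continuous_intros)
  have s: "cube_fn \<beta> u v w = cube_fn \<beta> w v u" "cube_fn \<beta> u v w = cube_fn \<beta> u w v"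
    if "u \<in> {0..<1}" "v \<in> {0..<1}" "w \<in> {0..<1}" for u v w
  proof -
    have "complex_of_real (cube_fn \<beta> u v w) = of_real (cube_fn \<beta> w v u)"
      unfolding G_cube[OF that, symmetric] G_cube[OF that(3,2,1), symmetric] by (rule G_swap(1)[OF that, symmetric])
    then show "cube_fn \<beta> u v w = cube_fn \<beta> w v u" by (rule of_real_eq_iff[THEN iffD1])
    have "complex_of_real (cube_fn \<beta> u v w) = of_real (cube_fn \<beta> u w v)"
      unfolding G_cube[OF that, symmetric] G_cube[OF that(1,3,2), symmetric] by (rule G_swap(2)[OF that, symmetric])
    then show "cube_fn \<beta> u v w = cube_fn \<beta> u w v" by (rule of_real_eq_iff[THEN iffD1])
  qed
  have "(\<lambda>p. cube_fn \<beta> (fst p) (fst (snd p)) (snd (snd p)) - cube_fn \<beta> (snd (snd p)) (fst (snd p)) (fst p)) (x, y, z) = 0"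
    by (rule continuous_constant_on_closure[where S = ?H], unfold cl)
      (use s(1) assms in \<open>auto intro!: continuous_on_diff c c1\<close>)
  then show "cube_fn \<beta> x y z = cube_fn \<beta> z y x" by simp
  have "(\<lambda>p. cube_fn \<beta> (fst p) (fst (snd p)) (snd (snd p)) - cube_fn \<beta> (fst p) (snd (snd p)) (fst (snd p))) (x, y, z) = 0"
    by (rule continuous_constant_on_closure[where S = ?H], unfold cl)
      (use s(2) assms in \<open>auto intro!: continuous_on_diff c c2\<close>)
  then show "cube_fn \<beta> x y z = cube_fn \<beta> x z y" by simp
qed

lemma cube_fn_faces:
  assumes r: "r \<in> closed_cube" and l: "r $ l = 1"
  shows "cube_fn \<beta> (r $ 1) (r $ 2) (r $ 3) = gauss_g \<beta> 1 * (\<Prod>j\<in>UNIV - {l}. f_beta \<beta> (r $ j))"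
proof -
  have m: "r $ i \<in> {0..1}" for i using r by (simp add: closed_cube_def)
  have one: "(1::real) \<in> {0..1}" by simp
  have "l = 1 \<or> l = 2 \<or> l = 3" by (rule exhaust_3)
  then show ?thesis
  proof (elim disjE)
    assume l1: "l = 1"
    have "UNIV - {l} = {2, 3 :: 3}" unfolding UNIV_3 l1 by auto
    then show ?thesis using l cube_fn_1[OF \<beta> m[of 2] m[of 3]] by (simp add: l1 mult.assoc)
  next
    assume l2: "l = 2"
    have "UNIV - {l} = {1, 3 :: 3}" unfolding UNIV_3 l2 by auto
    moreover have "cube_fn \<beta> (r $ 1) 1 (r $ 3) = cube_fn \<beta> 1 (r $ 3) (r $ 1)"
      using cube_fn_swap(2)[OF m[of 1] one m[of 3]] cube_fn_swap(1)[OF m[of 1] m[of 3] one] by simp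
    ultimately show ?thesis using l cube_fn_1[OF \<beta> m[of 3] m[of 1]] by (simp add: l2 mult_ac)
  next
    assume l3: "l = 3"
    have "UNIV - {l} = {1, 2 :: 3}" unfolding UNIV_3 l3 by auto
    moreover have "cube_fn \<beta> (r $ 1) (r $ 2) 1 = cube_fn \<beta> 1 (r $ 2) (r $ 1)"
      using cube_fn_swap(1)[OF m[of 1] m[of 2] one] by simp
    ultimately show ?thesis using l cube_fn_1[OF \<beta> m[of 2] m[of 1]] by (simp add: l3 mult_ac)
  qed
qed

end

theorem theorem6p1:
  fixes \<beta> :: real and F :: "real ^ 3 \<Rightarrow> complex"
  assumes "\<beta> \<ge> 2 / 3"
    and "neighbor_function \<beta> F"
  shows "\<exists>Fbar :: real ^ 3 \<Rightarrow> complex.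
           continuous_on closed_cube Fbar \<and>
           (\<forall>r\<in>half_open_cube. Fbar r = F r) \<and>
           (\<forall>l :: 3. \<forall>r\<in>closed_cube. r $ l = 1 \<longrightarrow>
              Fbar r = complex_of_real
                (Gamma (2 * \<beta>) * Gamma (3 * \<beta> - 1) / (Gamma \<beta> * Gamma (4 * \<beta> - 1))
                  * (\<Prod>j\<in>UNIV - {l}. f_beta \<beta> (r $ j))))"
proof -
  obtain A B U G where nc: "neighbor_coeffs \<beta> A B" and U: "complex_vec ` half_open_cube \<subseteq> U"
    and G: "analytic3_on G U"
    and hs: "\<forall>r\<in>small_polydisc. ((\<lambda>n. complex_of_real (A n) * monomial3 r n) has_sum G r) UNIV"
    and F: "\<forall>r\<in>half_open_cube. F r = G (complex_vec r)"
    using assms(2) unfolding neighbor_function_def by (elim exE conjE)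
  have b: "\<beta> > 0" using assms(1) by simp
  interpret neighbor_extension \<beta> A G U
    by unfold_locales (use assms(1) neighbor_array_ext_array[OF nc b] G U hs in auto)
  define Fbar where "Fbar = (\<lambda>r :: real ^ 3. complex_of_real (cube_fn \<beta> (r $ 1) (r $ 2) (r $ 3)))"
  have "continuous_on closed_cube (\<lambda>r. case (r $ 1, r $ 2, r $ 3) of (x, y, z) \<Rightarrow> cube_fn \<beta> x y z)"
    by (rule continuous_on_compose2[OF continuous_cube_fn[OF assms(1)]])
      (auto simp: closed_cube_def intro!: continuous_intros)
  then have "continuous_on closed_cube Fbar"
    unfolding Fbar_def by (intro continuous_on_of_real) simp
  moreover have "Fbar r = F r" if r: "r \<in> half_open_cube" for r
  proof -
    have "complex_vec r = vector [of_real (r $ 1), of_real (r $ 2), of_real (r $ 3)]"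
      by (simp add: complex_vec_def vec_eq_iff forall_3)
    moreover have "G (vector [of_real (r $ 1), of_real (r $ 2), of_real (r $ 3)]) = Fbar r"
      unfolding Fbar_def by (rule G_cube) (use r in \<open>auto simp: half_open_cube_def\<close>)
    ultimately show ?thesis using F r by simp
  qed
  moreover have "Fbar r = complex_of_real
      (Gamma (2 * \<beta>) * Gamma (3 * \<beta> - 1) / (Gamma \<beta> * Gamma (4 * \<beta> - 1)) * (\<Prod>j\<in>UNIV - {l}. f_beta \<beta> (r $ j)))"
    if "r \<in> closed_cube" "r $ l = 1" for r l
    unfolding Fbar_def cube_fn_faces[OF that] gauss_g_1[OF assms(1)] ..
  ultimately show ?thesis by (intro exI[of _ Fbar] conjI ballI allI impI)
qed

end
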